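(* Let $\gamma>0$, $\tau=i\pi/\gamma^2$. Writing $$v(t)=\sum_{n\in\mathbb Z}c_n(t)\psi_n,\qquad f(t,\xi)=\sum_{n\in\mathbb Z}c_n(t)e^{-2\pi in\xi},$$ the equation $i\partial_tv+\lambda v=\Pi\big[2|\Phi_0|^2v+\Phi_0^2\,\overline v\big]$ becomes $$i\partial_t\begin{pmatrix}f(t,\xi)\\ \overline f(t,-\xi)\end{pmatrix}=A_{\mathrm{rect}}(\xi)\begin{pmatrix}f(t,\xi)\\ \overline f(t,-\xi)\end{pmatrix}$$ for the $2\times2$ matrix $A_{\mathrm{rect}}(\xi)$ given in the context. The matrix $A_{\mathrm{rect}}(\xi)$ can be diagonalized for $\xi\neq0$ (modulo $1$), resulting in $$A_{\mathrm{rect}}(\xi)=P(\xi)\begin{pmatrix}\mu(\xi)&0\\0&-\mu(\xi)\end{pmatrix}P^{-1}(\xi).$$ Furthermore: - For any $\gamma>0$, $\mu(\xi)\in i\mathbb R\setminus\{0\}$ if $\xi$ is close to $0$, but $\xi\neq0$. - If $\tau=i$ (square lattice, i.e. $\gamma^2=\pi$), then $\mu(\xi)\in i\mathbb R\setminus\{0\}$ for any $\xi\neq0$ (modulo $1$). In particular, all rectangular lattices are exponentially unstable in $L^2(S_\gamma)\cap\mathcal F_\gamma$.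
   Context: $L$ is Lebesgue measure on $\mathbb C$. For a function $u$ on $\mathbb C$ of at most polynomial growth, $[\Pi u](z)=\frac1\pi e^{-|z|^2/2}\int_{\mathbb C}e^{\overline w z-|w|^2/2}u(w)\,dL(w)$. $\widetilde{\mathcal E}$ is the set of functions $u(z)=e^{-|z|^2/2}F(z)$ with $F$ entire such that $|u(z)|\lesssim\langle z\rangle^M$ for some $M$; $R_\alpha u(z)=e^{(\alpha\overline z-\overline\alpha z)/2}u(z+\alpha)$; $\mathcal F_\gamma=\{u\in\widetilde{\mathcal E}:R_\gamma u=u\}$; $S_\gamma=\{z:-\gamma/2<\mathrm{Re}\,z\le\gamma/2\}$. A Hilbert basis of $L^2(S_\gamma)\cap\mathcal F_\gamma$ is $$\psi_n(z)=\Big(\frac2{\pi\gamma^2}\Big)^{1/4}\exp\Big(-\frac{\pi^2n^2}{\gamma^2}+\frac{2in\pi}\gamma z+\frac{z^2}2-\frac{|z|^2}2\Big),\quad n\in\mathbb Z.$$ The rectangular lattice solution of $i\partial_tu=\Pi(|u|^2u)$ is $e^{-i\lambda t}\Phi_0$ with $$\Phi_0=\Big(\frac{\pi\gamma^2}2\Big)^{1/4}e^{\pi^2/(4\gamma^2)}\sum_{n\in\mathbb Z}\psi_n ,$$ and the equation for $v$ in the claim is the linearization around it (after factoring out the phase $e^{-i\lambda t}$). Set $\ell(\xi)=1+2\sum_{k\ge1}e^{-\pi^2k^2/\gamma^2}\cos(2\pi k\xi)$, $C_M=\frac1{\sqrt2}e^{\pi^2/(2\gamma^2)}$, $\lambda=C_M\ell^2(0)$,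 $a(\xi)=C_M\ell(0)(2\ell(\xi)-\ell(0))$, $b(\xi)=C_M\ell^2(\xi)$, $$A_{\mathrm{rect}}(\xi)=\begin{pmatrix}a(\xi)&b(\xi)\\-b(\xi)&-a(\xi)\end{pmatrix},\qquad \mu(\xi)=\sqrt{-\det A_{\mathrm{rect}}(\xi)}=\sqrt{a^2(\xi)-b^2(\xi)},$$ with the convention that $\mathrm{Im}\sqrt x\ge0$ if $x\le0$, and $$P(\xi)=\begin{pmatrix}b(\xi)&b(\xi)\\ \mu(\xi)-a(\xi)&-\mu(\xi)-a(\xi)\end{pmatrix}.$$ All these functions are $1$-periodic in $\xi$. "Exponentially unstable in $L^2(S_\gamma)\cap\mathcal F_\gamma$" means: there exist $v_0\in L^2(S_\gamma)\cap\mathcal F_\gamma$ and $c,\sigma>0$ such that the solution $v$ of the linearized equation with $v(0)=v_0$ satisfies $\|v(t)\|_{L^2(S_\gamma)}\ge c\,e^{\sigma t}$ for all $t\ge0$.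
   Formalization: The diagonalization is proved for ξ≠0 (mod 1) with a(ξ)+b(ξ)≠0: for large γ (e.g. γ=3) some ξ≠0 (mod 1) has a(ξ)+b(ξ)=0, where μ(ξ)=0, A_rect(ξ) is nonzero nilpotent and P(ξ) is singular. *)

theory Defs
  imports "HOL-Analysis.Analysis"
begin

text \<open>Elements of \<open>L\<^sup>2\<close> are represented by functions, not by equivalence classes.\<close>

definition square_integrable :: "'a measure \<Rightarrow> ('a \<Rightarrow> 'b::real_normed_vector) \<Rightarrow> bool" where
  "square_integrable M u \<longleftrightarrow> u \<in> borel_measurable M \<and> integrable M (\<lambda>x. (norm (u x))\<^sup>2)"

definition L2norm :: "'a measure \<Rightarrow> ('a \<Rightarrow> 'b::real_normed_vector) \<Rightarrow> real" where
  "L2norm M u = sqrt (LINT x|M. (norm (u x))\<^sup>2)"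

text \<open>\<open>u = (\<Sum>n\<in>\<int>. c n e n)\<close> with unconditional convergence in \<open>L\<^sup>2(M)\<close>.\<close>

definition L2_expansion ::
    "'a measure \<Rightarrow> (int \<Rightarrow> 'a \<Rightarrow> complex) \<Rightarrow> (int \<Rightarrow> complex) \<Rightarrow> ('a \<Rightarrow> complex) \<Rightarrow> bool" where
  "L2_expansion M e c u \<longleftrightarrow> square_integrable M u \<and>
     ((\<lambda>F. L2norm M (\<lambda>x. u x - (\<Sum>n\<in>F. c n * e n x))) \<longlongrightarrow> 0) (finite_subsets_at_top UNIV)"

text \<open>The curve \<open>u :: T \<rightarrow> L\<^sup>2(M)\<close> is differentiable at \<open>t\<close> (relative to the set \<open>T\<close> of times)
  with derivative \<open>u'\<close>, the difference quotients converging in \<open>L\<^sup>2(M)\<close>.\<close>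

definition has_L2_derivative ::
    "'a measure \<Rightarrow> (real \<Rightarrow> 'a \<Rightarrow> 'b::real_normed_vector) \<Rightarrow> ('a \<Rightarrow> 'b) \<Rightarrow> real \<Rightarrow> real set \<Rightarrow> bool" where
  "has_L2_derivative M u u' t T \<longleftrightarrow>
     (\<forall>s\<in>T. square_integrable M (u s)) \<and> square_integrable M u' \<and>
     ((\<lambda>s. L2norm M (\<lambda>x. (u s x - u t x) /\<^sub>R (s - t) - u' x)) \<longlongrightarrow> 0) (at t within T)"

definition Proj :: "(complex \<Rightarrow> complex) \<Rightarrow> complex \<Rightarrow> complex" where
  "Proj u z = of_real (1 / pi * exp (- (cmod z)\<^sup>2 / 2)) *
     (LINT w|lebesgue. exp (cnj w * z - of_real ((cmod w)\<^sup>2 / 2)) * u w)"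

definition japanese :: "complex \<Rightarrow> real" where
  "japanese z = sqrt (1 + (cmod z)\<^sup>2)"

definition Etilde :: "(complex \<Rightarrow> complex) set" where
  "Etilde = {u. (\<exists>F. F holomorphic_on UNIV \<and> (\<forall>z. u z = of_real (exp (- (cmod z)\<^sup>2 / 2)) * F z)) \<and>
                (\<exists>C M. \<forall>z. cmod (u z) \<le> C * japanese z powr M)}"

definition R :: "complex \<Rightarrow> (complex \<Rightarrow> complex) \<Rightarrow> complex \<Rightarrow> complex" where
  "R \<alpha> u z = exp ((\<alpha> * cnj z - cnj \<alpha> * z) / 2) * u (z + \<alpha>)"

definition Fspace :: "real \<Rightarrow> (complex \<Rightarrow> complex) set" where
  "Fspace \<gamma> = {u \<in> Etilde. R (of_real \<gamma>) u = u}"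

definition strip :: "real \<Rightarrow> complex set" where
  "strip \<gamma> = {z. - \<gamma> / 2 < Re z \<and> Re z \<le> \<gamma> / 2}"

definition L2F :: "real \<Rightarrow> (complex \<Rightarrow> complex) set" where
  "L2F \<gamma> = {u \<in> Fspace \<gamma>. square_integrable (lebesgue_on (strip \<gamma>)) u}"

definition psi :: "real \<Rightarrow> int \<Rightarrow> complex \<Rightarrow> complex" where
  "psi \<gamma> n z = of_real ((2 / (pi * \<gamma>\<^sup>2)) powr (1/4)) *
     exp (- of_real (pi\<^sup>2 * (of_int n)\<^sup>2 / \<gamma>\<^sup>2) + 2 * \<i> * of_int n * of_real (pi / \<gamma>) * z
          + z\<^sup>2 / 2 - of_real ((cmod z)\<^sup>2 / 2))"

definition Phi0 :: "real \<Rightarrow> complex \<Rightarrow> complex" where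
  "Phi0 \<gamma> z = of_real ((pi * \<gamma>\<^sup>2 / 2) powr (1/4) * exp (pi\<^sup>2 / (4 * \<gamma>\<^sup>2))) *
     (\<Sum>\<^sub>\<infinity>n\<in>UNIV. psi \<gamma> n z)"

definition ell :: "real \<Rightarrow> real \<Rightarrow> real" where
  "ell \<gamma> \<xi> = 1 + 2 * (\<Sum>k. exp (- pi\<^sup>2 * (real (Suc k))\<^sup>2 / \<gamma>\<^sup>2) * cos (2 * pi * real (Suc k) * \<xi>))"

definition C_M :: "real \<Rightarrow> real" where
  "C_M \<gamma> = 1 / sqrt 2 * exp (pi\<^sup>2 / (2 * \<gamma>\<^sup>2))"

definition lam :: "real \<Rightarrow> real" where
  "lam \<gamma> = C_M \<gamma> * (ell \<gamma> 0)\<^sup>2"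

definition a_rect :: "real \<Rightarrow> real \<Rightarrow> real" where
  "a_rect \<gamma> \<xi> = C_M \<gamma> * ell \<gamma> 0 * (2 * ell \<gamma> \<xi> - ell \<gamma> 0)"

definition b_rect :: "real \<Rightarrow> real \<Rightarrow> real" where
  "b_rect \<gamma> \<xi> = C_M \<gamma> * (ell \<gamma> \<xi>)\<^sup>2"

definition A_rect :: "real \<Rightarrow> real \<Rightarrow> complex^2^2" where
  "A_rect \<gamma> \<xi> = vector [vector [of_real (a_rect \<gamma> \<xi>), of_real (b_rect \<gamma> \<xi>)],
                         vector [- of_real (b_rect \<gamma> \<xi>), - of_real (a_rect \<gamma> \<xi>)]]"

text \<open>The principal root \<^const>\<open>csqrt\<close> has nonnegative imaginary part on the nonpositive reals.\<close>

definition mu :: "real \<Rightarrow> real \<Rightarrow> complex" where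
  "mu \<gamma> \<xi> = csqrt (- det (A_rect \<gamma> \<xi>))"

definition P_rect :: "real \<Rightarrow> real \<Rightarrow> complex^2^2" where
  "P_rect \<gamma> \<xi> =
     vector [vector [of_real (b_rect \<gamma> \<xi>), of_real (b_rect \<gamma> \<xi>)],
             vector [mu \<gamma> \<xi> - of_real (a_rect \<gamma> \<xi>), - mu \<gamma> \<xi> - of_real (a_rect \<gamma> \<xi>)]]"

definition D_rect :: "real \<Rightarrow> real \<Rightarrow> complex^2^2" where
  "D_rect \<gamma> \<xi> = vector [vector [mu \<gamma> \<xi>, 0], vector [0, - mu \<gamma> \<xi>]]"

text \<open>\<open>i v\<^sub>t + \<lambda> v = \<Pi>[2|\<Phi>\<^sub>0|\<^sup>2 v + \<Phi>\<^sub>0\<^sup>2 v\<^sup>*]\<close> on a set \<open>T\<close> of times, for a curve in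
  \<open>L\<^sup>2(S\<^sub>\<gamma>) \<inter> F\<^sub>\<gamma>\<close> that is differentiable for the norm of that space.\<close>

definition solves_linearized :: "real \<Rightarrow> real set \<Rightarrow> (real \<Rightarrow> complex \<Rightarrow> complex) \<Rightarrow> bool" where
  "solves_linearized \<gamma> T v \<longleftrightarrow> (\<forall>t\<in>T. v t \<in> L2F \<gamma>) \<and>
     (\<forall>t\<in>T. \<exists>v'\<in>L2F \<gamma>. has_L2_derivative (lebesgue_on (strip \<gamma>)) v v' t T \<and>
        (\<forall>z. \<i> * v' z + of_real (lam \<gamma>) * v t z =
             Proj (\<lambda>w. 2 * of_real ((cmod (Phi0 \<gamma> w))\<^sup>2) * v t w + (Phi0 \<gamma> w)\<^sup>2 * cnj (v t w)) z))"

definition conj_pair :: "(real \<Rightarrow> complex) \<Rightarrow> real \<Rightarrow> complex^2" where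
  "conj_pair f \<xi> = vector [f \<xi>, cnj (f (- \<xi>))]"

text \<open>\<open>i w\<^sub>t = A\<^sub>r\<^sub>e\<^sub>c\<^sub>t w\<close> for \<open>w = (f(t,\<xi>), f\<^sup>*(t,-\<xi>))\<close>, as an equation in \<open>L\<^sup>2\<close> of a period.\<close>

definition solves_fourier :: "real \<Rightarrow> real set \<Rightarrow> (real \<Rightarrow> real \<Rightarrow> complex) \<Rightarrow> bool" where
  "solves_fourier \<gamma> T f \<longleftrightarrow>
     (\<forall>t\<in>T. \<exists>w'. has_L2_derivative (lebesgue_on {0..1}) (\<lambda>s. conj_pair (f s)) w' t T \<and>
        (AE \<xi> in lebesgue_on {0..1}. \<i> *s w' \<xi> = A_rect \<gamma> \<xi> *v conj_pair (f t) \<xi>))"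

definition exponentially_unstable :: "real \<Rightarrow> bool" where
  "exponentially_unstable \<gamma> \<longleftrightarrow>
     (\<exists>v0\<in>L2F \<gamma>. \<exists>c>0. \<exists>\<sigma>>0.
        (\<exists>v. solves_linearized \<gamma> {0..} v \<and> v 0 = v0) \<and>
        (\<forall>v. solves_linearized \<gamma> {0..} v \<and> v 0 = v0 \<longrightarrow>
           (\<forall>t\<ge>0. L2norm (lebesgue_on (strip \<gamma>)) (v t) \<ge> c * exp (\<sigma> * t))))"

end

theory Submission
  imports Defs "HOL-Probability.Probability" "HOL-Complex_Analysis.Complex_Analysis"
begin

text \<open>Multiplying \<open>u \<in> F\<^sub>\<gamma>\<close> by \<open>exp (|z|\<^sup>2/2 - z\<^sup>2/2)\<close> gives a \<open>\<gamma>\<close>-periodic entire function, so along every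
  horizontal line the \<open>n\<close>-th Fourier coefficient of \<open>u\<close> is a fixed multiple of the Gaussian of \<open>\<psi>\<^sub>n\<close>;
  hence \<open>u = (\<Sum>n. \<langle>u, \<psi>\<^sub>n\<rangle> \<psi>\<^sub>n)\<close> pointwise. A Gaussian integral yields
  \<open>\<Pi>(\<psi>\<^sub>j \<psi>\<^sub>k \<psi>\<^sub>n\<^sup>*) = \<kappa> exp (- \<pi>\<^sup>2 (p\<^sup>2 + q\<^sup>2) / \<gamma>\<^sup>2) \<psi>\<^sub>m\<close> with \<open>m = j + k - n\<close>, \<open>p = j - m\<close>, \<open>q = k - m\<close>, so
  the linearized operator acts on coefficients by convolution with theta weights, that is on the
  Fourier side by \<open>A\<^sub>r\<^sub>e\<^sub>c\<^sub>t\<close>, and Parseval carries \<open>L\<^sup>2\<close>-differentiability across.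
  Since \<open>b - a\<close> is a positive multiple of \<open>(l(0) - l(\<xi>))\<^sup>2\<close>, which is positive off the integers, \<open>\<mu>\<close> is
  imaginary wherever \<open>a + b > 0\<close>; a packet of such modes near \<open>\<xi> = 0\<close> grows exponentially.\<close>

section \<open>Orthonormal families in \<open>L\<^sup>2\<close>\<close>

text \<open>The conjugate of \<open>v\<close> makes the linearized equation linear over the reals
  only. Pairing f(\<xi>) with the conjugate of f(-\<xi>) restores complex linearity at fixed \<xi>:
  conjugation sends frequency n to -n and reflection sends it back, so both entries are governed by
  coefficients of the same index.

  \<open>Phi0\<close> has constant coefficients, which are not square-summable; for this reason
  basis series are studied for merely bounded coefficients, and the cubic projection is computed
  there by absolute convergence.

  Invertibility of \<open>P_rect\<close> requires b and \<mu> to be nonzero, since det P = -2 b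
  \<mu>. The former says that the theta function has no real zero. The latter fails off the integers
  exactly where a + b = 0; there \<open>A_rect\<close> is a nonzero nilpotent matrix, so the
  diagonalization is stated away from such points.

  Instability quantifies over every solution with the given initial value. An explicit growing
  packet therefore has to be accompanied by uniqueness, which is proved in the supremum norm of the
  coefficients, where Gaussian convolution is visibly bounded.\<close>

lemma integrable_bound_real:
  fixes f :: "'a \<Rightarrow> real" and g :: "'a \<Rightarrow> 'b::{banach,second_countable_topology}"
  assumes "integrable M f" "g \<in> borel_measurable M" "\<And>x. norm (g x) \<le> f x"
  shows "integrable M g"
  using assms(1,2)
proof (rule Bochner_Integration.integrable_bound)
  have "norm (g x) \<le> norm (f x)" for x
    using assms(3)[of x] by simp
  then show "AE x in M. norm (g x) \<le> norm (f x)"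
    by (rule AE_I2)
qed

lemma norm_add_sq_le: "(norm (a + b))\<^sup>2 \<le> 2 * (norm a)\<^sup>2 + 2 * (norm b)\<^sup>2"
proof -
  have "(norm (a + b))\<^sup>2 \<le> (norm a + norm b)\<^sup>2"
    by (intro power_mono norm_triangle_ineq norm_ge_zero)
  also have "\<dots> = (norm a)\<^sup>2 + (norm b)\<^sup>2 + 2 * norm a * norm b"
    by (rule power2_sum)
  also have "\<dots> \<le> 2 * (norm a)\<^sup>2 + 2 * (norm b)\<^sup>2"
    using sum_squares_bound[of "norm a" "norm b"] by linarith
  finally show ?thesis .
qed

lemma square_integrable_add:
  fixes u v :: "'a \<Rightarrow> 'b::{real_normed_vector,second_countable_topology}"
  assumes u: "square_integrable M u" and v: "square_integrable M v"
  shows "square_integrable M (\<lambda>x. u x + v x)"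
proof -
  have [measurable]: "u \<in> borel_measurable M" "v \<in> borel_measurable M"
    using u v by (simp_all add: square_integrable_def)
  have i: "integrable M (\<lambda>x. 2 * (norm (u x))\<^sup>2 + 2 * (norm (v x))\<^sup>2)"
    using u v by (simp add: square_integrable_def)
  have "integrable M (\<lambda>x. (norm (u x + v x))\<^sup>2)"
    by (rule integrable_bound_real[OF i]) (use norm_add_sq_le in simp_all)
  then show ?thesis by (simp add: square_integrable_def)
qed

lemma norm_mult_sq_le:
  fixes a b :: complex
  assumes "norm a \<le> B"
  shows "(norm (a * b))\<^sup>2 \<le> B\<^sup>2 * (norm b)\<^sup>2"
proof -
  have "norm (a * b) \<le> B * norm b"
    unfolding norm_mult by (rule mult_right_mono[OF assms]) simp
  from power_mono[OF this, of 2] show ?thesis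
    by (simp only: power_mult_distrib) simp
qed

lemma square_integrable_bounded_mult:
  fixes u :: "'a \<Rightarrow> complex"
  assumes u: "square_integrable M u" and [measurable]: "g \<in> borel_measurable M"
    and B: "\<And>x. norm (g x) \<le> B"
  shows "square_integrable M (\<lambda>x. g x * u x)"
proof -
  have [measurable]: "u \<in> borel_measurable M"
    using u by (simp add: square_integrable_def)
  have i: "integrable M (\<lambda>x. B\<^sup>2 * (norm (u x))\<^sup>2)"
    using u by (simp add: square_integrable_def)
  have "integrable M (\<lambda>x. (norm (g x * u x))\<^sup>2)"
    by (rule integrable_bound_real[OF i]) (use norm_mult_sq_le[OF B] in simp_all)
  then show ?thesis by (simp add: square_integrable_def)
qed

lemma square_integrable_cmult:
  fixes u :: "'a \<Rightarrow> complex"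
  shows "square_integrable M u \<Longrightarrow> square_integrable M (\<lambda>x. c * u x)"
  by (rule square_integrable_bounded_mult[of M u "\<lambda>_. c" "norm c"]) auto

lemma square_integrable_scaleR:
  fixes u :: "'a \<Rightarrow> 'b::{real_normed_vector,second_countable_topology}"
  assumes "square_integrable M u"
  shows "square_integrable M (\<lambda>x. c *\<^sub>R u x)"
  using assms by (auto simp: square_integrable_def power_mult_distrib)

lemma square_integrable_diff:
  fixes u v :: "'a \<Rightarrow> 'b::{real_normed_vector,second_countable_topology}"
  assumes "square_integrable M u" "square_integrable M v"
  shows "square_integrable M (\<lambda>x. u x - v x)"
  using square_integrable_add[OF assms(1) square_integrable_scaleR[OF assms(2), of "-1"]] by simp

lemma square_integrable_zero: "square_integrable M (\<lambda>x. 0)"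
  by (simp add: square_integrable_def)

lemma square_integrable_sum:
  fixes u :: "'i \<Rightarrow> 'a \<Rightarrow> 'b::{real_normed_vector,second_countable_topology}"
  assumes "\<And>i. i \<in> F \<Longrightarrow> square_integrable M (u i)"
  shows "square_integrable M (\<lambda>x. \<Sum>i\<in>F. u i x)"
  using assms
  by (induction F rule: infinite_finite_induct) (auto intro: square_integrable_add square_integrable_zero)

lemma square_integrable_cnj:
  "square_integrable M u \<Longrightarrow> square_integrable M (\<lambda>x. cnj (u x))"
  unfolding square_integrable_def by (auto intro: borel_measurable_continuous_on[OF continuous_on_cnj[OF continuous_on_id]])

lemma integrable_norm_mult_L2:
  fixes u :: "'a \<Rightarrow> 'b::{real_normed_vector,second_countable_topology}"
    and v :: "'a \<Rightarrow> 'c::{real_normed_vector,second_countable_topology}"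
  assumes "square_integrable M u" "square_integrable M v"
  shows "integrable M (\<lambda>x. norm (u x) * norm (v x))"
proof -
  have [measurable]: "u \<in> borel_measurable M" "v \<in> borel_measurable M"
    using assms by (auto simp: square_integrable_def)
  have b: "norm (u x) * norm (v x) \<le> (norm (u x))\<^sup>2 + (norm (v x))\<^sup>2" for x
    using sum_squares_bound[of "norm (u x)" "norm (v x)"]
      mult_nonneg_nonneg[OF norm_ge_zero norm_ge_zero, of "u x" "v x"] by linarith
  have i: "integrable M (\<lambda>x. (norm (u x))\<^sup>2 + (norm (v x))\<^sup>2)"
    using assms by (simp add: square_integrable_def)
  show ?thesis
    by (rule integrable_bound_real[OF i]) (use b in simp_all)
qed

lemma integrable_mult_L2:
  fixes u v :: "'a \<Rightarrow> complex"
  assumes "square_integrable M u" "square_integrable M v"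
  shows "integrable M (\<lambda>x. u x * v x)"
proof -
  have [measurable]: "u \<in> borel_measurable M" "v \<in> borel_measurable M"
    using assms by (auto simp: square_integrable_def)
  show ?thesis
    by (rule integrable_bound_real[OF integrable_norm_mult_L2[OF assms]])
       (simp_all add: norm_mult)
qed

lemma L2norm_nonneg: "L2norm M u \<ge> 0"
  by (simp add: L2norm_def)

lemma L2norm_sq: "(L2norm M u)\<^sup>2 = (LINT x|M. (norm (u x))\<^sup>2)"
  by (simp add: L2norm_def)

lemma weighted_AM_GM:
  fixes a b x y :: real
  assumes "a > 0" "b > 0"
  shows "2 * (x * y) \<le> b / a * x\<^sup>2 + a / b * y\<^sup>2"
proof -
  have "0 \<le> (b * x - a * y)\<^sup>2 / (a * b)" using assms by simp
  also have "\<dots> = b / a * x\<^sup>2 + a / b * y\<^sup>2 - 2 * (x * y)"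
    using assms by (simp add: field_simps power2_eq_square)
  finally show ?thesis by simp
qed

text \<open>Integrate the weighted AM-GM inequality with the two norms as weights. Adding \<epsilon>
  to both keeps the weights positive when a norm vanishes; the limit \<epsilon> to 0 removes
  it.\<close>

lemma Cauchy_Schwarz_L2:
  fixes u :: "'a \<Rightarrow> 'b::{real_normed_vector,second_countable_topology}"
    and v :: "'a \<Rightarrow> 'c::{real_normed_vector,second_countable_topology}"
  assumes u: "square_integrable M u" and v: "square_integrable M v"
  shows "(LINT x|M. norm (u x) * norm (v x)) \<le> L2norm M u * L2norm M v"
proof -
  let ?c = "LINT x|M. norm (u x) * norm (v x)"
  let ?A = "L2norm M u" and ?B = "L2norm M v"
  have iu: "integrable M (\<lambda>x. (norm (u x))\<^sup>2)" and iv: "integrable M (\<lambda>x. (norm (v x))\<^sup>2)"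
    using u v by (auto simp: square_integrable_def)
  have *: "?c \<le> (?A + \<epsilon>) * (?B + \<epsilon>)" if "\<epsilon> > 0" for \<epsilon>
  proof -
    let ?a = "?A + \<epsilon>" and ?b = "?B + \<epsilon>"
    have pos: "?a > 0" "?b > 0" using that L2norm_nonneg[of M u] L2norm_nonneg[of M v] by auto
    have "2 * (norm (u x) * norm (v x)) \<le> ?b / ?a * (norm (u x))\<^sup>2 + ?a / ?b * (norm (v x))\<^sup>2" for x
      by (rule weighted_AM_GM[OF pos])
    then have "(LINT x|M. 2 * (norm (u x) * norm (v x))) \<le>
        (LINT x|M. ?b / ?a * (norm (u x))\<^sup>2 + ?a / ?b * (norm (v x))\<^sup>2)"
      using iu iv integrable_norm_mult_L2[OF u v] by (intro integral_mono) auto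
    also have "\<dots> = ?b / ?a * ?A\<^sup>2 + ?a / ?b * ?B\<^sup>2"
      using iu iv by (simp add: L2norm_sq)
    also have "\<dots> \<le> ?b / ?a * ?a\<^sup>2 + ?a / ?b * ?b\<^sup>2"
      using pos that L2norm_nonneg[of M u] L2norm_nonneg[of M v]
      by (intro add_mono mult_left_mono power_mono) auto
    also have "\<dots> = 2 * (?a * ?b)" using pos by (simp add: power2_eq_square)
    finally show ?thesis by simp
  qed
  have "((\<lambda>\<epsilon>. (?A + \<epsilon>) * (?B + \<epsilon>)) \<longlongrightarrow> (?A + 0) * (?B + 0)) (at_right 0)"
    by (intro tendsto_intros)
  moreover have "eventually (\<lambda>\<epsilon>. ?c \<le> (?A + \<epsilon>) * (?B + \<epsilon>)) (at_right 0)"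
    using * by (auto simp: eventually_at_right_field intro: exI[of _ 1])
  ultimately show ?thesis
    using tendsto_lowerbound by fastforce
qed

lemma L2norm_triangle:
  fixes u v :: "'a \<Rightarrow> 'b::{real_normed_vector,second_countable_topology}"
  assumes u: "square_integrable M u" and v: "square_integrable M v"
  shows "L2norm M (\<lambda>x. u x + v x) \<le> L2norm M u + L2norm M v"
proof -
  have iu: "integrable M (\<lambda>x. (norm (u x))\<^sup>2)" and iv: "integrable M (\<lambda>x. (norm (v x))\<^sup>2)"
    using u v by (auto simp: square_integrable_def)
  note iuv = integrable_norm_mult_L2[OF u v]
  have "(L2norm M (\<lambda>x. u x + v x))\<^sup>2 = (LINT x|M. (norm (u x + v x))\<^sup>2)" by (rule L2norm_sq)
  also have "\<dots> \<le> (LINT x|M. (norm (u x))\<^sup>2 + (norm (v x))\<^sup>2 + 2 * (norm (u x) * norm (v x)))"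
  proof (rule integral_mono)
    show "integrable M (\<lambda>x. (norm (u x + v x))\<^sup>2)"
      using square_integrable_add[OF u v] by (simp add: square_integrable_def)
    show "(norm (u x + v x))\<^sup>2 \<le> (norm (u x))\<^sup>2 + (norm (v x))\<^sup>2 + 2 * (norm (u x) * norm (v x))" for x
      using power_mono[OF norm_triangle_ineq[of "u x" "v x"], of 2] by (simp add: power2_sum)
  qed (use iu iv iuv in auto)
  also have "\<dots> = (L2norm M u)\<^sup>2 + (L2norm M v)\<^sup>2 + 2 * (LINT x|M. norm (u x) * norm (v x))"
    using iu iv iuv by (simp add: L2norm_sq)
  also have "\<dots> \<le> (L2norm M u + L2norm M v)\<^sup>2"
    using Cauchy_Schwarz_L2[OF u v] by (simp add: power2_sum)
  finally show ?thesis
    by (rule power2_le_imp_le) (simp add: L2norm_nonneg)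
qed

lemma L2norm_scaleR: "L2norm M (\<lambda>x. c *\<^sub>R u x) = \<bar>c\<bar> * L2norm M u"
proof -
  have "(LINT x|M. (norm (c *\<^sub>R u x))\<^sup>2) = c\<^sup>2 * (LINT x|M. (norm (u x))\<^sup>2)"
    by (simp add: power_mult_distrib)
  then show ?thesis by (simp add: L2norm_def real_sqrt_mult)
qed

lemma L2norm_cmult:
  fixes u :: "'a \<Rightarrow> complex"
  shows "L2norm M (\<lambda>x. c * u x) = norm c * L2norm M u"
proof -
  have "(LINT x|M. (norm (c * u x))\<^sup>2) = (norm c)\<^sup>2 * (LINT x|M. (norm (u x))\<^sup>2)"
    by (simp add: norm_mult power_mult_distrib)
  then show ?thesis by (simp add: L2norm_def real_sqrt_mult)
qed

lemma L2norm_minus_commute: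
  "L2norm M (\<lambda>x. u x - v x) = L2norm M (\<lambda>x. v x - u x)"
  by (simp add: L2norm_def norm_minus_commute)

lemma L2norm_triangle_diff:
  fixes u v w :: "'a \<Rightarrow> 'b::{real_normed_vector,second_countable_topology}"
  assumes "square_integrable M u" "square_integrable M v" "square_integrable M w"
  shows "L2norm M (\<lambda>x. u x - w x) \<le> L2norm M (\<lambda>x. u x - v x) + L2norm M (\<lambda>x. v x - w x)"
  using L2norm_triangle[OF square_integrable_diff[OF assms(1,2)] square_integrable_diff[OF assms(2,3)]]
  by simp

lemma L2norm_mono_bound:
  fixes u :: "'a \<Rightarrow> complex"
  assumes u: "square_integrable M u" and g: "g \<in> borel_measurable M"
    and B: "\<And>x. norm (g x) \<le> B"
  shows "L2norm M (\<lambda>x. g x * u x) \<le> B * L2norm M u"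
proof -
  have pos: "B \<ge> 0" by (rule order_trans[OF norm_ge_zero B])
  have "(LINT x|M. (norm (g x * u x))\<^sup>2) \<le> (LINT x|M. B\<^sup>2 * (norm (u x))\<^sup>2)"
  proof (rule integral_mono)
    show "integrable M (\<lambda>x. (norm (g x * u x))\<^sup>2)"
      using square_integrable_bounded_mult[OF u g B] by (simp add: square_integrable_def)
    show "integrable M (\<lambda>x. B\<^sup>2 * (norm (u x))\<^sup>2)"
      using u by (simp add: square_integrable_def)
  qed (rule norm_mult_sq_le[OF B])
  then have "(L2norm M (\<lambda>x. g x * u x))\<^sup>2 \<le> (B * L2norm M u)\<^sup>2"
    by (simp add: L2norm_sq power_mult_distrib)
  then show ?thesis by (rule power2_le_imp_le) (simp add: L2norm_nonneg pos)
qed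

lemma L2norm_cong_AE:
  assumes "u \<in> borel_measurable M" "v \<in> borel_measurable M" "AE x in M. u x = v x"
  shows "L2norm M u = L2norm M v"
proof -
  have "(LINT x|M. (norm (u x))\<^sup>2) = (LINT x|M. (norm (v x))\<^sup>2)"
    by (rule integral_cong_AE) (use assms in simp_all, use assms(3) in eventually_elim, simp)
  then show ?thesis by (simp add: L2norm_def)
qed

section \<open>Inner products, orthonormal families and best approximation\<close>

definition ip :: "'a measure \<Rightarrow> ('a \<Rightarrow> complex) \<Rightarrow> ('a \<Rightarrow> complex) \<Rightarrow> complex" where
  "ip M u v = (LINT x|M. u x * cnj (v x))"

lemma ip_bound:
  assumes "square_integrable M u" "square_integrable M v"
  shows "norm (ip M u v) \<le> L2norm M u * L2norm M v"
proof -
  have "norm (ip M u v) \<le> (LINT x|M. norm (u x * cnj (v x)))"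
    unfolding ip_def by (rule integral_norm_bound)
  also have "\<dots> = (LINT x|M. norm (u x) * norm (v x))" by (simp add: norm_mult)
  finally show ?thesis using Cauchy_Schwarz_L2[OF assms] by linarith
qed

lemma integrable_ip:
  assumes "square_integrable M u" "square_integrable M v"
  shows "integrable M (\<lambda>x. u x * cnj (v x))"
  by (intro integrable_mult_L2 square_integrable_cnj assms)

lemma ip_diff_left:
  assumes "square_integrable M u" "square_integrable M v" "square_integrable M w"
  shows "ip M (\<lambda>x. u x - v x) w = ip M u w - ip M v w"
  using integrable_ip[OF assms(1,3)] integrable_ip[OF assms(2,3)]
  by (simp add: ip_def algebra_simps)

lemma ip_cmult_left: "ip M (\<lambda>x. c * u x) w = c * ip M u w"
  by (simp add: ip_def mult.assoc)

lemma ip_sum_left: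
  assumes "\<And>i. i \<in> F \<Longrightarrow> square_integrable M (u i)" "square_integrable M w"
  shows "ip M (\<lambda>x. \<Sum>i\<in>F. u i x) w = (\<Sum>i\<in>F. ip M (u i) w)"
  using integrable_ip[OF assms]
  by (simp add: ip_def sum_distrib_right Bochner_Integration.integral_sum)

lemma ip_commute: "ip M v u = cnj (ip M u v)"
proof -
  have "cnj (ip M u v) = (LINT x|M. cnj (u x * cnj (v x)))"
    unfolding ip_def by (simp del: complex_cnj_mult)
  then show ?thesis by (simp add: ip_def mult.commute)
qed

lemma ip_self: "ip M u u = of_real ((L2norm M u)\<^sup>2)"
proof -
  have "ip M u u = (LINT x|M. complex_of_real ((norm (u x))\<^sup>2))"
    unfolding ip_def by (metis complex_norm_square)
  also have "\<dots> = of_real (LINT x|M. (norm (u x))\<^sup>2)"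
    by (rule integral_complex_of_real)
  finally show ?thesis by (simp only: L2norm_sq)
qed

lemma L2norm_sq_diff:
  assumes "square_integrable M u" "square_integrable M v"
  shows "(L2norm M (\<lambda>x. u x - v x))\<^sup>2 = (L2norm M u)\<^sup>2 - 2 * Re (ip M u v) + (L2norm M v)\<^sup>2"
proof -
  note d = square_integrable_diff[OF assms]
  have "complex_of_real ((L2norm M (\<lambda>x. u x - v x))\<^sup>2) = ip M u (\<lambda>x. u x - v x) - ip M v (\<lambda>x. u x - v x)"
    using ip_diff_left[OF assms d] by (simp add: ip_self)
  also have "\<dots> = cnj (ip M u u - ip M v u) - cnj (ip M u v - ip M v v)"
    unfolding ip_commute[of M u "\<lambda>x. u x - v x"] ip_commute[of M v "\<lambda>x. u x - v x"]
    by (simp add: ip_diff_left assms d)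
  also have "\<dots> = of_real ((L2norm M u)\<^sup>2) - (ip M u v + cnj (ip M u v)) + of_real ((L2norm M v)\<^sup>2)"
    by (simp add: ip_self ip_commute[of M v u])
  finally show ?thesis by (simp add: complex_eq_iff)
qed

locale orthonormal_family =
  fixes M :: "'a measure" and e :: "int \<Rightarrow> 'a \<Rightarrow> complex"
  assumes sq: "square_integrable M (e n)"
    and ortho: "ip M (e m) (e n) = (if m = n then 1 else 0)"
begin

lemma L2norm_e: "L2norm M (e n) = 1"
  using ip_self[of M "e n"] ortho[of n n] L2norm_nonneg[of M "e n"]
  by (metis abs_of_nonneg norm_of_real norm_one of_real_eq_1_iff power2_eq_1_iff zero_le_one
      zero_neq_neg_one abs_1 abs_minus_cancel)

lemma coeff_bound: "square_integrable M u \<Longrightarrow> norm (ip M u (e n)) \<le> L2norm M u"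
  using ip_bound[OF _ sq, of u n] by (simp add: L2norm_e)

lemma square_integrable_comb: "square_integrable M (\<lambda>x. \<Sum>n\<in>F. a n * e n x)"
  by (intro square_integrable_sum square_integrable_cmult sq)

lemma ip_comb: "finite F \<Longrightarrow> ip M (\<lambda>x. \<Sum>n\<in>F. a n * e n x) (e m) = (if m \<in> F then a m else 0)"
  by (subst ip_sum_left)
     (auto intro!: square_integrable_cmult sq simp: ip_cmult_left ortho mult_delta_right)

lemma ip_comb_right:
  assumes "square_integrable M u"
  shows "ip M u (\<lambda>x. \<Sum>n\<in>F. a n * e n x) = (\<Sum>n\<in>F. cnj (a n) * ip M u (e n))"
proof -
  have "ip M u (\<lambda>x. \<Sum>n\<in>F. a n * e n x) = cnj (\<Sum>n\<in>F. a n * ip M (e n) u)"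
    by (subst ip_commute, subst ip_sum_left)
       (auto intro!: square_integrable_cmult sq assms simp: ip_cmult_left)
  then show ?thesis
    by (simp, intro sum.cong refl arg_cong2[of _ _ _ _ "(*)"]) (metis ip_commute)
qed

lemma L2norm_comb:
  assumes "finite F"
  shows "(L2norm M (\<lambda>x. \<Sum>n\<in>F. a n * e n x))\<^sup>2 = (\<Sum>n\<in>F. (norm (a n))\<^sup>2)"
proof -
  have "complex_of_real ((L2norm M (\<lambda>x. \<Sum>n\<in>F. a n * e n x))\<^sup>2) = (\<Sum>n\<in>F. cnj (a n) * a n)"
    unfolding ip_self[symmetric] ip_comb_right[OF square_integrable_comb] using assms by (simp add: ip_comb)
  also have "\<dots> = of_real (\<Sum>n\<in>F. (norm (a n))\<^sup>2)"
    by (simp add: complex_norm_square mult.commute del: of_real_power)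
  finally show ?thesis using of_real_eq_iff by blast
qed

text \<open>Pythagoras: with the coefficients \<open>ip M u (e n)\<close> the last sum vanishes, so
  these give the smallest residual, and that residual decreases as \<open>F\<close> grows. Both
  facts drive the expansion lemmas below.\<close>

lemma L2norm_residual:
  assumes "square_integrable M u" "finite F"
  shows "(L2norm M (\<lambda>x. u x - (\<Sum>n\<in>F. a n * e n x)))\<^sup>2 =
    (L2norm M u)\<^sup>2 - (\<Sum>n\<in>F. (norm (ip M u (e n)))\<^sup>2) + (\<Sum>n\<in>F. (norm (a n - ip M u (e n)))\<^sup>2)"
proof -
  have "(norm (a - c))\<^sup>2 = (norm a)\<^sup>2 + (norm c)\<^sup>2 - 2 * Re (cnj a * c)" for a c :: complex
    by (simp add: cmod_power2 power2_diff algebra_simps)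
  then have *: "(\<Sum>n\<in>F. (norm (a n - ip M u (e n)))\<^sup>2) = (\<Sum>n\<in>F. (norm (a n))\<^sup>2)
      + (\<Sum>n\<in>F. (norm (ip M u (e n)))\<^sup>2) - 2 * (\<Sum>n\<in>F. Re (cnj (a n) * ip M u (e n)))"
    by (simp only: sum.distrib sum_subtractf sum_distrib_left)
  show ?thesis
    unfolding * L2norm_sq_diff[OF assms(1) square_integrable_comb] ip_comb_right[OF assms(1)] L2norm_comb[OF assms(2)]
    by simp
qed

text \<open>The n-th coefficient of the residual is \<open>ip M u (e n) - c n\<close> as soon as n
  lies in \<open>F\<close>, and a coefficient never exceeds the norm; let the residual tend to
  0.\<close>

lemma expansion_coeff:
  assumes "L2_expansion M e c u"
  shows "ip M u (e n) = c n"
proof -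
  have u: "square_integrable M u"
    and lim: "((\<lambda>F. L2norm M (\<lambda>x. u x - (\<Sum>n\<in>F. c n * e n x))) \<longlongrightarrow> 0) (finite_subsets_at_top UNIV)"
    using assms by (auto simp: L2_expansion_def)
  have "norm (ip M u (e n) - c n) \<le> L2norm M (\<lambda>x. u x - (\<Sum>n\<in>F. c n * e n x))"
    if "finite F" "n \<in> F" for F
    using coeff_bound[OF square_integrable_diff[OF u square_integrable_comb[of c F]], of n] that
    by (simp add: ip_diff_left u square_integrable_comb sq ip_comb)
  then have "\<forall>\<^sub>F F in finite_subsets_at_top UNIV.
      norm (ip M u (e n) - c n) \<le> L2norm M (\<lambda>x. u x - (\<Sum>n\<in>F. c n * e n x))"
    by (auto simp: eventually_finite_subsets_at_top intro!: exI[of _ "{n}"])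
  then have "norm (ip M u (e n) - c n) \<le> 0"
    by (rule tendsto_lowerbound[OF lim]) simp
  then show ?thesis by simp
qed

text \<open>Approximation by arbitrary finite combinations suffices: over any larger index set the
  inner products do at least as well as the coefficients of the given approximant.\<close>

lemma expansionI_approx:
  assumes u: "square_integrable M u"
    and approx: "\<And>\<epsilon>. \<epsilon> > 0 \<Longrightarrow> \<exists>F a. finite F \<and> L2norm M (\<lambda>x. u x - (\<Sum>n\<in>F. a n * e n x)) < \<epsilon>"
  shows "L2_expansion M e (\<lambda>n. ip M u (e n)) u"
  unfolding L2_expansion_def
proof (intro conjI u tendstoI)
  fix \<epsilon> :: real assume "\<epsilon> > 0"
  from approx[OF this] obtain F a where F: "finite F"
    and a: "L2norm M (\<lambda>x. u x - (\<Sum>n\<in>F. a n * e n x)) < \<epsilon>" by blast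
  have "L2norm M (\<lambda>x. u x - (\<Sum>n\<in>G. ip M u (e n) * e n x)) < \<epsilon>" if "finite G" "F \<subseteq> G" for G
  proof -
    let ?h = "\<lambda>n. (norm (ip M u (e n)))\<^sup>2"
    have "(L2norm M (\<lambda>x. u x - (\<Sum>n\<in>G. ip M u (e n) * e n x)))\<^sup>2 = (L2norm M u)\<^sup>2 - sum ?h G"
      by (simp add: L2norm_residual u that)
    also have "\<dots> \<le> (L2norm M u)\<^sup>2 - sum ?h F"
      using that by (simp add: sum_mono2)
    also have "\<dots> \<le> (L2norm M (\<lambda>x. u x - (\<Sum>n\<in>F. a n * e n x)))\<^sup>2"
      by (simp add: L2norm_residual u F sum_nonneg)
    finally have "L2norm M (\<lambda>x. u x - (\<Sum>n\<in>G. ip M u (e n) * e n x)) \<le> L2norm M (\<lambda>x. u x - (\<Sum>n\<in>F. a n * e n x))"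
      by (rule power2_le_imp_le) (rule L2norm_nonneg)
    with a show ?thesis by simp
  qed
  with F show "\<forall>\<^sub>F F in finite_subsets_at_top UNIV.
      dist (L2norm M (\<lambda>x. u x - (\<Sum>n\<in>F. ip M u (e n) * e n x))) 0 < \<epsilon>"
    by (auto simp: eventually_finite_subsets_at_top L2norm_nonneg dist_real_def intro!: exI[of _ F])
qed

lemma expansion_approx:
  assumes "L2_expansion M e c u" "\<epsilon> > 0"
  shows "\<exists>F. finite F \<and> L2norm M (\<lambda>x. u x - (\<Sum>n\<in>F. c n * e n x)) < \<epsilon>"
proof -
  have "((\<lambda>F. L2norm M (\<lambda>x. u x - (\<Sum>n\<in>F. c n * e n x))) \<longlongrightarrow> 0) (finite_subsets_at_top UNIV)"
    using assms by (auto simp: L2_expansion_def)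
  from order_tendstoD(2)[OF this assms(2)] show ?thesis
    by (auto simp: eventually_finite_subsets_at_top)
qed

lemma expansion_Parseval:
  assumes "L2_expansion M e c u"
  shows "((\<lambda>n. (norm (c n))\<^sup>2) has_sum (L2norm M u)\<^sup>2) UNIV"
proof -
  have u: "square_integrable M u"
    and lim: "((\<lambda>F. L2norm M (\<lambda>x. u x - (\<Sum>n\<in>F. c n * e n x))) \<longlongrightarrow> 0) (finite_subsets_at_top UNIV)"
    using assms by (auto simp: L2_expansion_def)
  have "((\<lambda>F. (L2norm M u)\<^sup>2 - (L2norm M (\<lambda>x. u x - (\<Sum>n\<in>F. c n * e n x)))\<^sup>2) \<longlongrightarrow>
      (L2norm M u)\<^sup>2 - 0\<^sup>2) (finite_subsets_at_top UNIV)"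
    by (intro tendsto_intros lim)
  moreover have "\<forall>\<^sub>F F in finite_subsets_at_top UNIV.
     (L2norm M u)\<^sup>2 - (L2norm M (\<lambda>x. u x - (\<Sum>n\<in>F. c n * e n x)))\<^sup>2 = (\<Sum>n\<in>F. (norm (c n))\<^sup>2)"
    using u by (auto intro!: eventually_finite_subsets_at_top_weakI
        simp: L2norm_residual expansion_coeff[OF assms])
  ultimately show ?thesis
    unfolding has_sum_def by (auto elim: Lim_transform_eventually)
qed

lemma expansion_lincomb:
  assumes "L2_expansion M e c u" "L2_expansion M e d w"
  shows "L2_expansion M e (\<lambda>n. \<alpha> * c n + \<beta> * d n) (\<lambda>x. \<alpha> * u x + \<beta> * w x)"
proof -
  have u: "square_integrable M u" and w: "square_integrable M w"
    using assms by (auto simp: L2_expansion_def)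
  have s: "square_integrable M (\<lambda>x. \<alpha> * u x + \<beta> * w x)"
    by (intro square_integrable_add square_integrable_cmult u w)
  have *: "L2norm M (\<lambda>x. (\<alpha> * u x + \<beta> * w x) - (\<Sum>n\<in>F. (\<alpha> * c n + \<beta> * d n) * e n x)) \<le>
     norm \<alpha> * L2norm M (\<lambda>x. u x - (\<Sum>n\<in>F. c n * e n x)) + norm \<beta> * L2norm M (\<lambda>x. w x - (\<Sum>n\<in>F. d n * e n x))" for F
  proof -
    have "L2norm M (\<lambda>x. (\<alpha> * u x + \<beta> * w x) - (\<Sum>n\<in>F. (\<alpha> * c n + \<beta> * d n) * e n x)) =
       L2norm M (\<lambda>x. \<alpha> * (u x - (\<Sum>n\<in>F. c n * e n x)) + \<beta> * (w x - (\<Sum>n\<in>F. d n * e n x)))"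
      by (rule arg_cong[of _ _ "L2norm M"], rule ext)
        (simp only: distrib_right right_diff_distrib sum.distrib sum_distrib_left mult.assoc add_diff_add)
    also have "\<dots> \<le> L2norm M (\<lambda>x. \<alpha> * (u x - (\<Sum>n\<in>F. c n * e n x))) + L2norm M (\<lambda>x. \<beta> * (w x - (\<Sum>n\<in>F. d n * e n x)))"
      by (intro L2norm_triangle square_integrable_cmult square_integrable_diff u w square_integrable_comb)
    finally show ?thesis by (simp add: L2norm_cmult)
  qed
  have "((\<lambda>F. norm \<alpha> * L2norm M (\<lambda>x. u x - (\<Sum>n\<in>F. c n * e n x)) +
      norm \<beta> * L2norm M (\<lambda>x. w x - (\<Sum>n\<in>F. d n * e n x))) \<longlongrightarrow> norm \<alpha> * 0 + norm \<beta> * 0) (finite_subsets_at_top UNIV)"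
    using assms by (intro tendsto_intros) (auto simp: L2_expansion_def)
  then have lim: "((\<lambda>F. norm \<alpha> * L2norm M (\<lambda>x. u x - (\<Sum>n\<in>F. c n * e n x)) +
      norm \<beta> * L2norm M (\<lambda>x. w x - (\<Sum>n\<in>F. d n * e n x))) \<longlongrightarrow> 0) (finite_subsets_at_top UNIV)"
    by simp
  have "((\<lambda>F. L2norm M (\<lambda>x. (\<alpha> * u x + \<beta> * w x) - (\<Sum>n\<in>F. (\<alpha> * c n + \<beta> * d n) * e n x))) \<longlongrightarrow> 0)
      (finite_subsets_at_top UNIV)"
    by (rule tendsto_sandwich[OF always_eventually always_eventually tendsto_const lim])
       (use * L2norm_nonneg in blast)+
  with s show ?thesis by (simp add: L2_expansion_def)
qed

end

text \<open>Parseval on either side. Applied to difference quotients, this carries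
  L2-differentiability between the strip and the period.\<close>

lemma expansion_L2norm_eq:
  assumes "orthonormal_family M e" "orthonormal_family M' e'"
    "L2_expansion M e c u" "L2_expansion M' e' c w"
  shows "L2norm M u = L2norm M' w"
proof -
  have "(L2norm M u)\<^sup>2 = (L2norm M' w)\<^sup>2"
    using orthonormal_family.expansion_Parseval[OF assms(1,3)]
      orthonormal_family.expansion_Parseval[OF assms(2,4)] by (rule has_sum_unique)
  then show ?thesis by (simp add: L2norm_nonneg)
qed

section \<open>Fourier series on a period\<close>

text \<open>Termwise integration of an absolutely convergent series over an unordered index set. An
  enumeration by the naturals, available as the type is countably infinite, reduces it to the
  statement for sequences; the integrals are absolutely summable, so the order is
  immaterial.\<close>

lemma has_sum_integral:
  fixes g :: "'i \<Rightarrow> 'a \<Rightarrow> 'b::{banach,second_countable_topology}"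
  assumes cnt: "countable (UNIV :: 'i set)" "infinite (UNIV :: 'i set)"
    and int: "\<And>i. integrable M (g i)"
    and sm: "\<And>x. (\<lambda>i. norm (g i x)) summable_on UNIV"
    and sint: "(\<lambda>i. LINT x|M. norm (g i x)) summable_on UNIV"
  shows "integrable M (\<lambda>x. \<Sum>\<^sub>\<infinity>i\<in>UNIV. g i x)"
    and "((\<lambda>i. LINT x|M. g i x) has_sum (LINT x|M. (\<Sum>\<^sub>\<infinity>i\<in>UNIV. g i x))) UNIV"
proof -
  define b :: "nat \<Rightarrow> 'i" where "b = from_nat_into UNIV"
  have b: "bij_betw b UNIV UNIV"
    unfolding b_def using cnt by (rule bij_betw_from_nat_into)
  have sums: "(\<lambda>n. g (b n) x) sums (\<Sum>\<^sub>\<infinity>i\<in>UNIV. g i x)" for x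
    using has_sum_infsum[OF abs_summable_summable[OF sm]]
    by (intro has_sum_imp_sums) (simp add: has_sum_reindex_bij_betw[OF b, of "\<lambda>i. g i x"])
  then have eq: "(\<lambda>x. \<Sum>\<^sub>\<infinity>i\<in>UNIV. g i x) = (\<lambda>x. \<Sum>n. g (b n) x)"
    by (simp add: sums_iff)
  have 1: "summable (\<lambda>n. norm (g (b n) x))" for x
    using sm[of x] summable_on_reindex_bij_betw[OF b, of "\<lambda>i. norm (g i x)"]
    by (intro summable_on_imp_summable) simp
  have 2: "summable (\<lambda>n. LINT x|M. norm (g (b n) x))"
    using sint summable_on_reindex_bij_betw[OF b, of "\<lambda>i. LINT x|M. norm (g i x)"]
    by (intro summable_on_imp_summable) simp
  show "integrable M (\<lambda>x. \<Sum>\<^sub>\<infinity>i\<in>UNIV. g i x)"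
    unfolding eq using int 1 2 by (intro integrable_suminf) auto
  have s: "(\<lambda>n. LINT x|M. g (b n) x) sums (LINT x|M. (\<Sum>\<^sub>\<infinity>i\<in>UNIV. g i x))"
    unfolding eq using int 1 2 by (intro sums_integral) auto
  have "(\<lambda>i. LINT x|M. g i x) summable_on UNIV"
  proof (rule abs_summable_summable, rule summable_on_comparison_test[OF sint])
    show "norm (LINT x|M. g i x) \<le> (LINT x|M. norm (g i x))" for i
      by (rule integral_norm_bound)
  qed auto
  then have h: "((\<lambda>i. LINT x|M. g i x) has_sum (\<Sum>\<^sub>\<infinity>i\<in>UNIV. LINT x|M. g i x)) UNIV"
    by (rule has_sum_infsum)
  then have "(\<lambda>n. LINT x|M. g (b n) x) sums (\<Sum>\<^sub>\<infinity>i\<in>UNIV. LINT x|M. g i x)"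
    by (intro has_sum_imp_sums) (simp add: has_sum_reindex_bij_betw[OF b, of "\<lambda>i. LINT x|M. g i x"])
  with s have "(\<Sum>\<^sub>\<infinity>i\<in>UNIV. LINT x|M. g i x) = (LINT x|M. (\<Sum>\<^sub>\<infinity>i\<in>UNIV. g i x))"
    using sums_unique2 by blast
  with h show "((\<lambda>i. LINT x|M. g i x) has_sum (LINT x|M. (\<Sum>\<^sub>\<infinity>i\<in>UNIV. g i x))) UNIV"
    by simp
qed

section \<open>The characters on the unit period\<close>

abbreviation period :: "real measure" where
  "period \<equiv> lebesgue_on {0..1}"

definition fchar :: "int \<Rightarrow> real \<Rightarrow> complex" where
  "fchar n \<xi> = exp (- 2 * of_real pi * \<i> * of_int n * of_real \<xi>)"

lemma fchar_cis: "fchar n \<xi> = cis (- 2 * pi * of_int n * \<xi>)"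
  by (simp add: fchar_def cis_conv_exp algebra_simps)

lemma norm_fchar [simp]: "norm (fchar n \<xi>) = 1"
  by (simp add: fchar_cis)

lemma fchar_0 [simp]: "fchar 0 \<xi> = 1"
  by (simp add: fchar_cis)

lemma fchar_add: "fchar (m + n) \<xi> = fchar m \<xi> * fchar n \<xi>"
  by (simp add: fchar_cis cis_mult algebra_simps)

lemma cnj_fchar: "cnj (fchar n \<xi>) = fchar (- n) \<xi>"
  by (simp add: fchar_cis cis_cnj)

lemma fchar_minus: "fchar n (- \<xi>) = fchar (- n) \<xi>"
  by (simp add: fchar_cis)

lemma cis_2pi_int: "cis (2 * pi * of_int k) = 1"
  by (simp add: cis_multiple_2pi)

lemma fchar_plus_1: "fchar n (\<xi> + 1) = fchar n \<xi>"
proof -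
  have "fchar n (\<xi> + 1) = fchar n \<xi> * cis (2 * pi * of_int (- n))"
    by (simp add: fchar_cis cis_mult algebra_simps)
  then show ?thesis by (simp only: cis_2pi_int) simp
qed

lemma continuous_on_fchar [continuous_intros]:
  "continuous_on A g \<Longrightarrow> continuous_on A (\<lambda>x. fchar n (g x))"
  unfolding fchar_def by (intro continuous_intros)

lemma integrable_period_continuous:
  fixes f :: "real \<Rightarrow> 'b::euclidean_space"
  shows "continuous_on UNIV f \<Longrightarrow> integrable period f"
  by (rule continuous_imp_integrable_real) (rule continuous_on_subset, auto)

lemma measurable_period_continuous:
  fixes f :: "real \<Rightarrow> 'b::euclidean_space"
  shows "continuous_on UNIV f \<Longrightarrow> f \<in> borel_measurable period"
  by (rule borel_measurable_integrable) (rule integrable_period_continuous)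

lemma square_integrable_continuous:
  fixes f :: "real \<Rightarrow> 'b::euclidean_space"
  assumes "continuous_on UNIV f"
  shows "square_integrable period f"
  unfolding square_integrable_def
  by (rule conjI[OF measurable_period_continuous[OF assms]], rule integrable_period_continuous)
     (intro continuous_intros assms)

lemma finite_measure_period: "finite_measure period" "measure period (space period) = 1"
proof -
  show "finite_measure period"
    by (rule finite_measureI) (simp add: emeasure_restrict_space)
  show "measure period (space period) = 1"
    by (simp add: measure_restrict_space)
qed

lemma L2norm_period_le:
  assumes u: "square_integrable period u" and B: "\<And>x. norm (u x) \<le> B"
  shows "L2norm period u \<le> B"
proof -
  interpret finite_measure period by (rule finite_measure_period)
  have pos: "B \<ge> 0" by (rule order_trans[OF norm_ge_zero B])
  have "(L2norm period u)\<^sup>2 \<le> (LINT x|period. B\<^sup>2)"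
    unfolding L2norm_sq
  proof (rule integral_mono)
    show "integrable period (\<lambda>x. (norm (u x))\<^sup>2)"
      using u by (simp add: square_integrable_def)
    show "(norm (u x))\<^sup>2 \<le> B\<^sup>2" for x
      by (intro power_mono B norm_ge_zero)
  qed simp
  also have "\<dots> = B\<^sup>2" using finite_measure_period by simp
  finally show ?thesis by (rule power2_le_imp_le) (rule pos)
qed

lemma integral_fchar: "(LINT \<xi>|period. fchar n \<xi>) = (if n = 0 then 1 else 0)"
proof (cases "n = 0")
  case True
  then show ?thesis using finite_measure_period by simp
next
  case False
  define k :: complex where "k = - 2 * of_real pi * \<i> * of_int n"
  have k: "k \<noteq> 0" using False by (simp add: k_def)
  have "((\<lambda>\<xi>. fchar n \<xi>) has_integral (fchar n 1 / k - fchar n 0 / k)) {0..1}"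
  proof (rule fundamental_theorem_of_calculus)
    fix x :: real
    have "((\<lambda>z. exp (k * z) / k) has_field_derivative exp (k * of_real x)) (at (of_real x))"
      using k by (auto intro!: derivative_eq_intros)
    from has_vector_derivative_real_field[OF this]
    show "((\<lambda>\<xi>. fchar n \<xi> / k) has_vector_derivative fchar n x) (at x within {0..1})"
      by (simp add: fchar_def k_def o_def)
  qed simp
  then have "((\<lambda>\<xi>. fchar n \<xi>) has_integral 0) {0..1}"
    using fchar_plus_1[of n 0] by simp
  moreover have "integrable period (fchar n)"
    by (rule integrable_period_continuous) (intro continuous_intros)
  ultimately show ?thesis
    using False by (simp add: lebesgue_integral_eq_integral integral_unique)
qed

lemma square_integrable_fchar: "square_integrable period (fchar n)"
  by (rule square_integrable_continuous) (intro continuous_intros)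

interpretation fourier: orthonormal_family period fchar
proof
  show "square_integrable period (fchar n)" for n by (rule square_integrable_fchar)
  show "ip period (fchar m) (fchar n) = (if m = n then 1 else 0)" for m n
    by (simp add: ip_def cnj_fchar fchar_add[symmetric] integral_fchar)
qed

text \<open>An inductive presentation, so that closure under products and the image of a polynomial
  on the circle are proved by induction; \<open>trig_poly_sum\<close> recovers the coefficient
  form.\<close>

inductive trig_poly :: "(real \<Rightarrow> complex) \<Rightarrow> bool" where
  monom: "trig_poly (\<lambda>\<xi>. c * fchar n \<xi>)"
| add: "trig_poly f \<Longrightarrow> trig_poly g \<Longrightarrow> trig_poly (\<lambda>\<xi>. f \<xi> + g \<xi>)"

lemma trig_poly_mult:
  assumes "trig_poly f" "trig_poly g"
  shows "trig_poly (\<lambda>\<xi>. f \<xi> * g \<xi>)"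
proof -
  have *: "trig_poly (\<lambda>\<xi>. c * fchar n \<xi> * g \<xi>)" for c n
    using assms(2)
  proof induction
    case (monom c' n')
    have "(\<lambda>\<xi>. c * fchar n \<xi> * (c' * fchar n' \<xi>)) = (\<lambda>\<xi>. (c * c') * fchar (n + n') \<xi>)"
      by (simp add: fchar_add mult_ac)
    then show ?case using trig_poly.monom by simp
  next
    case (add f g)
    then show ?case using trig_poly.add[OF add.IH] by (simp add: distrib_left)
  qed
  from assms(1) show ?thesis
  proof induction
    case (add f g)
    then show ?case using trig_poly.add[OF add.IH] by (simp add: distrib_right)
  qed (rule *)
qed

lemma trig_poly_sum:
  assumes "trig_poly f"
  shows "\<exists>F a. finite F \<and> f = (\<lambda>\<xi>. \<Sum>n\<in>F. a n * fchar n \<xi>)"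
  using assms
proof induction
  case (monom c n)
  then show ?case by (intro exI[of _ "{n}"] exI[of _ "\<lambda>_. c"]) simp
next
  case (add f g)
  then obtain F a G b where F: "finite F" "f = (\<lambda>\<xi>. \<Sum>n\<in>F. a n * fchar n \<xi>)"
    and G: "finite G" "g = (\<lambda>\<xi>. \<Sum>n\<in>G. b n * fchar n \<xi>)" by blast
  have 1: "(\<Sum>n\<in>F. a n * fchar n \<xi>) = (\<Sum>n\<in>F \<union> G. (if n \<in> F then a n else 0) * fchar n \<xi>)" for \<xi>
    using F(1) G(1) by (intro sum.mono_neutral_cong_left) auto
  have 2: "(\<Sum>n\<in>G. b n * fchar n \<xi>) = (\<Sum>n\<in>F \<union> G. (if n \<in> G then b n else 0) * fchar n \<xi>)" for \<xi>
    using F(1) G(1) by (intro sum.mono_neutral_cong_left) auto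
  have "(\<lambda>\<xi>. f \<xi> + g \<xi>) = (\<lambda>\<xi>. \<Sum>n\<in>F \<union> G. ((if n \<in> F then a n else 0) + (if n \<in> G then b n else 0)) * fchar n \<xi>)"
    unfolding F(2) G(2) 1 2 by (simp only: sum.distrib distrib_right)
  moreover have "finite (F \<union> G)" using F(1) G(1) by simp
  ultimately show ?case
    by (intro exI[of _ "F \<union> G"] exI[of _ "\<lambda>n. (if n \<in> F then a n else 0) + (if n \<in> G then b n else 0)"] conjI)
qed

lemma trig_poly_real_polynomial:
  assumes "real_polynomial_function p"
  shows "trig_poly (\<lambda>\<xi>. of_real (p (cis (2 * pi * \<xi>))))"
  using assms
proof induction
  case (linear f)
  then interpret bounded_linear f .
  \<comment> \<open>A real linear functional of cos + i sin is a combination of cos and sin,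
    rewritten through the two characters of frequency -1 and 1.\<close>
  have "complex_of_real (f (cis (2 * pi * \<xi>))) = ((f 1 - \<i> * f \<i>) / 2) * fchar (-1) \<xi> + ((f 1 + \<i> * f \<i>) / 2) * fchar 1 \<xi>" for \<xi>
  proof -
    have "cis (2 * pi * \<xi>) = cos (2 * pi * \<xi>) *\<^sub>R 1 + sin (2 * pi * \<xi>) *\<^sub>R \<i>"
      by (simp add: complex_eq_iff)
    then have "f (cis (2 * pi * \<xi>)) = cos (2 * pi * \<xi>) * f 1 + sin (2 * pi * \<xi>) * f \<i>"
      by (simp add: add scaleR)
    moreover have "fchar (-1) \<xi> = of_real (cos (2 * pi * \<xi>)) + \<i> * of_real (sin (2 * pi * \<xi>))"
      "fchar 1 \<xi> = of_real (cos (2 * pi * \<xi>)) - \<i> * of_real (sin (2 * pi * \<xi>))"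
      by (simp_all add: fchar_cis complex_eq_iff)
    ultimately show ?thesis by (simp only:) (simp add: complex_eq_iff algebra_simps)
  qed
  then show ?case
    using trig_poly.add[OF trig_poly.monom trig_poly.monom, of "(f 1 - \<i> * f \<i>) / 2" "-1" "(f 1 + \<i> * f \<i>) / 2" 1]
    by (simp only:)
next
  case (const c)
  show ?case using trig_poly.monom[of "of_real c" 0] by simp
next
  case (add f g)
  then show ?case using trig_poly.add[OF add.IH] by simp
next
  case (mult f g)
  then show ?case using trig_poly_mult[OF mult.IH] by simp
qed

lemma periodic_int:
  assumes "\<And>\<xi>. f (\<xi> + 1) = f (\<xi>::real)"
  shows "f (\<xi> + of_int k) = f \<xi>"
proof -
  have n: "f (\<xi> + of_nat n) = f \<xi>" for n \<xi>
  proof (induction n)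
    case (Suc n)
    then show ?case using assms[of "\<xi> + of_nat n"] by (simp add: add_ac)
  qed simp
  show ?thesis
  proof (cases k)
    case (nonneg n)
    then show ?thesis using n by simp
  next
    case (neg n)
    then show ?thesis using n[of "\<xi> + of_int k" "Suc n"] by simp
  qed
qed

text \<open>The lift evaluates \<open>f\<close> at the argument of z, which jumps across the branch
  cut of \<open>Ln\<close>; the periodicity of \<open>f\<close> is what makes the result well
  defined and continuous.\<close>

lemma periodic_lift_circle:
  fixes f :: "real \<Rightarrow> 'b::topological_space"
  assumes per: "\<And>\<xi>. f (\<xi> + 1) = f \<xi>" and cont: "continuous_on UNIV f"
  obtains h :: "complex \<Rightarrow> 'b" where "continuous_on (sphere 0 1) h" "\<And>\<xi>. h (cis (2 * pi * \<xi>)) = f \<xi>"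
proof
  define h where "h z = f (Im (Ln z) / (2 * pi))" for z :: complex
  have eq: "f \<xi> = f \<eta>" if "cis (2 * pi * \<xi>) = cis (2 * pi * \<eta>)" for \<xi> \<eta>
  proof -
    have "cis (2 * pi * (\<xi> - \<eta>)) = 1"
      using that by (simp add: right_diff_distrib flip: cis_divide)
    then obtain k :: int where "2 * pi * (\<xi> - \<eta>) = of_int k * (2 * pi)"
      by (auto simp: complex_eq_iff cos_one_2pi_int)
    then have "\<xi> = \<eta> + of_int k" by simp
    then show ?thesis using periodic_int[of f, OF per] by simp
  qed
  have cisLn: "cis (2 * pi * (Im (Ln z) / (2 * pi))) = z" if "norm z = 1" for z
  proof -
    have "z \<noteq> 0" using that by auto
    then have "z = exp (Ln z)" by simp
    also have "\<dots> = cis (Im (Ln z))"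
      using that \<open>z \<noteq> 0\<close> by (simp add: exp_eq_polar)
    finally show ?thesis by simp
  qed
  show "h (cis (2 * pi * \<xi>)) = f \<xi>" for \<xi>
    unfolding h_def by (rule eq) (rule cisLn, simp)
  show "continuous_on (sphere 0 1) h"
    unfolding continuous_on_eq_continuous_within
  proof
    fix z0 :: complex assume z0: "z0 \<in> sphere 0 1"
    then have n0: "norm z0 = 1" "z0 \<noteq> 0" by auto
    define x0 where "x0 = Im (Ln z0) / (2 * pi)"
    have c0: "cis (2 * pi * x0) = z0" unfolding x0_def by (rule cisLn[OF n0(1)])
    \<comment> \<open>Near z0 the logarithm is taken of z / z0, which is close to 1 and far from the
      cut. By \<open>eq\<close> this local formula agrees with \<open>h\<close> on the
      circle.\<close>
    have "isCont (\<lambda>z. Im (Ln (z / z0)) / (2 * pi) + x0) z0"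
      using n0 by (intro continuous_intros) auto
    moreover have "isCont f y" for y
      using cont continuous_on_eq_continuous_at by blast
    ultimately have "isCont (\<lambda>z. f (Im (Ln (z / z0)) / (2 * pi) + x0)) z0"
      using isCont_o2 by blast
    then have "continuous (at z0 within sphere 0 1) (\<lambda>z. f (Im (Ln (z / z0)) / (2 * pi) + x0))"
      by (rule continuous_at_imp_continuous_at_within)
    then show "continuous (at z0 within sphere 0 1) h"
    proof (rule continuous_transform_within[of _ _ _ 1])
      fix z :: complex assume "z \<in> sphere 0 1"
      then have z: "norm z = 1" "norm (z / z0) = 1" using n0 by (auto simp: norm_divide)
      show "f (Im (Ln (z / z0)) / (2 * pi) + x0) = h z"
        unfolding h_def
      proof (rule eq)
        have "cis (2 * pi * (Im (Ln (z / z0)) / (2 * pi) + x0)) = (z / z0) * z0"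
          unfolding distrib_left cis_mult[symmetric] c0 cisLn[OF z(2)] ..
        then show "cis (2 * pi * (Im (Ln (z / z0)) / (2 * pi) + x0)) = cis (2 * pi * (Im (Ln z) / (2 * pi)))"
          using n0 by (simp only: cisLn[OF z(1)]) simp
      qed
    qed (use z0 in auto)
  qed
qed

text \<open>Stone-Weierstrass on the circle, applied to the lift; polynomials in the point
  \<open>cis (2 * pi * \<xi>)\<close> are trigonometric polynomials.\<close>

lemma trig_poly_dense:
  fixes f :: "real \<Rightarrow> complex"
  assumes per: "\<And>\<xi>. f (\<xi> + 1) = f \<xi>" and cont: "continuous_on UNIV f" and e: "\<epsilon> > 0"
  obtains g where "trig_poly g" "\<And>\<xi>. norm (f \<xi> - g \<xi>) < \<epsilon>"
proof -
  obtain h where h: "continuous_on (sphere 0 1) h" "\<And>\<xi>. h (cis (2 * pi * \<xi>)) = f \<xi>"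
    using periodic_lift_circle[of f, OF per cont] by blast
  obtain q where q: "polynomial_function q" "\<forall>z\<in>sphere 0 1. norm (h z - q z) < \<epsilon>"
    using Stone_Weierstrass_polynomial_function[OF _ h(1) e] by auto
  have re: "real_polynomial_function (\<lambda>z. Re (q z))" and im: "real_polynomial_function (\<lambda>z. Im (q z))"
    using q(1) bounded_linear_Re bounded_linear_Im by (auto simp: polynomial_function_def o_def)
  have "trig_poly (\<lambda>\<xi>. of_real (Re (q (cis (2 * pi * \<xi>)))) + \<i> * of_real (Im (q (cis (2 * pi * \<xi>)))))"
    using trig_poly.add[OF trig_poly_real_polynomial[OF re]
       trig_poly_mult[OF trig_poly.monom[of \<i> 0] trig_poly_real_polynomial[OF im]]] by simp
  then have "trig_poly (\<lambda>\<xi>. q (cis (2 * pi * \<xi>)))"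
    by (simp flip: complex_eq)
  moreover have "norm (f \<xi> - q (cis (2 * pi * \<xi>))) < \<epsilon>" for \<xi>
    using q(2) by (simp flip: h(2))
  ultimately show ?thesis using that by blast
qed

lemma fourier_expansion_continuous:
  fixes f :: "real \<Rightarrow> complex"
  assumes per: "\<And>\<xi>. f (\<xi> + 1) = f \<xi>" and cont: "continuous_on UNIV f"
  shows "L2_expansion period fchar (\<lambda>n. ip period f (fchar n)) f"
proof (rule fourier.expansionI_approx)
  show f: "square_integrable period f" by (rule square_integrable_continuous[OF cont])
  fix \<epsilon> :: real assume "\<epsilon> > 0"
  then obtain g where g: "trig_poly g" "\<And>\<xi>. norm (f \<xi> - g \<xi>) < \<epsilon> / 2"
    using trig_poly_dense[of f "\<epsilon> / 2", OF per cont] by auto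
  from trig_poly_sum[OF g(1)] obtain F a where F: "finite F" and ga: "g = (\<lambda>\<xi>. \<Sum>n\<in>F. a n * fchar n \<xi>)"
    by blast
  have "L2norm period (\<lambda>x. f x - g x) \<le> \<epsilon> / 2"
    unfolding ga by (rule L2norm_period_le, intro square_integrable_diff f fourier.square_integrable_comb)
      (use g(2) ga in \<open>auto intro: less_imp_le\<close>)
  with F ga \<open>\<epsilon> > 0\<close> show "\<exists>F a. finite F \<and> L2norm period (\<lambda>x. f x - (\<Sum>n\<in>F. a n * fchar n x)) < \<epsilon>"
    by (intro exI[of _ F] exI[of _ a]) auto
qed

text \<open>Parseval gives norm 0; continuity turns that into vanishing at every point of [0,1], and
  periodicity extends it.\<close>

lemma fourier_unique_0:
  fixes f :: "real \<Rightarrow> complex"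
  assumes per: "\<And>\<xi>. f (\<xi> + 1) = f \<xi>" and cont: "continuous_on UNIV f"
    and z: "\<And>n. ip period f (fchar n) = 0"
  shows "f \<xi> = 0"
proof -
  have "((\<lambda>n::int. 0::real) has_sum (L2norm period f)\<^sup>2) UNIV"
    using fourier.expansion_Parseval[OF fourier_expansion_continuous[of f, OF per cont]] by (simp add: z)
  moreover have "((\<lambda>n::int. 0::real) has_sum 0) UNIV" by (rule has_sum_0) simp
  ultimately have "(L2norm period f)\<^sup>2 = 0" by (rule has_sum_unique)
  then have "(LINT x|period. (norm (f x))\<^sup>2) = 0" by (simp add: L2norm_sq)
  moreover have i: "integrable period (\<lambda>x. (norm (f x))\<^sup>2)"
    using square_integrable_continuous[OF cont] by (simp add: square_integrable_def)
  ultimately have "((\<lambda>x. (norm (f x))\<^sup>2) has_integral 0) (cbox 0 1)"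
    using has_integral_integral_lebesgue_on[OF i] by simp
  moreover have "continuous_on (cbox 0 1) (\<lambda>x. (norm (f x))\<^sup>2)"
    by (intro continuous_intros continuous_on_subset[OF cont]) auto
  ultimately have "(norm (f x))\<^sup>2 = 0" if "x \<in> {0..1}" for x
    using that has_integral_0_cbox_imp_0[of 0 1 "\<lambda>x. (norm (f x))\<^sup>2" x] by simp
  then have *: "f x = 0" if "x \<in> {0..1}" for x using that by simp
  have "f \<xi> = f (frac \<xi> + of_int \<lfloor>\<xi>\<rfloor>)" by (simp add: frac_def)
  also have "\<dots> = f (frac \<xi>)" by (rule periodic_int[of f, OF per])
  also have "\<dots> = 0" using frac_lt_1[of \<xi>] by (intro *) auto
  finally show ?thesis .
qed

section \<open>Multiplication by absolutely convergent Fourier series\<close>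

lemma continuous_on_infsum_fchar:
  fixes s :: "'i \<Rightarrow> int"
  assumes "(\<lambda>i. norm (\<gamma> i)) summable_on UNIV"
  shows "continuous_on UNIV (\<lambda>\<xi>. \<Sum>\<^sub>\<infinity>i\<in>UNIV. \<gamma> i * fchar (s i) \<xi>)"
proof (rule uniform_limit_theorem)
  show "uniform_limit UNIV (\<lambda>X \<xi>. \<Sum>i\<in>X. \<gamma> i * fchar (s i) \<xi>)
     (\<lambda>\<xi>. \<Sum>\<^sub>\<infinity>i\<in>UNIV. \<gamma> i * fchar (s i) \<xi>) (finite_subsets_at_top UNIV)"
    by (rule Weierstrass_m_test_general[OF _ assms]) (simp add: norm_mult)
  show "\<forall>\<^sub>F X in finite_subsets_at_top UNIV. continuous_on UNIV (\<lambda>\<xi>. \<Sum>i\<in>X. \<gamma> i * fchar (s i) \<xi>)"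
    by (intro always_eventually allI continuous_intros)
qed simp

text \<open>Multiplying by the character of frequency \<open>s i\<close> shifts coefficients by
  \<open>s i\<close>, and the series may be integrated termwise. Frequencies may repeat: the index
  will be a pair (p, q) with frequency -q or -(p + q), so double series need not be collected by
  frequency.\<close>

lemma coeff_infsum_mult:
  fixes s :: "'i \<Rightarrow> int"
  assumes cnt: "countable (UNIV :: 'i set)" "infinite (UNIV :: 'i set)"
    and sm: "(\<lambda>i. norm (\<gamma> i)) summable_on UNIV" and f: "square_integrable period f"
  shows "((\<lambda>i. \<gamma> i * ip period f (fchar (n - s i))) has_sum
     ip period (\<lambda>\<xi>. (\<Sum>\<^sub>\<infinity>i\<in>UNIV. \<gamma> i * fchar (s i) \<xi>) * f \<xi>) (fchar n)) UNIV"
proof -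
  define g where "g i \<xi> = \<gamma> i * fchar (s i) \<xi> * f \<xi> * cnj (fchar n \<xi>)" for i \<xi>
  have gf: "g i \<xi> = \<gamma> i * (f \<xi> * cnj (fchar (n - s i) \<xi>))" for i \<xi>
    using fchar_add[of "s i" "- n" \<xi>] by (simp add: g_def cnj_fchar)
  have i1: "integrable period (\<lambda>\<xi>. f \<xi> * cnj (fchar (n - s i) \<xi>))" for i
    by (rule integrable_ip[OF f square_integrable_fchar])
  have ng: "norm (g i \<xi>) = norm (\<gamma> i) * norm (f \<xi>)" for i \<xi>
    by (simp add: gf norm_mult)
  have int: "integrable period (g i)" for i
    using i1 unfolding gf by simp
  have sm': "(\<lambda>i. norm (g i \<xi>)) summable_on UNIV" for \<xi>
    unfolding ng by (rule summable_on_cmult_left[OF sm])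
  have sint: "(\<lambda>i. LINT \<xi>|period. norm (g i \<xi>)) summable_on UNIV"
    unfolding ng by (simp, rule summable_on_cmult_left[OF sm])
  have e1: "(LINT \<xi>|period. g i \<xi>) = \<gamma> i * ip period f (fchar (n - s i))" for i
    unfolding gf ip_def by simp
  have e2: "(\<Sum>\<^sub>\<infinity>i\<in>UNIV. g i \<xi>) = (\<Sum>\<^sub>\<infinity>i\<in>UNIV. \<gamma> i * fchar (s i) \<xi>) * f \<xi> * cnj (fchar n \<xi>)" for \<xi>
    unfolding g_def by (simp add: infsum_cmult_left' )
  show ?thesis
    using has_sum_integral(2)[of period g, OF cnt int sm' sint]
    unfolding e1 e2 ip_def .
qed

lemma infsum_fchar_bound:
  fixes s :: "'i \<Rightarrow> int"
  assumes sm: "(\<lambda>i. norm (\<gamma> i)) summable_on UNIV"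
  shows "norm (\<Sum>\<^sub>\<infinity>i\<in>UNIV. \<gamma> i * fchar (s i) \<xi>) \<le> (\<Sum>\<^sub>\<infinity>i\<in>UNIV. norm (\<gamma> i))"
  using norm_infsum_bound[of "\<lambda>i. \<gamma> i * fchar (s i) \<xi>" UNIV] sm by (simp add: norm_mult)

text \<open>The coefficients come from \<open>coeff_infsum_mult\<close>; what remains is
  convergence. Replace \<open>f\<close> by a trigonometric polynomial at the cost of the bound
  \<open>B\<close> of the multiplier, then expand the continuous product.\<close>

lemma expansion_infsum_mult:
  fixes s :: "'i \<Rightarrow> int"
  assumes cnt: "countable (UNIV :: 'i set)" "infinite (UNIV :: 'i set)"
    and sm: "(\<lambda>i. norm (\<gamma> i)) summable_on UNIV" and f: "L2_expansion period fchar c f"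
  shows "L2_expansion period fchar (\<lambda>n. \<Sum>\<^sub>\<infinity>i\<in>UNIV. \<gamma> i * c (n - s i))
     (\<lambda>\<xi>. (\<Sum>\<^sub>\<infinity>i\<in>UNIV. \<gamma> i * fchar (s i) \<xi>) * f \<xi>)"
proof -
  define G where "G \<xi> = (\<Sum>\<^sub>\<infinity>i\<in>UNIV. \<gamma> i * fchar (s i) \<xi>)" for \<xi>
  \<comment> \<open>The added 1 makes the bound positive, so that it can be divided by.\<close>
  define B where "B = (\<Sum>\<^sub>\<infinity>i\<in>UNIV. norm (\<gamma> i)) + 1"
  have B: "norm (G \<xi>) \<le> B" for \<xi>
    using infsum_fchar_bound[OF sm, of s \<xi>] by (simp add: G_def B_def)
  have Bpos: "B > 0" unfolding B_def by (simp add: infsum_nonneg add_nonneg_pos)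
  have sqf: "square_integrable period f" using f by (simp add: L2_expansion_def)
  have contG: "continuous_on UNIV G"
    unfolding G_def by (rule continuous_on_infsum_fchar[OF sm])
  have perG: "G (\<xi> + 1) = G \<xi>" for \<xi> by (simp add: G_def fchar_plus_1)
  note mG = measurable_period_continuous[OF contG]
  have sqGf: "square_integrable period (\<lambda>\<xi>. G \<xi> * f \<xi>)"
    by (rule square_integrable_bounded_mult[OF sqf mG B])
  have "L2_expansion period fchar (\<lambda>n. ip period (\<lambda>\<xi>. G \<xi> * f \<xi>) (fchar n)) (\<lambda>\<xi>. G \<xi> * f \<xi>)"
  proof (rule fourier.expansionI_approx[OF sqGf])
    fix \<epsilon> :: real assume e: "\<epsilon> > 0"
    then obtain F where F: "finite F" "L2norm period (\<lambda>x. f x - (\<Sum>n\<in>F. c n * fchar n x)) < \<epsilon> / 2 / B"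
      using fourier.expansion_approx[OF f, of "\<epsilon> / 2 / B"] Bpos by auto
    define p where "p \<xi> = (\<Sum>n\<in>F. c n * fchar n \<xi>)" for \<xi>
    have contp: "continuous_on UNIV p" unfolding p_def by (intro continuous_intros)
    have sqp: "square_integrable period p" by (rule square_integrable_continuous[OF contp])
    have "L2norm period (\<lambda>x. G x * (f x - p x)) \<le> B * L2norm period (\<lambda>x. f x - p x)"
      by (rule L2norm_mono_bound[OF square_integrable_diff[OF sqf sqp] mG B])
    also have "\<dots> < B * (\<epsilon> / 2 / B)"
      using F(2) Bpos unfolding p_def by (intro mult_strict_left_mono) auto
    finally have 1: "L2norm period (\<lambda>x. G x * f x - G x * p x) < \<epsilon> / 2"
      using Bpos by (simp add: right_diff_distrib)
    have contGp: "continuous_on UNIV (\<lambda>x. G x * p x)" by (intro continuous_intros contG contp)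
    have "L2_expansion period fchar (\<lambda>n. ip period (\<lambda>x. G x * p x) (fchar n)) (\<lambda>x. G x * p x)"
      by (rule fourier_expansion_continuous[OF _ contGp]) (simp add: perG p_def fchar_plus_1)
    from fourier.expansion_approx[OF this, of "\<epsilon> / 2"] e obtain H where H: "finite H"
      "L2norm period (\<lambda>x. G x * p x - (\<Sum>n\<in>H. ip period (\<lambda>x. G x * p x) (fchar n) * fchar n x)) < \<epsilon> / 2"
      by auto
    have "L2norm period (\<lambda>x. G x * f x - (\<Sum>n\<in>H. ip period (\<lambda>x. G x * p x) (fchar n) * fchar n x)) < \<epsilon>"
      using L2norm_triangle_diff[OF sqGf square_integrable_continuous[OF contGp] fourier.square_integrable_comb,
          of "\<lambda>n. ip period (\<lambda>x. G x * p x) (fchar n)" H] 1 H(2) by linarith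
    with H(1) show "\<exists>F a. finite F \<and> L2norm period (\<lambda>x. G x * f x - (\<Sum>n\<in>F. a n * fchar n x)) < \<epsilon>"
      by (intro exI[of _ H] exI[of _ "\<lambda>n. ip period (\<lambda>x. G x * p x) (fchar n)"]) simp
  qed
  moreover have "ip period (\<lambda>\<xi>. G \<xi> * f \<xi>) (fchar n) = (\<Sum>\<^sub>\<infinity>i\<in>UNIV. \<gamma> i * c (n - s i))" for n
    using coeff_infsum_mult[OF cnt sm sqf, of n s]
    unfolding fourier.expansion_coeff[OF f] G_def by (simp add: infsumI)
  ultimately show ?thesis unfolding G_def by simp
qed

section \<open>Reflection of the period\<close>

lemma measurable_reflect_lebesgue: "(\<lambda>x::real. 1 - x) \<in> lebesgue \<rightarrow>\<^sub>M lebesgue"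
  using lebesgue_affine_measurable[of "\<lambda>_::real. -1" 1] by simp

lemma distr_reflect_lebesgue: "distr lebesgue lebesgue (\<lambda>x::real. 1 - x) = lebesgue"
  using lebesgue_real_affine[of "-1" 1] by (simp add: density_1)

lemma square_integrable_period_iff:
  fixes u :: "real \<Rightarrow> 'b::euclidean_space"
  shows "square_integrable period u \<longleftrightarrow> square_integrable lebesgue (\<lambda>x. indicator {0..1} x *\<^sub>R u x)"
proof -
  have eq: "(norm (indicator {0..1} x *\<^sub>R u x))\<^sup>2 = indicator {0..1} x *\<^sub>R (norm (u x))\<^sup>2" for x :: real
    by (auto simp: indicator_def)
  show ?thesis
    unfolding square_integrable_def eq
    by (subst integrable_restrict_space) (auto simp: borel_measurable_restrict_space_iff)
qed

lemma L2norm_period_lebesgue: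
  fixes u :: "real \<Rightarrow> 'b::euclidean_space"
  shows "L2norm period u = L2norm lebesgue (\<lambda>x. indicator {0..1} x *\<^sub>R u x)"
proof -
  have eq: "(norm (indicator {0..1} x *\<^sub>R u x))\<^sup>2 = indicator {0..1} x *\<^sub>R (norm (u x))\<^sup>2" for x :: real
    by (auto simp: indicator_def)
  show ?thesis unfolding L2norm_def eq by (subst integral_restrict_space) auto
qed

text \<open>By periodicity u(-x) = u(1 - x), and unlike -x the map sending x to 1 - x preserves the
  interval [0,1] together with the measure.\<close>

lemma reflect_period:
  fixes u :: "real \<Rightarrow> 'b::euclidean_space"
  assumes per: "\<And>\<xi>. u (\<xi> + 1) = u \<xi>" and u: "square_integrable period u"
  shows "square_integrable period (\<lambda>\<xi>. u (- \<xi>))" "L2norm period (\<lambda>\<xi>. u (- \<xi>)) = L2norm period u"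
proof -
  define w where "w x = indicator {0..1} x *\<^sub>R u x" for x :: real
  have w: "w \<in> borel_measurable lebesgue" "integrable lebesgue (\<lambda>x. (norm (w x))\<^sup>2)"
    using u unfolding square_integrable_period_iff w_def[symmetric] by (auto simp: square_integrable_def)
  have eq: "(\<lambda>x. indicator {0..1} x *\<^sub>R u (- x)) = (\<lambda>x. w (1 - x))"
    using per[of "- x" for x] by (auto simp: w_def indicator_def fun_eq_iff)
  note m = measurable_reflect_lebesgue
  have mw: "(\<lambda>x. (norm (w x))\<^sup>2) \<in> borel_measurable lebesgue" using w(1) by measurable
  have "(\<lambda>x. w (1 - x)) \<in> borel_measurable lebesgue"
    using measurable_compose[OF m w(1)] .
  moreover have "integrable lebesgue (\<lambda>x. (norm (w (1 - x)))\<^sup>2)"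
    using integrable_distr[OF m, of "\<lambda>x. (norm (w x))\<^sup>2"] w(2) unfolding distr_reflect_lebesgue by simp
  ultimately show "square_integrable period (\<lambda>\<xi>. u (- \<xi>))"
    unfolding square_integrable_period_iff eq by (simp add: square_integrable_def)
  have "(LINT x|lebesgue. (norm (w (1 - x)))\<^sup>2) = (LINT x|lebesgue. (norm (w x))\<^sup>2)"
    using integral_distr[OF m mw] unfolding distr_reflect_lebesgue by simp
  then show "L2norm period (\<lambda>\<xi>. u (- \<xi>)) = L2norm period u"
    unfolding L2norm_period_lebesgue eq w_def[symmetric] by (simp add: L2norm_def)
qed

lemma L2norm_cnj: "L2norm M (\<lambda>x. cnj (u x)) = L2norm M u"
  by (simp add: L2norm_def)

text \<open>Conjugation negates the frequency and reflection negates it again, so the index n stays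
  in place. This is the second entry of \<open>conj_pair\<close>.\<close>

lemma expansion_cnj_reflect:
  fixes f :: "real \<Rightarrow> complex"
  assumes per: "\<And>\<xi>. f (\<xi> + 1) = f \<xi>" and f: "L2_expansion period fchar c f"
  shows "L2_expansion period fchar (\<lambda>n. cnj (c n)) (\<lambda>\<xi>. cnj (f (- \<xi>)))"
proof -
  have sqf: "square_integrable period f" using f by (simp add: L2_expansion_def)
  have "L2norm period (\<lambda>\<xi>. cnj (f (- \<xi>)) - (\<Sum>n\<in>F. cnj (c n) * fchar n \<xi>)) =
    L2norm period (\<lambda>\<xi>. f \<xi> - (\<Sum>n\<in>F. c n * fchar n \<xi>))" for F
  proof -
    define d where "d \<xi> = f \<xi> - (\<Sum>n\<in>F. c n * fchar n \<xi>)" for \<xi>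
    have d: "square_integrable period d"
      unfolding d_def by (intro square_integrable_diff sqf fourier.square_integrable_comb)
    have "cnj (f (- \<xi>)) - (\<Sum>n\<in>F. cnj (c n) * fchar n \<xi>) = cnj (d (- \<xi>))" for \<xi>
      by (simp add: d_def cnj_fchar fchar_minus)
    then have "L2norm period (\<lambda>\<xi>. cnj (f (- \<xi>)) - (\<Sum>n\<in>F. cnj (c n) * fchar n \<xi>)) = L2norm period (\<lambda>\<xi>. d (- \<xi>))"
      by (simp only: L2norm_cnj)
    also have "\<dots> = L2norm period d"
      by (rule reflect_period(2)[OF _ d]) (simp add: d_def per fchar_plus_1)
    finally show ?thesis unfolding d_def .
  qed
  moreover have "square_integrable period (\<lambda>\<xi>. cnj (f (- \<xi>)))"
    by (intro square_integrable_cnj reflect_period(1)[OF per sqf])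
  ultimately show ?thesis using f by (simp add: L2_expansion_def)
qed

section \<open>The theta function and the matrix \<open>A\<^sub>r\<^sub>e\<^sub>c\<^sub>t\<close>\<close>

lemma has_sum_int:
  fixes f :: "int \<Rightarrow> 'b::topological_comm_monoid_add"
  assumes A: "((\<lambda>k. f (int (Suc k))) has_sum A) UNIV" and B: "((\<lambda>k. f (- int (Suc k))) has_sum B) UNIV"
  shows "(f has_sum (f 0 + A + B)) UNIV"
proof -
  let ?P = "range (\<lambda>k. int (Suc k))" and ?N = "range (\<lambda>k. - int (Suc k))"
  have "n \<in> {0} \<union> ?P \<union> ?N" for n :: int
  proof (cases n)
    case (nonneg k)
    then show ?thesis by (cases k) auto
  next
    case (neg k)
    then show ?thesis by blast
  qed
  then have U: "({0} \<union> ?P) \<union> ?N = (UNIV :: int set)" by blast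
  have "(f has_sum A) ?P"
    using A by (subst has_sum_reindex) (auto simp: o_def inj_def)
  moreover have "(f has_sum B) ?N"
    using B by (subst has_sum_reindex) (auto simp: o_def inj_def)
  moreover have "(f has_sum f 0) {0}"
    using has_sum_finite[of "{0}" f] by simp
  ultimately have "(f has_sum (f 0 + A + B)) (({0} \<union> ?P) \<union> ?N)"
    by (intro has_sum_Un_disjoint) auto
  then show ?thesis by (simp only: U)
qed

lemma abs_summable_prod:
  fixes f :: "'i \<Rightarrow> 'b::{banach,real_normed_field}" and g :: "'j \<Rightarrow> 'b"
  assumes "(\<lambda>i. norm (f i)) summable_on UNIV" "(\<lambda>j. norm (g j)) summable_on UNIV"
  shows "(\<lambda>(i,j). norm (f i * g j)) summable_on UNIV"
    and "((\<lambda>(i,j). f i * g j) has_sum ((\<Sum>\<^sub>\<infinity>i\<in>UNIV. f i) * (\<Sum>\<^sub>\<infinity>j\<in>UNIV. g j))) UNIV"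
proof -
  have "(\<lambda>p. norm (f (fst p) * g (snd p))) summable_on Sigma UNIV (\<lambda>_. UNIV)"
    unfolding Infinite_Sum.abs_summable_on_Sigma_iff
  proof (intro conjI ballI)
    show "(\<lambda>y. norm (f (fst (i, y)) * g (snd (i, y)))) summable_on UNIV" for i
      using summable_on_cmult_right[OF assms(2)] by (simp add: norm_mult)
    have e: "(\<Sum>\<^sub>\<infinity>y\<in>UNIV. norm (f (fst (x, y)) * g (snd (x, y)))) = norm (f x) * (\<Sum>\<^sub>\<infinity>y\<in>UNIV. norm (g y))" for x
      by (simp add: norm_mult infsum_cmult_right')
    show "(\<lambda>x. norm (\<Sum>\<^sub>\<infinity>y\<in>UNIV. norm (f (fst (x, y)) * g (snd (x, y))))) summable_on UNIV"
      unfolding e using summable_on_cmult_left[OF assms(1)]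
      by (simp add: norm_mult infsum_nonneg)
  qed
  then have s: "(\<lambda>p. norm (f (fst p) * g (snd p))) summable_on UNIV" by simp
  then show "(\<lambda>(i,j). norm (f i * g j)) summable_on UNIV" by (simp add: case_prod_beta')
  from s have "(\<lambda>p. f (fst p) * g (snd p)) summable_on UNIV" by (rule abs_summable_summable)
  then have h: "((\<lambda>p. f (fst p) * g (snd p)) has_sum (\<Sum>\<^sub>\<infinity>p\<in>UNIV. f (fst p) * g (snd p))) (Sigma UNIV (\<lambda>_. UNIV))"
    by simp
  have hg: "(g has_sum (\<Sum>\<^sub>\<infinity>j\<in>UNIV. g j)) UNIV"
    by (rule has_sum_infsum[OF abs_summable_summable[OF assms(2)]])
  have "((\<lambda>i. f i * (\<Sum>\<^sub>\<infinity>j\<in>UNIV. g j)) has_sum (\<Sum>\<^sub>\<infinity>p\<in>UNIV. f (fst p) * g (snd p))) UNIV"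
  proof (rule has_sum_SigmaD[OF h])
    show "((\<lambda>y. f (fst (i, y)) * g (snd (i, y))) has_sum (f i * (\<Sum>\<^sub>\<infinity>j\<in>UNIV. g j))) UNIV" for i
      unfolding fst_conv snd_conv by (rule has_sum_cmult_right[OF hg])
  qed
  moreover have "((\<lambda>i. f i * (\<Sum>\<^sub>\<infinity>j\<in>UNIV. g j)) has_sum (\<Sum>\<^sub>\<infinity>i\<in>UNIV. f i) * (\<Sum>\<^sub>\<infinity>j\<in>UNIV. g j)) UNIV"
    by (rule has_sum_cmult_left[OF has_sum_infsum[OF abs_summable_summable[OF assms(1)]]])
  ultimately have "(\<Sum>\<^sub>\<infinity>p\<in>UNIV. f (fst p) * g (snd p)) = (\<Sum>\<^sub>\<infinity>i\<in>UNIV. f i) * (\<Sum>\<^sub>\<infinity>j\<in>UNIV. g j)"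
    by (rule has_sum_unique)
  with h show "((\<lambda>(i,j). f i * g j) has_sum ((\<Sum>\<^sub>\<infinity>i\<in>UNIV. f i) * (\<Sum>\<^sub>\<infinity>j\<in>UNIV. g j))) UNIV"
    by (simp add: case_prod_beta')
qed

section \<open>Gaussian weights and the theta series\<close>

definition gw :: "real \<Rightarrow> int \<Rightarrow> real" where
  "gw \<gamma> p = exp (- (pi\<^sup>2 * (of_int p)\<^sup>2 / \<gamma>\<^sup>2))"

lemma gw_pos [simp]: "gw \<gamma> p > 0" and gw_minus [simp]: "gw \<gamma> (- p) = gw \<gamma> p" and gw_0 [simp]: "gw \<gamma> 0 = 1"
  by (simp_all add: gw_def)

lemma gw_le_geometric:
  assumes "\<gamma> \<noteq> 0"
  shows "gw \<gamma> (int (Suc k)) \<le> exp (- (pi\<^sup>2 / \<gamma>\<^sup>2)) ^ Suc k"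
proof -
  have "1 * real (Suc k) \<le> real (Suc k) * real (Suc k)"
    by (intro mult_right_mono) auto
  then have "pi\<^sup>2 / \<gamma>\<^sup>2 * real (Suc k) \<le> pi\<^sup>2 / \<gamma>\<^sup>2 * (real (Suc k))\<^sup>2"
    by (intro mult_left_mono) (simp_all only: power2_eq_square mult_1 zero_le_divide_iff zero_le_square HOL.simp_thms)
  then have "gw \<gamma> (int (Suc k)) \<le> exp (real (Suc k) * (- (pi\<^sup>2 / \<gamma>\<^sup>2)))"
    by (simp add: gw_def mult.commute)
  also have "\<dots> = exp (- (pi\<^sup>2 / \<gamma>\<^sup>2)) ^ Suc k" by (rule exp_of_nat_mult)
  finally show ?thesis .
qed

lemma summable_gw_nat:
  assumes "\<gamma> \<noteq> 0"
  shows "summable (\<lambda>k. gw \<gamma> (int (Suc k)))"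
proof (rule summable_comparison_test)
  show "summable (\<lambda>k. exp (- (pi\<^sup>2 / \<gamma>\<^sup>2)) ^ Suc k)"
    unfolding summable_Suc_iff[of "\<lambda>k. exp (- (pi\<^sup>2 / \<gamma>\<^sup>2)) ^ k"]
    using assms by (intro summable_geometric) simp
  show "\<exists>N. \<forall>n\<ge>N. norm (gw \<gamma> (int (Suc n))) \<le> exp (- (pi\<^sup>2 / \<gamma>\<^sup>2)) ^ Suc n"
    using gw_le_geometric[OF assms] gw_pos[of \<gamma>]
    by (intro exI[of _ 0]) (simp only: real_norm_def abs_of_pos simp_thms)
qed

lemma summable_gw:
  assumes "\<gamma> \<noteq> 0"
  shows "gw \<gamma> summable_on UNIV"
proof -
  have "((\<lambda>k. gw \<gamma> (int (Suc k))) has_sum (\<Sum>k. gw \<gamma> (int (Suc k)))) UNIV"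
    using summable_gw_nat[OF assms]
    by (intro norm_summable_imp_has_sum summable_sums) (simp_all only: real_norm_def abs_of_pos gw_pos)
  then show ?thesis
    using has_sum_int[of "gw \<gamma>"] unfolding gw_minus summable_on_def by blast
qed

lemma norm_summable_gw:
  assumes "\<gamma> \<noteq> 0"
  shows "(\<lambda>p. norm (complex_of_real (gw \<gamma> p))) summable_on UNIV"
  using summable_gw[OF assms] by (simp add: abs_of_pos)

lemma summable_ell:
  assumes "\<gamma> \<noteq> 0"
  shows "summable (\<lambda>k. norm (gw \<gamma> (int (Suc k)) * cos (2 * pi * real (Suc k) * \<xi>)))"
proof (rule summable_comparison_test[OF _ summable_gw_nat[OF assms]], intro exI allI impI)
  fix k
  have "gw \<gamma> (int (Suc k)) * \<bar>cos (2 * pi * real (Suc k) * \<xi>)\<bar> \<le> gw \<gamma> (int (Suc k)) * 1"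
    by (intro mult_left_mono abs_cos_le_one less_imp_le gw_pos)
  then show "norm (norm (gw \<gamma> (int (Suc k)) * cos (2 * pi * real (Suc k) * \<xi>))) \<le> gw \<gamma> (int (Suc k))"
    by (simp only: real_norm_def abs_abs abs_mult abs_of_pos gw_pos mult_1_right)
qed

lemma ell_alt: "ell \<gamma> \<xi> = 1 + 2 * (\<Sum>k. gw \<gamma> (int (Suc k)) * cos (2 * pi * real (Suc k) * \<xi>))"
  by (simp add: ell_def gw_def)

text \<open>Two-sided form of the cosine series: the terms for k and -k add up to a cosine. Only the
  sum A + B of the one-sided series has to be identified.\<close>

lemma has_sum_ell:
  assumes "\<gamma> \<noteq> 0"
  shows "((\<lambda>p. of_real (gw \<gamma> p) * fchar p \<xi>) has_sum of_real (ell \<gamma> \<xi>)) UNIV"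
proof -
  define g where "g k = complex_of_real (gw \<gamma> (int (Suc k)))" for k
  define c where "c k = 2 * pi * real (Suc k) * \<xi>" for k
  have cos: "((\<lambda>k. gw \<gamma> (int (Suc k)) * cos (c k)) has_sum (\<Sum>k. gw \<gamma> (int (Suc k)) * cos (c k))) UNIV"
    unfolding c_def
    by (intro norm_summable_imp_has_sum summable_sums summable_ell[OF assms] summable_norm_cancel[OF summable_ell[OF assms]])
  have abs: "(\<lambda>k. norm (g k * cis (s * c k))) summable_on UNIV" for s
    unfolding g_def norm_mult using summable_gw_nat[OF assms]
    by (simp add: summable_on_UNIV_nonneg_real_iff abs_of_pos less_imp_le)
  obtain A where A: "((\<lambda>k. g k * cis (- c k)) has_sum A) UNIV"
    using abs_summable_summable[OF abs[of "-1"]] by (auto simp: summable_on_def)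
  obtain B where B: "((\<lambda>k. g k * cis (c k)) has_sum B) UNIV"
    using abs_summable_summable[OF abs[of 1]] by (auto simp: summable_on_def)
  have "((\<lambda>p. of_real (gw \<gamma> p) * fchar p \<xi>) has_sum (of_real (gw \<gamma> 0) * fchar 0 \<xi> + A + B)) UNIV"
  proof (rule has_sum_int)
    show "((\<lambda>k. of_real (gw \<gamma> (int (Suc k))) * fchar (int (Suc k)) \<xi>) has_sum A) UNIV"
      using A by (simp add: fchar_cis g_def c_def)
    show "((\<lambda>k. of_real (gw \<gamma> (- int (Suc k))) * fchar (- int (Suc k)) \<xi>) has_sum B) UNIV"
      using B unfolding gw_minus fchar_cis g_def c_def by (simp add: algebra_simps)
  qed
  moreover have "((\<lambda>k. g k * cis (- c k) + g k * cis (c k)) has_sum (A + B)) UNIV"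
    by (rule has_sum_add[OF A B])
  then have "((\<lambda>k. complex_of_real (2 * (gw \<gamma> (int (Suc k)) * cos (c k)))) has_sum (A + B)) UNIV"
    by (rule has_sum_cong[THEN iffD1, rotated]) (simp add: g_def complex_eq_iff)
  then have "A + B = of_real (2 * (\<Sum>k. gw \<gamma> (int (Suc k)) * cos (c k)))"
    using has_sum_of_real[OF has_sum_cmult_right[OF cos, of 2]] has_sum_unique by blast
  ultimately show ?thesis unfolding ell_alt c_def[symmetric] by (simp add: add.assoc)
qed

lemma ell_infsum:
  assumes "\<gamma> \<noteq> 0"
  shows "of_real (ell \<gamma> \<xi>) = (\<Sum>\<^sub>\<infinity>p\<in>UNIV. of_real (gw \<gamma> p) * fchar p \<xi>)"
  by (rule infsumI[symmetric]) (rule has_sum_ell[OF assms])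

lemma ell_minus: "ell \<gamma> (- \<xi>) = ell \<gamma> \<xi>"
  by (simp add: ell_alt)

lemma ell_plus_1:
  assumes "\<gamma> \<noteq> 0"
  shows "ell \<gamma> (\<xi> + 1) = ell \<gamma> \<xi>"
proof -
  have "complex_of_real (ell \<gamma> (\<xi> + 1)) = of_real (ell \<gamma> \<xi>)"
    unfolding ell_infsum[OF assms] fchar_plus_1 ..
  then show ?thesis by (simp only: of_real_eq_iff)
qed

lemma continuous_on_ell:
  assumes "\<gamma> \<noteq> 0"
  shows "continuous_on A (ell \<gamma>)"
proof -
  have "continuous_on UNIV (\<lambda>\<xi>. Re (\<Sum>\<^sub>\<infinity>p\<in>UNIV. of_real (gw \<gamma> p) * fchar p \<xi>))"
    by (intro continuous_intros continuous_on_infsum_fchar[of _ "\<lambda>p. p"] norm_summable_gw assms)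
  then have "continuous_on UNIV (ell \<gamma>)"
    by (simp flip: ell_infsum[OF assms])
  then show ?thesis by (rule continuous_on_subset) simp
qed

lemma ell_0_ge_1:
  assumes "\<gamma> \<noteq> 0"
  shows "ell \<gamma> 0 \<ge> 1"
  using suminf_nonneg[OF summable_gw_nat[OF assms]] less_imp_le[OF gw_pos]
  by (simp add: ell_alt del: of_nat_Suc)

text \<open>All terms of ell(0) - ell(\<xi>) are nonnegative, and the first one, of frequency 1, is
  positive unless \<xi> is an integer.\<close>

lemma ell_less_ell_0:
  assumes "\<gamma> \<noteq> 0" "\<xi> \<notin> \<int>"
  shows "ell \<gamma> \<xi> < ell \<gamma> 0"
proof -
  let ?w = "\<lambda>k. gw \<gamma> (int (Suc k))"
  let ?d = "\<lambda>k. ?w k - ?w k * cos (2 * pi * real (Suc k) * \<xi>)"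
  note s = summable_norm_cancel[OF summable_ell[OF assms(1), of \<xi>]]
  have nn: "?d k \<ge> 0" for k
    using mult_left_mono[OF cos_le_one[of "2 * pi * real (Suc k) * \<xi>"] less_imp_le[OF gw_pos[of \<gamma> "int (Suc k)"]]]
    by (simp del: of_nat_Suc)
  have "cos (2 * pi * \<xi>) \<noteq> 1"
  proof
    assume "cos (2 * pi * \<xi>) = 1"
    then obtain n :: int where "2 * pi * \<xi> = of_int n * 2 * pi" by (auto simp: cos_one_2pi_int)
    then have "\<xi> = of_int n" by simp
    with assms(2) show False by simp
  qed
  then have "cos (2 * pi * \<xi>) < 1" using cos_le_one[of "2 * pi * \<xi>"] by linarith
  then have "?w 0 * cos (2 * pi * \<xi>) < ?w 0 * 1" by (intro mult_strict_left_mono gw_pos)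
  then have "?d 0 > 0" by simp
  then have "suminf ?d > 0"
    using nn by (intro suminf_pos2[of _ 0] summable_diff summable_gw_nat[OF assms(1)] s)
  also have "suminf ?d = suminf ?w - (\<Sum>k. ?w k * cos (2 * pi * real (Suc k) * \<xi>))"
    by (rule suminf_diff[symmetric]) (intro summable_gw_nat[OF assms(1)] s)+
  finally show ?thesis by (simp add: ell_alt del: of_nat_Suc)
qed

text \<open>With x = exp(-pi^2/\<gamma>^2) the deviation is at most 2x/(1 - x), and x \<le> 1/8
  because exp 3 \<ge> 2^3. The threshold 3 is met at \<gamma>^2 = pi as well as for all small
  \<gamma>, the two uses below.\<close>

lemma ell_near_1:
  assumes "\<gamma> \<noteq> 0" "pi\<^sup>2 / \<gamma>\<^sup>2 \<ge> 3"
  shows "\<bar>ell \<gamma> \<xi> - 1\<bar> \<le> 2 / 7"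
proof -
  let ?x = "exp (- (pi\<^sup>2 / \<gamma>\<^sup>2))"
  have "(2::real) ^ 3 \<le> exp 1 ^ 3"
    using exp_ge_add_one_self[of 1] by (intro power_mono) auto
  also have "\<dots> = exp (3::real)" by (simp flip: exp_of_nat_mult)
  also have "\<dots> \<le> exp (pi\<^sup>2 / \<gamma>\<^sup>2)" using assms(2) by simp
  finally have x: "?x \<le> 1 / 8" by (simp add: exp_minus field_simps)
  have xpos: "0 < ?x" by simp
  note s = summable_ell[OF assms(1), of \<xi>]
  have g: "(\<lambda>k. ?x ^ Suc k) sums (?x / (1 - ?x))"
  proof -
    have "norm ?x < 1" unfolding real_norm_def using x xpos by linarith
    from sums_mult[OF geometric_sums[OF this], of ?x] show ?thesis
      by (simp only: power_Suc times_divide_eq_right mult_1_right)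
  qed
  have "\<bar>\<Sum>k. gw \<gamma> (int (Suc k)) * cos (2 * pi * real (Suc k) * \<xi>)\<bar> \<le>
     (\<Sum>k. norm (gw \<gamma> (int (Suc k)) * cos (2 * pi * real (Suc k) * \<xi>)))"
    using summable_norm[OF s] by simp
  also have "\<dots> \<le> (\<Sum>k. gw \<gamma> (int (Suc k)))"
  proof (rule suminf_le[OF _ s summable_gw_nat[OF assms(1)]])
    fix k
    have "gw \<gamma> (int (Suc k)) * \<bar>cos (2 * pi * real (Suc k) * \<xi>)\<bar> \<le> gw \<gamma> (int (Suc k)) * 1"
      by (intro mult_left_mono abs_cos_le_one less_imp_le gw_pos)
    then show "norm (gw \<gamma> (int (Suc k)) * cos (2 * pi * real (Suc k) * \<xi>)) \<le> gw \<gamma> (int (Suc k))"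
      by (simp only: real_norm_def abs_mult abs_of_pos gw_pos mult_1_right)
  qed
  also have "\<dots> \<le> (\<Sum>k. ?x ^ Suc k)"
    using gw_le_geometric[OF assms(1)] summable_gw_nat[OF assms(1)] sums_summable[OF g] by (rule suminf_le)
  also have "\<dots> = ?x / (1 - ?x)" using g by (simp add: sums_iff)
  also have "\<dots> \<le> 1 / 7"
  proof -
    have "y / (1 - y) \<le> 1 / 7" if "0 < y" "y \<le> 1 / 8" for y :: real
      using that by (simp add: field_simps)
    from this[OF xpos x] show ?thesis .
  qed
  finally show ?thesis by (simp add: ell_alt abs_mult)
qed

section \<open>Absence of real zeros of the theta function\<close>

lemma fchar_double: "fchar (2 * S) \<xi> = fchar S (2 * \<xi>)"
  by (simp add: fchar_cis mult_ac)

lemma fchar_plus: "fchar S (\<xi> + \<eta>) = fchar S \<xi> * fchar S \<eta>"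
  by (simp add: fchar_cis cis_mult algebra_simps)

lemma fchar_at_0 [simp]: "fchar n 0 = 1"
  by (simp add: fchar_cis)

lemma fchar_half_sq: "fchar (m + m) (1/2) = 1"
  using fchar_double[of m "1/2"] fchar_plus_1[of m 0] by simp

lemma fchar_half_odd: "odd s \<Longrightarrow> fchar s (1/2) = -1"
proof -
  assume "odd s"
  then obtain k where k: "s = 2 * k + 1" by (elim oddE)
  have "fchar s (1/2) = fchar (k + k) (1/2) * fchar 1 (1/2)"
    unfolding k by (simp flip: fchar_add)
  also have "\<dots> = cis (- pi)" unfolding fchar_half_sq by (simp add: fchar_cis)
  finally show ?thesis by (simp add: complex_eq_iff)
qed

text \<open>In the double series for the left-hand side the terms with \<open>n + m\<close> odd cancel under
  \<open>n \<leftrightarrow> m\<close>; the others are reindexed by \<open>n = S + D\<close>, \<open>m = S - D\<close>.\<close>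

lemma ell_duplication:
  assumes "\<gamma> \<noteq> 0"
  shows "ell \<gamma> \<xi> * ell \<gamma> (\<xi> + 1/2) = ell (\<gamma> / sqrt 2) (2 * \<xi> + 1/2) * ell (\<gamma> / sqrt 2) (1/2)"
proof -
  let ?\<gamma>' = "\<gamma> / sqrt 2"
  have g': "?\<gamma>' \<noteq> 0" using assms by simp
  have abs: "(\<lambda>p. norm (of_real (gw \<gamma> p) * fchar p \<xi>)) summable_on UNIV" if "\<gamma> \<noteq> 0" for \<gamma> \<xi>
    using norm_summable_gw[OF that] by (simp add: norm_mult)
  define h where "h p = (of_real (gw \<gamma> (fst p)) * fchar (fst p) \<xi>) * (of_real (gw \<gamma> (snd p)) * fchar (snd p) (\<xi> + 1/2))" for p
  note P = abs_summable_prod[OF abs[OF assms, of \<xi>] abs[OF assms, of "\<xi> + 1/2"]]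
  have hs: "h summable_on UNIV" and hsum: "(h has_sum of_real (ell \<gamma> \<xi> * ell \<gamma> (\<xi> + 1/2))) UNIV"
    using P abs_summable_summable[of h UNIV]
    by (simp_all add: case_prod_beta' h_def[abs_def] ell_infsum[OF assms])
  define E where "E = {p :: int \<times> int. even (fst p + snd p)}"
  define Od where "Od = {p :: int \<times> int. odd (fst p + snd p)}"
  have hE: "h summable_on E" and hO: "h summable_on Od"
    using hs by (auto intro: summable_on_subset_banach)
  \<comment> \<open>For odd index sum the two characters take opposite values at 1/2, so exchanging
    the entries changes the sign of the term.\<close>
  have swap: "h (prod.swap p) = - h p" if "p \<in> Od" for p
  proof -
    have o: "fchar (fst p + snd p) (1/2) = -1" using that by (intro fchar_half_odd) (simp add: Od_def)
    have i: "fchar (snd p) (1/2) * fchar (snd p) (1/2) = 1" by (simp only: fchar_half_sq flip: fchar_add)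
    have "fchar (fst p) (1/2) = fchar (fst p) (1/2) * (fchar (snd p) (1/2) * fchar (snd p) (1/2))" by (simp only: i mult_1_right)
    also have "\<dots> = - fchar (snd p) (1/2)" using o unfolding fchar_add by (simp only: mult.assoc[symmetric]) simp
    finally show ?thesis by (simp add: h_def fchar_plus mult_ac)
  qed
  have "(\<Sum>\<^sub>\<infinity>p\<in>Od. h p) = (\<Sum>\<^sub>\<infinity>p\<in>prod.swap ` Od. h p)"
    by (rule arg_cong[of _ _ "infsum h"]) (force simp: Od_def image_iff add.commute)
  also have "\<dots> = (\<Sum>\<^sub>\<infinity>p\<in>Od. h (prod.swap p))"
    by (subst infsum_reindex) (auto simp: o_def)
  also have "\<dots> = (\<Sum>\<^sub>\<infinity>p\<in>Od. - h p)" by (rule infsum_cong) (rule swap)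
  also have "\<dots> = - (\<Sum>\<^sub>\<infinity>p\<in>Od. h p)" by (rule infsum_uminus)
  finally have O0: "(\<Sum>\<^sub>\<infinity>p\<in>Od. h p) = 0" by simp
  \<comment> \<open>Sum and difference coordinates; on \<open>E\<close> both entries have equal
    parity, so the halving in the inverse map is exact.\<close>
  let ?r = "\<lambda>p :: int \<times> int. (fst p + snd p, fst p - snd p)"
  have bij: "bij_betw ?r UNIV E"
  proof (rule bij_betwI[where g = "\<lambda>p. ((fst p + snd p) div 2, (fst p - snd p) div 2)"])
    show "?r \<in> UNIV \<rightarrow> E" by (auto simp: E_def)
    show "?r ((fst y + snd y) div 2, (fst y - snd y) div 2) = y" if "y \<in> E" for y
    proof -
      obtain a b where y: "y = (a, b)" by fastforce
      have e: "even (a + b)" using that y by (simp add: E_def)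
      then have "even (a - b)" by simp
      with e obtain k l where kl: "a + b = 2 * k" "a - b = 2 * l" by (elim evenE) blast
      then have "a = k + l" "b = k - l" by auto
      then show ?thesis by (simp add: y)
    qed
  qed auto
  define h' where "h' p = (of_real (gw ?\<gamma>' (fst p)) * fchar (fst p) (2 * \<xi> + 1/2)) * (of_real (gw ?\<gamma>' (snd p)) * fchar (snd p) (1/2))" for p
  have hr: "h (?r p) = h' p" for p
  proof -
    obtain S D where p: "p = (S, D)" by fastforce
    \<comment> \<open>(S + D)^2 + (S - D)^2 = 2 (S^2 + D^2): the doubling is absorbed by passing
      from \<gamma> to \<gamma> / sqrt 2.\<close>
    have 1: "gw \<gamma> (S + D) * gw \<gamma> (S - D) = gw ?\<gamma>' S * gw ?\<gamma>' D"
      unfolding gw_def exp_add[symmetric] using assms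
      by (intro arg_cong[of _ _ exp]) (simp add: field_simps power2_eq_square)
    have "fchar (S + D) \<xi> * fchar (S - D) (\<xi> + 1/2) = fchar ((S + D) + (S - D)) \<xi> * fchar (S - D) (1/2)"
      unfolding fchar_plus fchar_add[of "S + D" "S - D"] by (simp only: mult.assoc)
    also have "fchar ((S + D) + (S - D)) \<xi> = fchar S (2 * \<xi>)"
    proof -
      have "S + D + (S - D) = 2 * S" by simp
      then show ?thesis by (simp only: fchar_double)
    qed
    also have "fchar (S - D) (1/2) = fchar S (1/2) * fchar D (1/2)"
    proof -
      have "S - D + (D + D) = S + D" by simp
      then have "fchar (S + D) (1/2) = fchar (S - D) (1/2)"
        using fchar_add[of "S - D" "D + D" "1/2"] by (simp only: fchar_half_sq mult_1_right)
      then show ?thesis by (simp only: fchar_add)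
    qed
    finally have 2: "fchar (S + D) \<xi> * fchar (S - D) (\<xi> + 1/2) = fchar S (2 * \<xi> + 1/2) * fchar D (1/2)"
      by (simp only: fchar_plus mult.assoc)
    have "h (?r p) = of_real (gw \<gamma> (S + D) * gw \<gamma> (S - D)) * (fchar (S + D) \<xi> * fchar (S - D) (\<xi> + 1/2))"
      unfolding h_def p fst_conv snd_conv of_real_mult by (simp only: mult_ac)
    also have "\<dots> = h' p" unfolding 1 2 h'_def p fst_conv snd_conv of_real_mult by (simp only: mult_ac)
    finally show ?thesis .
  qed
  have "(h' has_sum of_real (ell ?\<gamma>' (2 * \<xi> + 1/2) * ell ?\<gamma>' (1/2))) UNIV"
    using abs_summable_prod(2)[OF abs[OF g', of "2 * \<xi> + 1/2"] abs[OF g', of "1/2"]]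
    by (simp add: case_prod_beta' h'_def[abs_def] ell_infsum[OF g'])
  then have "(h has_sum of_real (ell ?\<gamma>' (2 * \<xi> + 1/2) * ell ?\<gamma>' (1/2))) E"
    unfolding has_sum_reindex_bij_betw[OF bij, of h, symmetric] hr .
  then have "(h has_sum (of_real (ell ?\<gamma>' (2 * \<xi> + 1/2) * ell ?\<gamma>' (1/2)) + 0)) (E \<union> Od)"
    using has_sum_infsum[OF hO] unfolding O0 by (rule has_sum_Un_disjoint) (auto simp: E_def Od_def)
  moreover have "E \<union> Od = UNIV" by (auto simp: E_def Od_def)
  ultimately have "complex_of_real (ell \<gamma> \<xi> * ell \<gamma> (\<xi> + 1/2)) = of_real (ell ?\<gamma>' (2 * \<xi> + 1/2) * ell ?\<gamma>' (1/2))"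
    using has_sum_unique[OF hsum] by simp
  then show ?thesis by (simp only: of_real_eq_iff)
qed

text \<open>By the duplication formula a real zero for \<open>\<gamma>\<close> yields one for \<open>\<gamma> / sqrt 2\<close>, hence for arbitrarily
  small parameters, where the constant term of the series dominates.\<close>

lemma ell_neq_0:
  assumes "\<gamma> \<noteq> 0"
  shows "ell \<gamma> \<xi> \<noteq> 0"
proof
  assume z: "ell \<gamma> \<xi> = 0"
  have "\<exists>\<eta>. ell (\<gamma> / sqrt 2 ^ n) \<eta> = 0" for n
  proof (induction n)
    case 0
    then show ?case using z by auto
  next
    case (Suc n)
    then obtain \<eta> where "ell (\<gamma> / sqrt 2 ^ n) \<eta> = 0" by blast
    \<comment> \<open>The product on the right of the duplication formula vanishes, so one of its
      factors does; either one gives a real zero for the next parameter.\<close>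
    then show ?case
      using ell_duplication[of "\<gamma> / sqrt 2 ^ n" \<eta>] assms by (auto simp: mult.commute)
  qed
  \<comment> \<open>\<open>n\<close> is chosen so that pi^2 2^n / \<gamma>^2 exceeds 3, the
    threshold of \<open>ell_near_1\<close>.\<close>
  moreover obtain n where n: "3 * \<gamma>\<^sup>2 / pi\<^sup>2 < 2 ^ n"
    using real_arch_pow[of 2 "3 * \<gamma>\<^sup>2 / pi\<^sup>2"] by auto
  ultimately obtain \<eta> where \<eta>: "ell (\<gamma> / sqrt 2 ^ n) \<eta> = 0" by blast
  have "(sqrt 2 ^ n)\<^sup>2 = (2::real) ^ n" by (simp add: power2_eq_square flip: power_mult_distrib)
  then have "pi\<^sup>2 / (\<gamma> / sqrt 2 ^ n)\<^sup>2 \<ge> 3"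
    using n assms by (simp add: power_divide field_simps)
  from ell_near_1[OF _ this, of \<eta>] \<eta> assms show False by simp
qed

section \<open>Eigenvalues and diagonalization of \<open>A_rect\<close>\<close>

lemma C_M_pos: "C_M \<gamma> > 0"
  by (simp add: C_M_def)

lemma b_rect_pos:
  assumes "\<gamma> \<noteq> 0"
  shows "b_rect \<gamma> \<xi> > 0"
  using C_M_pos[of \<gamma>] ell_neq_0[OF assms] by (simp add: b_rect_def)

lemma b_minus_a: "b_rect \<gamma> \<xi> - a_rect \<gamma> \<xi> = C_M \<gamma> * (ell \<gamma> 0 - ell \<gamma> \<xi>)\<^sup>2"
  by (simp add: a_rect_def b_rect_def power2_eq_square algebra_simps)

lemma a_less_b:
  assumes "\<gamma> \<noteq> 0" "\<xi> \<notin> \<int>"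
  shows "a_rect \<gamma> \<xi> < b_rect \<gamma> \<xi>"
proof -
  have "0 < (ell \<gamma> 0 - ell \<gamma> \<xi>)\<^sup>2" using ell_less_ell_0[OF assms] by simp
  with C_M_pos[of \<gamma>] have "0 < b_rect \<gamma> \<xi> - a_rect \<gamma> \<xi>" unfolding b_minus_a by (rule mult_pos_pos)
  then show ?thesis by simp
qed

lemma mu_alt: "mu \<gamma> \<xi> = csqrt (of_real ((a_rect \<gamma> \<xi>)\<^sup>2 - (b_rect \<gamma> \<xi>)\<^sup>2))"
  by (simp add: mu_def A_rect_def det_2 power2_eq_square)

lemma mu_sq: "(mu \<gamma> \<xi>)\<^sup>2 = of_real ((a_rect \<gamma> \<xi>)\<^sup>2 - (b_rect \<gamma> \<xi>)\<^sup>2)"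
  unfolding mu_alt by (rule power2_csqrt)

lemma mu_imaginary:
  assumes "\<gamma> \<noteq> 0" "\<xi> \<notin> \<int>" "a_rect \<gamma> \<xi> + b_rect \<gamma> \<xi> > 0"
  shows "mu \<gamma> \<xi> \<in> range (\<lambda>y. \<i> * of_real y) - {0}"
proof -
  let ?d = "(a_rect \<gamma> \<xi>)\<^sup>2 - (b_rect \<gamma> \<xi>)\<^sup>2"
  have "?d = (a_rect \<gamma> \<xi> - b_rect \<gamma> \<xi>) * (a_rect \<gamma> \<xi> + b_rect \<gamma> \<xi>)"
    by (simp add: power2_eq_square algebra_simps)
  also have "\<dots> < 0" using a_less_b[OF assms(1,2)] assms(3) by (intro mult_neg_pos) auto
  finally have d: "?d < 0" .
  then have "mu \<gamma> \<xi> = \<i> * of_real (sqrt (- ?d))"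
    unfolding mu_alt by (subst csqrt_of_real_nonpos) auto
  moreover have "sqrt (- ?d) \<noteq> 0" using d by simp
  ultimately show ?thesis by auto
qed

text \<open>A completed square again: a + b is positive as soon as ell(\<xi>) exceeds (sqrt 2 - 1)
  ell(0), which holds near 0 by continuity and everywhere on the square lattice.\<close>

lemma a_plus_b: "a_rect \<gamma> \<xi> + b_rect \<gamma> \<xi> = C_M \<gamma> * ((ell \<gamma> \<xi> + ell \<gamma> 0)\<^sup>2 - 2 * (ell \<gamma> 0)\<^sup>2)"
  by (simp add: a_rect_def b_rect_def power2_eq_square algebra_simps)

lemma a_plus_b_near_0:
  assumes "\<gamma> \<noteq> 0"
  shows "\<forall>\<^sub>F \<xi> in at 0. a_rect \<gamma> \<xi> + b_rect \<gamma> \<xi> > 0"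
proof -
  have "isCont (ell \<gamma>) 0"
    using continuous_on_ell[OF assms, of UNIV] continuous_on_eq_continuous_at by blast
  then have "((\<lambda>\<xi>. a_rect \<gamma> \<xi> + b_rect \<gamma> \<xi>) \<longlongrightarrow> a_rect \<gamma> 0 + b_rect \<gamma> 0) (at 0)"
    unfolding a_rect_def b_rect_def by (intro tendsto_intros) (simp_all add: isCont_def)
  moreover have "a_rect \<gamma> 0 + b_rect \<gamma> 0 > 0"
    using ell_0_ge_1[OF assms] C_M_pos[of \<gamma>]
    unfolding a_plus_b by (intro mult_pos_pos) (simp_all add: power2_eq_square)
  ultimately show ?thesis by (rule order_tendstoD(1))
qed

lemma not_Ints_near_0: "\<forall>\<^sub>F \<xi> :: real in at 0. \<xi> \<notin> \<int>"
  unfolding eventually_at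
proof (intro exI[of _ 1] conjI ballI impI)
  fix \<xi> :: real assume "\<xi> \<noteq> 0 \<and> dist \<xi> 0 < 1"
  then show "\<xi> \<notin> \<int>" by (auto elim!: Ints_cases)
qed simp

lemma mu_near_0:
  assumes "\<gamma> \<noteq> 0"
  shows "\<forall>\<^sub>F \<xi> in at 0. mu \<gamma> \<xi> \<in> range (\<lambda>y. \<i> * of_real y) - {0}"
  using a_plus_b_near_0[OF assms] not_Ints_near_0
  by eventually_elim (rule mu_imaginary[OF assms])

lemma mu_square_lattice:
  assumes "\<gamma> \<noteq> 0" "\<gamma>\<^sup>2 = pi" "\<xi> \<notin> \<int>"
  shows "mu \<gamma> \<xi> \<in> range (\<lambda>y. \<i> * of_real y) - {0}"
proof (rule mu_imaginary[OF assms(1,3)])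
  have "pi\<^sup>2 / \<gamma>\<^sup>2 \<ge> 3" unfolding assms(2) using pi_gt3 by (simp add: power2_eq_square)
  from ell_near_1[OF assms(1) this, of \<xi>] ell_near_1[OF assms(1) this, of 0]
  \<comment> \<open>\<open>ell_near_1\<close> gives ell(\<xi>) \<ge> 5/7 and ell(0) \<le> 9/7, so
    their ratio is at least 5/9. What counts below is (14/9)^2 = 196/81 > 2.\<close>
  have l: "14 / 9 * ell \<gamma> 0 \<le> ell \<gamma> \<xi> + ell \<gamma> 0" by linarith
  have e: "ell \<gamma> 0 \<ge> 1" by (rule ell_0_ge_1[OF assms(1)])
  have "2 * (ell \<gamma> 0)\<^sup>2 < (14 / 9 * ell \<gamma> 0)\<^sup>2" using e by (simp add: power_mult_distrib power2_eq_square)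
  also have "\<dots> \<le> (ell \<gamma> \<xi> + ell \<gamma> 0)\<^sup>2" using l e by (intro power_mono) auto
  finally show "a_rect \<gamma> \<xi> + b_rect \<gamma> \<xi> > 0"
    unfolding a_plus_b using C_M_pos[of \<gamma>] by simp
qed

text \<open>det P = -2 b \<mu> with \<mu>^2 = (a - b)(a + b): b is positive, a < b off the integers,
  and the remaining factor is assumed nonzero. The columns of P are eigenvectors for \<mu> and
  -\<mu>, since A P = P D follows from \<mu>^2 = a^2 - b^2 alone.\<close>

lemma A_rect_diagonalization:
  assumes "\<gamma> \<noteq> 0" "\<xi> \<notin> \<int>" "a_rect \<gamma> \<xi> + b_rect \<gamma> \<xi> \<noteq> 0"
  shows "invertible (P_rect \<gamma> \<xi>)"
    and "A_rect \<gamma> \<xi> = P_rect \<gamma> \<xi> ** D_rect \<gamma> \<xi> ** matrix_inv (P_rect \<gamma> \<xi>)"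
proof -
  have "(a_rect \<gamma> \<xi>)\<^sup>2 - (b_rect \<gamma> \<xi>)\<^sup>2 = (a_rect \<gamma> \<xi> - b_rect \<gamma> \<xi>) * (a_rect \<gamma> \<xi> + b_rect \<gamma> \<xi>)"
    by (simp add: power2_eq_square algebra_simps)
  also have "\<dots> \<noteq> 0" using a_less_b[OF assms(1,2)] assms(3) by simp
  finally have "(mu \<gamma> \<xi>)\<^sup>2 \<noteq> 0" unfolding mu_sq by (simp only: of_real_eq_0_iff not_False_eq_True)
  then have mu0: "mu \<gamma> \<xi> \<noteq> 0" by simp
  have "det (P_rect \<gamma> \<xi>) = - 2 * of_real (b_rect \<gamma> \<xi>) * mu \<gamma> \<xi>"
    by (simp add: P_rect_def det_2 algebra_simps)
  then have "det (P_rect \<gamma> \<xi>) \<noteq> 0"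
    using mu0 b_rect_pos[OF assms(1), of \<xi>] by simp
  then show inv: "invertible (P_rect \<gamma> \<xi>)" by (simp add: invertible_det_nz)
  have m: "mu \<gamma> \<xi> * mu \<gamma> \<xi> = of_real (a_rect \<gamma> \<xi>) * of_real (a_rect \<gamma> \<xi>) - of_real (b_rect \<gamma> \<xi>) * of_real (b_rect \<gamma> \<xi>)"
    using mu_sq[of \<gamma> \<xi>] by (simp add: power2_eq_square)
  have "A_rect \<gamma> \<xi> ** P_rect \<gamma> \<xi> = P_rect \<gamma> \<xi> ** D_rect \<gamma> \<xi>"
    unfolding A_rect_def P_rect_def D_rect_def vec_eq_iff forall_2 matrix_matrix_mult_def
    by (simp add: sum_2 algebra_simps m)
  then have "P_rect \<gamma> \<xi> ** D_rect \<gamma> \<xi> ** matrix_inv (P_rect \<gamma> \<xi>) = A_rect \<gamma> \<xi> ** (P_rect \<gamma> \<xi> ** matrix_inv (P_rect \<gamma> \<xi>))"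
    by (simp only: matrix_mul_assoc)
  then show "A_rect \<gamma> \<xi> = P_rect \<gamma> \<xi> ** D_rect \<gamma> \<xi> ** matrix_inv (P_rect \<gamma> \<xi>)"
    using someI_ex[OF inv[unfolded invertible_def]] by (simp add: matrix_inv_def)
qed

section \<open>Fourier coefficients along horizontal lines\<close>

lemma borel_measurable_Complex: "(\<lambda>p. Complex (fst p) (snd p)) \<in> borel_measurable (lborel \<Otimes>\<^sub>M lborel)"
proof -
  have "(\<lambda>p :: real \<times> real. Complex (fst p) (snd p)) \<in> borel_measurable borel"
    unfolding Complex_eq by (intro borel_measurable_continuous_onI continuous_intros)
  then show ?thesis by (simp add: lborel_prod)
qed

lemma distr_Complex: "distr (lborel \<Otimes>\<^sub>M lborel) borel (\<lambda>p. Complex (fst p) (snd p)) = lborel"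
proof (rule lborel_eqI[symmetric])
  fix l u :: complex
  assume l: "\<And>b. b \<in> Basis \<Longrightarrow> l \<bullet> b \<le> u \<bullet> b"
  have le: "Re l \<le> Re u" "Im l \<le> Im u"
    using l[of 1] l[of \<i>] by (simp_all add: Basis_complex_def)
  have "(\<lambda>p. Complex (fst p) (snd p)) -` box l u \<inter> space (lborel \<Otimes>\<^sub>M lborel) = {Re l<..<Re u} \<times> {Im l<..<Im u}"
    by (auto simp: space_pair_measure in_box_complex_iff)
  then have "emeasure (distr (lborel \<Otimes>\<^sub>M lborel) borel (\<lambda>p. Complex (fst p) (snd p))) (box l u) =
      emeasure lborel {Re l<..<Re u} * emeasure lborel {Im l<..<Im u}"
    by (subst emeasure_distr[OF borel_measurable_Complex])
       (simp_all add: lborel.emeasure_pair_measure_Times)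
  also have "\<dots> = (\<Prod>b\<in>Basis. (u - l) \<bullet> b)"
    using le by (simp add: Basis_complex_def ennreal_mult'' )
  finally show "emeasure (distr (lborel \<Otimes>\<^sub>M lborel) borel (\<lambda>p. Complex (fst p) (snd p))) (box l u) =
      (\<Prod>b\<in>Basis. (u - l) \<bullet> b)" .
qed simp

lemma integrable_lborel_complex:
  fixes f :: "complex \<Rightarrow> 'b::{banach,second_countable_topology}"
  assumes "f \<in> borel_measurable borel"
  shows "integrable lborel f \<longleftrightarrow> integrable (lborel \<Otimes>\<^sub>M lborel) (\<lambda>(x,y). f (Complex x y))"
  using integrable_distr_eq[OF borel_measurable_Complex, of f] assms
  by (simp add: distr_Complex case_prod_beta')

lemma integral_lborel_complex:
  fixes f :: "complex \<Rightarrow> 'b::{banach,second_countable_topology}"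
  assumes "f \<in> borel_measurable borel"
  shows "(LINT z|lborel. f z) = (LINT p|(lborel \<Otimes>\<^sub>M lborel). (case p of (x,y) \<Rightarrow> f (Complex x y)))"
  using integral_distr[OF borel_measurable_Complex, of f] assms
  by (simp add: distr_Complex case_prod_beta')

lemma integral_lborel_complex_iterated:
  fixes f :: "complex \<Rightarrow> 'b::{banach,second_countable_topology}"
  assumes "f \<in> borel_measurable borel" "integrable lborel f"
  shows "(LINT z|lborel. f z) = (LINT y|lborel. (LINT x|lborel. f (Complex x y)))"
  using lborel_pair.integral_snd[of "\<lambda>x y. f (Complex x y)"] assms(2)
  by (simp add: integrable_lborel_complex[OF assms(1)] integral_lborel_complex[OF assms(1)])

lemma integrable_pair_mult:
  fixes g h :: "real \<Rightarrow> real"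
  assumes g: "integrable lborel g" and h: "integrable lborel h"
  shows "integrable (lborel \<Otimes>\<^sub>M lborel) (\<lambda>(x,y). g x * h y)"
proof (rule lborel_pair.Fubini_integrable)
  have [measurable]: "g \<in> borel_measurable borel" "h \<in> borel_measurable borel"
    using g h borel_measurable_integrable by fastforce+
  show "(\<lambda>(x,y). g x * h y) \<in> borel_measurable (lborel \<Otimes>\<^sub>M lborel)" by measurable
  show "integrable lborel (\<lambda>x. LINT y|lborel. norm (case (x, y) of (x, y) \<Rightarrow> g x * h y))"
    using g by (simp add: abs_mult)
  show "AE x in lborel. integrable lborel (\<lambda>y. case (x, y) of (x, y) \<Rightarrow> g x * h y)"
    using h by simp
qed

lemma gaussian_integral:
  fixes a c :: real
  assumes "a > 0"
  shows "integrable lborel (\<lambda>y. exp (- (a * (y + c)\<^sup>2)))"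
    and "(LINT y|lborel. exp (- (a * (y + c)\<^sup>2))) = sqrt (pi / a)"
proof -
  \<comment> \<open>The standard deviation of the normal density proportional to the
    integrand.\<close>
  define \<sigma> where "\<sigma> = sqrt (1 / (2 * a))"
  have s: "\<sigma> > 0" "\<sigma>\<^sup>2 = 1 / (2 * a)" using assms by (simp_all add: \<sigma>_def)
  have eq: "exp (- (a * (y + c)\<^sup>2)) = sqrt (pi / a) * normal_density (- c) \<sigma> y" for y
    using assms by (simp add: normal_density_def s(2) mult.commute)
  show "integrable lborel (\<lambda>y. exp (- (a * (y + c)\<^sup>2)))" unfolding eq using s by simp
  show "(LINT y|lborel. exp (- (a * (y + c)\<^sup>2))) = sqrt (pi / a)" unfolding eq using s by simp
qed

lemma strip_borel: "strip \<gamma> \<in> sets borel"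
  unfolding strip_def by measurable

text \<open>For Borel functions the completed measure on the strip is traded for
  \<open>lborel\<close>, where Fubini's theorem applies in the product form above.\<close>

lemma strip_restrict:
  fixes f :: "complex \<Rightarrow> 'b::{banach,second_countable_topology}"
  assumes "f \<in> borel_measurable borel"
  shows "integrable (lebesgue_on (strip \<gamma>)) f \<longleftrightarrow> integrable lborel (\<lambda>z. indicator (strip \<gamma>) z *\<^sub>R f z)"
    and "(LINT z|lebesgue_on (strip \<gamma>). f z) = (LINT z|lborel. indicator (strip \<gamma>) z *\<^sub>R f z)"
proof -
  have [measurable]: "f \<in> borel_measurable borel" "strip \<gamma> \<in> sets borel"
    using assms strip_borel by auto
  have m: "(\<lambda>z. indicator (strip \<gamma>) z *\<^sub>R f z) \<in> borel_measurable lborel" by measurable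
  have s: "strip \<gamma> \<inter> space lebesgue \<in> sets lebesgue" using strip_borel by simp
  show "integrable (lebesgue_on (strip \<gamma>)) f \<longleftrightarrow> integrable lborel (\<lambda>z. indicator (strip \<gamma>) z *\<^sub>R f z)"
    unfolding integrable_restrict_space[OF s] integrable_completion[OF m] ..
  show "(LINT z|lebesgue_on (strip \<gamma>). f z) = (LINT z|lborel. indicator (strip \<gamma>) z *\<^sub>R f z)"
    unfolding integral_restrict_space[OF s] integral_completion[OF m] ..
qed

lemma continuous_borel: "continuous_on UNIV f \<Longrightarrow> f \<in> borel_measurable borel"
  by (rule borel_measurable_continuous_onI)

lemma measurable_strip_continuous:
  "continuous_on UNIV (f :: complex \<Rightarrow> 'b::euclidean_space) \<Longrightarrow> f \<in> borel_measurable (lebesgue_on (strip \<gamma>))"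
  by (rule continuous_imp_measurable_on_sets_lebesgue) (use strip_borel in \<open>auto intro: continuous_on_subset\<close>)

text \<open>If Q is a primitive of K, then Q(z + \<gamma>) - Q(z) has derivative 0 by periodicity,
  hence is a constant d. Every mean over a horizontal period equals d / \<gamma>, at any height and
  from any starting point: Cauchy's theorem on a rectangle in disguise.\<close>

lemma periodic_line_integral:
  assumes hol: "K holomorphic_on UNIV" and \<gamma>: "\<gamma> > 0" and per: "\<And>z. K (z + of_real \<gamma>) = K z"
  shows "\<exists>k. \<forall>a y. ((\<lambda>x. K (Complex (\<gamma> * x) y)) has_integral k) {a..a+1}"
proof -
  obtain Q where Q: "\<And>z. (Q has_field_derivative K z) (at z)"
    using holomorphic_convex_primitive'[of UNIV K] hol by auto
  have "((\<lambda>z. Q (z + of_real \<gamma>) - Q z) has_field_derivative 0) (at z)" for z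
    using DERIV_diff[OF DERIV_shift[THEN iffD1, OF Q[of "z + of_real \<gamma>"]] Q[of z]] by (simp add: per)
  then obtain d where d: "\<And>z. Q (z + of_real \<gamma>) - Q z = d"
    using has_field_derivative_zero_constant[of UNIV "\<lambda>z. Q (z + of_real \<gamma>) - Q z"] by auto
  have "((\<lambda>x. K (Complex (\<gamma> * x) y)) has_integral d / of_real \<gamma>) {a..a+1}" for a y
  proof -
    have "((\<lambda>x. K (Complex (\<gamma> * x) y)) has_integral
       Q (Complex (\<gamma> * (a + 1)) y) / of_real \<gamma> - Q (Complex (\<gamma> * a) y) / of_real \<gamma>) {a..a+1}"
    proof (rule fundamental_theorem_of_calculus)
      fix x :: real
      have e: "Complex (\<gamma> * t) y = of_real \<gamma> * of_real t + \<i> * of_real y" for t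
        by (simp add: complex_eq_iff)
      have "((\<lambda>z. Q (of_real \<gamma> * z + \<i> * of_real y) / of_real \<gamma>) has_field_derivative K (of_real \<gamma> * of_real x + \<i> * of_real y)) (at (of_real x))"
      proof -
        have "((\<lambda>z. of_real \<gamma> * z + \<i> * of_real y) has_field_derivative of_real \<gamma>) (at (of_real x))"
          by (auto intro!: derivative_eq_intros)
        from DERIV_cdivide[OF DERIV_chain2[OF Q this], of "of_real \<gamma>"] show ?thesis
          using \<gamma> by simp
      qed
      from has_vector_derivative_real_field[OF this]
      show "((\<lambda>x. Q (Complex (\<gamma> * x) y) / of_real \<gamma>) has_vector_derivative K (Complex (\<gamma> * x) y)) (at x within {a..a+1})"
        by (simp add: e o_def)
    qed simp
    moreover have "Complex (\<gamma> * (a + 1)) y = Complex (\<gamma> * a) y + of_real \<gamma>"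
      by (simp add: complex_eq_iff algebra_simps)
    ultimately show ?thesis using d[of "Complex (\<gamma> * a) y"] by (simp flip: diff_divide_distrib)
  qed
  then show ?thesis by blast
qed

definition Npsi :: "real \<Rightarrow> real" where
  "Npsi \<gamma> = (2 / (pi * \<gamma>\<^sup>2)) powr (1/4)"

section \<open>The basis functions and restriction to horizontal lines\<close>

locale rectangular_lattice =
  fixes \<gamma> :: real
  assumes gamma_pos: "\<gamma> > 0"
begin

lemma gamma_neq_0 [simp]: "\<gamma> \<noteq> 0"
  using gamma_pos by simp

definition \<beta> :: real where "\<beta> = pi / \<gamma>"

lemma beta_pos: "\<beta> > 0"
  using gamma_pos by (simp add: \<beta>_def)

abbreviation N :: real where "N \<equiv> Npsi \<gamma>"

lemma N_pos: "N > 0"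
  using gamma_pos by (simp add: Npsi_def)

lemma N_sq: "N\<^sup>2 = sqrt (2 / pi) / \<gamma>"
proof -
  have "N\<^sup>2 = (2 / (pi * \<gamma>\<^sup>2)) powr (1/2)"
    by (simp add: Npsi_def power2_eq_square flip: powr_add)
  also have "\<dots> = sqrt (2 / (pi * \<gamma>\<^sup>2))" using gamma_pos by (simp add: powr_half_sqrt)
  also have "\<dots> = sqrt (2 / pi) / \<gamma>" using gamma_pos by (simp add: real_sqrt_divide real_sqrt_mult)
  finally show ?thesis .
qed

lemma gw_beta: "gw \<gamma> n = exp (- (\<beta> * of_int n)\<^sup>2)"
  by (simp add: gw_def \<beta>_def power_mult_distrib power_divide)

definition amp :: "int \<Rightarrow> real \<Rightarrow> real" where
  "amp n y = N * exp (- (y + \<beta> * of_int n)\<^sup>2)"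

lemma amp_pos: "amp n y > 0"
  using N_pos by (simp add: amp_def)

text \<open>The modulus depends on the height alone and is a Gaussian centred at -\<beta> n; on each
  horizontal line the phase is the n-th exponential times a factor common to all n.\<close>

lemma psi_polar: "psi \<gamma> n z = of_real (amp n (Im z)) * cis (2 * \<beta> * of_int n * Re z + Re z * Im z)"
proof -
  have "- of_real (pi\<^sup>2 * (of_int n)\<^sup>2 / \<gamma>\<^sup>2) + 2 * \<i> * of_int n * of_real (pi / \<gamma>) * z
          + z\<^sup>2 / 2 - of_real ((cmod z)\<^sup>2 / 2) =
      of_real (- (Im z + \<beta> * of_int n)\<^sup>2) + \<i> * of_real (2 * \<beta> * of_int n * Re z + Re z * Im z)"
  proof (rule complex_eqI)
    have 1: "Re (z\<^sup>2 / 2) = ((Re z)\<^sup>2 - (Im z)\<^sup>2) / 2" "Im (z\<^sup>2 / 2) = Re z * Im z"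
      by (simp_all add: power2_eq_square)
    have 2: "Re (2 * \<i> * of_int n * of_real (pi / \<gamma>) * z) = - (2 * \<beta> * of_int n * Im z)"
      "Im (2 * \<i> * of_int n * of_real (pi / \<gamma>) * z) = 2 * \<beta> * of_int n * Re z"
      by (simp_all add: \<beta>_def)
    have 3: "pi\<^sup>2 * (of_int n)\<^sup>2 / \<gamma>\<^sup>2 = (\<beta> * of_int n)\<^sup>2"
      by (simp add: \<beta>_def power_mult_distrib power_divide)
    show "Re (- of_real (pi\<^sup>2 * (of_int n)\<^sup>2 / \<gamma>\<^sup>2) + 2 * \<i> * of_int n * of_real (pi / \<gamma>) * z
          + z\<^sup>2 / 2 - of_real ((cmod z)\<^sup>2 / 2)) =
      Re (of_real (- (Im z + \<beta> * of_int n)\<^sup>2) + \<i> * of_real (2 * \<beta> * of_int n * Re z + Re z * Im z))"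
      unfolding plus_complex.sel minus_complex.sel uminus_complex.sel 1 2 3 cmod_power2
      by (simp add: power2_eq_square algebra_simps)
    show "Im (- of_real (pi\<^sup>2 * (of_int n)\<^sup>2 / \<gamma>\<^sup>2) + 2 * \<i> * of_int n * of_real (pi / \<gamma>) * z
          + z\<^sup>2 / 2 - of_real ((cmod z)\<^sup>2 / 2)) =
      Im (of_real (- (Im z + \<beta> * of_int n)\<^sup>2) + \<i> * of_real (2 * \<beta> * of_int n * Re z + Re z * Im z))"
      unfolding plus_complex.sel minus_complex.sel uminus_complex.sel 1 2
      by simp
  qed
  then have "psi \<gamma> n z = of_real N * exp (of_real (- (Im z + \<beta> * of_int n)\<^sup>2) + \<i> * of_real (2 * \<beta> * of_int n * Re z + Re z * Im z))"
    by (simp only: psi_def Npsi_def)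
  then show ?thesis
    unfolding exp_add exp_of_real cis_conv_exp[symmetric] amp_def by simp
qed

lemma norm_psi: "norm (psi \<gamma> n z) = amp n (Im z)"
  using amp_pos[of n "Im z"] by (simp add: psi_polar norm_mult)

lemma psi_Complex: "psi \<gamma> n (Complex (\<gamma> * x) y) = of_real (amp n y) * fchar (- n) x * cis (\<gamma> * x * y)"
  using gamma_pos by (simp add: psi_polar fchar_cis cis_mult \<beta>_def mult_ac add_ac)

lemma continuous_psi: "continuous_on UNIV (psi \<gamma> n)"
  unfolding psi_polar amp_def by (intro continuous_intros)

text \<open>The second claim is the squared norm of \<open>psi \<gamma> n\<close> on the strip of
  width \<gamma>; it is what the constant \<open>N\<close> is made for.\<close>

lemma amp_sq_integral:
  "integrable lborel (\<lambda>y. (amp n y)\<^sup>2)" "\<gamma> * (LINT y|lborel. (amp n y)\<^sup>2) = 1"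
proof -
  have e: "(amp n y)\<^sup>2 = N\<^sup>2 * exp (- (2 * (y + \<beta> * of_int n)\<^sup>2))" for y
    by (simp add: amp_def power_mult_distrib exp_double[symmetric])
  show "integrable lborel (\<lambda>y. (amp n y)\<^sup>2)" unfolding e
    by (intro integrable_mult_right gaussian_integral) simp
  have "sqrt (2 / pi) * sqrt (pi / 2) = 1" by (simp flip: real_sqrt_mult)
  then show "\<gamma> * (LINT y|lborel. (amp n y)\<^sup>2) = 1" unfolding e
    using gamma_pos by (simp add: gaussian_integral(2) N_sq)
qed

lemma Fspace_entire:
  assumes "u \<in> Fspace \<gamma>"
  obtains F where "F holomorphic_on UNIV" "\<And>z. u z = exp (- (z * cnj z) / 2) * F z"
    "\<And>z. F (z + of_real \<gamma>) * exp (- (z + of_real \<gamma>)\<^sup>2 / 2) = F z * exp (- z\<^sup>2 / 2)"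
proof -
  from assms obtain F where F: "F holomorphic_on UNIV" "\<And>z. u z = of_real (exp (- (cmod z)\<^sup>2 / 2)) * F z"
    and Ru: "R (of_real \<gamma>) u = u" by (auto simp: Fspace_def Etilde_def)
  have u: "u z = exp (- (z * cnj z) / 2) * F z" for z
    unfolding F(2) complex_norm_square[symmetric] by (simp flip: exp_of_real)
  have "F (z + of_real \<gamma>) * exp (- (z + of_real \<gamma>)\<^sup>2 / 2) = F z * exp (- z\<^sup>2 / 2)" for z
  proof -
    have "exp ((of_real \<gamma> * cnj z - of_real \<gamma> * z) / 2) * (exp (- ((z + of_real \<gamma>) * cnj (z + of_real \<gamma>)) / 2) * F (z + of_real \<gamma>)) =
      exp (- (z * cnj z) / 2) * F z"
      using fun_cong[OF Ru, of z] unfolding R_def u by simp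
    then have "exp (z * cnj z / 2 - z\<^sup>2 / 2) * (exp ((of_real \<gamma> * cnj z - of_real \<gamma> * z) / 2) * (exp (- ((z + of_real \<gamma>) * cnj (z + of_real \<gamma>)) / 2) * F (z + of_real \<gamma>))) =
       exp (z * cnj z / 2 - z\<^sup>2 / 2) * (exp (- (z * cnj z) / 2) * F z)"
      by (rule arg_cong)
    then have "exp (z * cnj z / 2 - z\<^sup>2 / 2 + ((of_real \<gamma> * cnj z - of_real \<gamma> * z) / 2 + (- ((z + of_real \<gamma>) * cnj (z + of_real \<gamma>)) / 2))) * F (z + of_real \<gamma>) =
      exp (z * cnj z / 2 - z\<^sup>2 / 2 + (- (z * cnj z) / 2)) * F z"
      by (simp only: exp_add mult.assoc)
    moreover have "z * cnj z / 2 - z\<^sup>2 / 2 + ((of_real \<gamma> * cnj z - of_real \<gamma> * z) / 2 + (- ((z + of_real \<gamma>) * cnj (z + of_real \<gamma>)) / 2)) = - (z + of_real \<gamma>)\<^sup>2 / 2"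
      by (simp add: field_simps power2_eq_square)
    moreover have "z * cnj z / 2 - z\<^sup>2 / 2 + (- (z * cnj z) / 2) = - z\<^sup>2 / 2" by simp
    ultimately show ?thesis by (simp only: mult.commute)
  qed
  then show thesis by (rule that[OF F(1) u])
qed

lemma Fspace_continuous:
  assumes "u \<in> Fspace \<gamma>"
  shows "continuous_on UNIV u"
proof -
  obtain F where F: "F holomorphic_on UNIV" "\<And>z. u z = exp (- (z * cnj z) / 2) * F z"
    by (rule Fspace_entire[OF assms]) (rule that)
  have "u = (\<lambda>z. exp (- (z * cnj z) / 2) * F z)" by (rule ext) (rule F(2))
  moreover have "continuous_on UNIV (\<lambda>z. exp (- (z * cnj z) / 2) * F z)"
    by (intro continuous_intros holomorphic_on_imp_continuous_on[OF F(1)]) simp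
  ultimately show ?thesis by simp
qed

text \<open>Rescaled to period 1. The phase undoes the quasi-periodicity imposed by
  \<open>R\<close>, and it is the same for all basis functions, which become multiples of
  characters.\<close>

definition line :: "(complex \<Rightarrow> complex) \<Rightarrow> real \<Rightarrow> real \<Rightarrow> complex" where
  "line u y x = u (Complex (\<gamma> * x) y) * cis (- (\<gamma> * x * y))"

lemma line_psi: "line (psi \<gamma> n) y x = of_real (amp n y) * fchar (- n) x"
  by (simp add: line_def psi_Complex mult.assoc cis_mult)

lemma line_continuous:
  assumes "u \<in> Fspace \<gamma>"
  shows "continuous_on UNIV (line u y)"
  unfolding line_def Complex_eq
  by (intro continuous_intros continuous_on_compose2[OF Fspace_continuous[OF assms]]) auto

lemma line_periodic:
  assumes "u \<in> Fspace \<gamma>"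
  shows "line u y (x + 1) = line u y x"
proof -
  have "R (of_real \<gamma>) u (Complex (\<gamma> * x) y) = u (Complex (\<gamma> * x) y)"
    using assms by (simp add: Fspace_def)
  moreover have "Complex (\<gamma> * x) y + of_real \<gamma> = Complex (\<gamma> * (x + 1)) y"
    by (simp add: complex_eq_iff algebra_simps)
  moreover have "exp ((of_real \<gamma> * cnj (Complex (\<gamma> * x) y) - cnj (of_real \<gamma>) * Complex (\<gamma> * x) y) / 2) = cis (- (\<gamma> * y))"
    unfolding cis_conv_exp by (rule arg_cong[of _ _ exp]) (simp add: complex_eq_iff algebra_simps)
  ultimately have "cis (- (\<gamma> * y)) * u (Complex (\<gamma> * (x + 1)) y) = u (Complex (\<gamma> * x) y)"
    by (simp add: R_def)
  moreover have "cis (- (\<gamma> * (x + 1) * y)) = cis (- (\<gamma> * y)) * cis (- (\<gamma> * x * y))"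
    by (simp add: cis_mult algebra_simps)
  ultimately show ?thesis by (simp add: line_def mult_ac)
qed

text \<open>The n-th character extends to the entire periodic factor exp(-2 i \<beta> n z), so its
  product with F(z) exp(-z^2/2) has a horizontal mean independent of the height. What depends on y
  is the factor exp(-y^2 - 2 \<beta> n y) split off on the line, and that is \<open>amp n y\<close>
  up to a constant.\<close>

lemma Fspace_coefficients:
  assumes u: "u \<in> Fspace \<gamma>"
  shows "\<exists>\<kappa>. \<forall>n a y. ((\<lambda>x. line u y x * fchar n x) has_integral \<kappa> n * of_real (amp n y)) {a..a+1}"
proof -
  obtain F where F: "F holomorphic_on UNIV" "\<And>z. u z = exp (- (z * cnj z) / 2) * F z"
    and per: "\<And>z. F (z + of_real \<gamma>) * exp (- (z + of_real \<gamma>)\<^sup>2 / 2) = F z * exp (- z\<^sup>2 / 2)"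
    by (rule Fspace_entire[OF assms]) (rule that)
  define K where "K n z = F z * exp (- z\<^sup>2 / 2) * exp (- 2 * \<i> * of_real \<beta> * of_int n * z)" for n :: int and z
  have hol: "K n holomorphic_on UNIV" for n
    unfolding K_def by (intro holomorphic_intros F(1)) auto
  have "K n (z + of_real \<gamma>) = K n z" for n z
  proof -
    have "- 2 * \<i> * of_real \<beta> * of_int n * (z + of_real \<gamma>) = - 2 * \<i> * of_real \<beta> * of_int n * z + \<i> * (of_int (- n) * (of_real pi * 2))"
      using gamma_pos by (simp add: \<beta>_def field_simps)
    then have "exp (- 2 * \<i> * of_real \<beta> * of_int n * (z + of_real \<gamma>)) = exp (- 2 * \<i> * of_real \<beta> * of_int n * z)"
      by (simp only: exp_plus_2pin)
    then show ?thesis unfolding K_def per by simp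
  qed
  then have "\<exists>k. \<forall>a y. ((\<lambda>x. K n (Complex (\<gamma> * x) y)) has_integral k) {a..a+1}" for n
    by (rule periodic_line_integral[OF hol gamma_pos])
  then obtain k where k: "\<And>n a y. ((\<lambda>x. K n (Complex (\<gamma> * x) y)) has_integral k n) {a..a+1}" by metis
  have eq: "line u y x * fchar n x = K n (Complex (\<gamma> * x) y) * of_real (exp (- y\<^sup>2 - 2 * \<beta> * of_int n * y))" for n x y
  proof -
    let ?z = "Complex (\<gamma> * x) y"
    have "line u y x * fchar n x = F ?z * (exp (- (?z * cnj ?z) / 2) * exp (\<i> * of_real (- (\<gamma> * x * y))) * exp (\<i> * of_real (- 2 * pi * of_int n * x)))"
      by (simp add: line_def F(2) fchar_cis cis_conv_exp mult_ac)
    also have "exp (- (?z * cnj ?z) / 2) * exp (\<i> * of_real (- (\<gamma> * x * y))) * exp (\<i> * of_real (- 2 * pi * of_int n * x)) =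
       exp (- ?z\<^sup>2 / 2) * exp (- 2 * \<i> * of_real \<beta> * of_int n * ?z) * exp (of_real (- y\<^sup>2 - 2 * \<beta> * of_int n * y))"
      unfolding exp_add[symmetric] using gamma_pos
      by (intro arg_cong[of _ _ exp]) (simp add: complex_eq_iff power2_eq_square \<beta>_def field_simps)
    finally show ?thesis unfolding exp_of_real K_def by (simp only: mult.assoc)
  qed
  have amp: "exp (- y\<^sup>2 - 2 * \<beta> * of_int n * y) = exp ((\<beta> * of_int n)\<^sup>2) / N * amp n y" for n :: int and y
    using N_pos by (simp add: amp_def field_simps power2_eq_square flip: exp_add)
  have "((\<lambda>x. line u y x * fchar n x) has_integral k n * of_real (exp ((\<beta> * of_int n)\<^sup>2) / N) * of_real (amp n y)) {a..a+1}" for n a y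
    using has_integral_mult_left[OF k[of n y a], of "of_real (exp (- y\<^sup>2 - 2 * \<beta> * of_int n * y))"]
    unfolding eq amp by (simp add: mult.assoc)
  then show ?thesis
    by (intro exI[of _ "\<lambda>n. k n * of_real (exp ((\<beta> * of_int n)\<^sup>2) / N)"]) blast
qed

lemma L2FD:
  assumes "u \<in> L2F \<gamma>"
  shows "square_integrable (lebesgue_on (strip \<gamma>)) u" "u \<in> Fspace \<gamma>"
  using assms by (simp_all add: L2F_def)

text \<open>The height-independent constant is the inner product on the strip: integrating over y
  leaves \<gamma> times the integral of the square of \<open>amp n y\<close>, which is 1. The free
  starting point of the period allows the passage from {0..1} to the rescaled strip
  {-1/2..1/2}.\<close>

lemma L2F_line_coefficient:
  assumes u: "u \<in> L2F \<gamma>" and psq: "square_integrable (lebesgue_on (strip \<gamma>)) (psi \<gamma> n)"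
  shows "ip period (line u y) (fchar (- n)) = ip (lebesgue_on (strip \<gamma>)) u (psi \<gamma> n) * of_real (amp n y)"
proof -
  note uF = L2FD(2)[OF u]
  obtain \<kappa> where \<kappa>: "\<And>n a y. ((\<lambda>x. line u y x * fchar n x) has_integral \<kappa> n * of_real (amp n y)) {a..a+1}"
    using Fspace_coefficients[OF uF] by blast
  have cont: "continuous_on UNIV (\<lambda>x. line u y x * fchar n x)" for y
    by (intro continuous_intros line_continuous[OF uF])
  have "ip period (line u y) (fchar (- n)) = (LINT x|period. line u y x * fchar n x)"
    by (simp add: ip_def cnj_fchar)
  also have "\<dots> = integral {0..1} (\<lambda>x. line u y x * fchar n x)"
    by (rule lebesgue_integral_eq_integral[OF integrable_period_continuous[OF cont]]) simp
  also have "\<dots> = \<kappa> n * of_real (amp n y)"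
    using \<kappa>[of y n 0] by (simp add: integral_unique)
  finally have 1: "ip period (line u y) (fchar (- n)) = \<kappa> n * of_real (amp n y)" .
  define f where "f z = u z * cnj (psi \<gamma> n z)" for z
  have fc: "continuous_on UNIV f"
    unfolding f_def by (intro continuous_intros Fspace_continuous[OF uF] continuous_psi)
  note fb = continuous_borel[OF fc]
  have fi: "integrable (lebesgue_on (strip \<gamma>)) f"
    unfolding f_def by (rule integrable_ip[OF L2FD(1)[OF u] psq])
  have gb: "(\<lambda>z. indicator (strip \<gamma>) z *\<^sub>R f z) \<in> borel_measurable borel"
    using fb strip_borel[of \<gamma>] by measurable
  have gi: "integrable lborel (\<lambda>z. indicator (strip \<gamma>) z *\<^sub>R f z)"
    using fi strip_restrict(1)[OF fb] by simp
  have inner: "(LINT x|lborel. indicator (strip \<gamma>) (Complex x y) *\<^sub>R f (Complex x y)) = \<kappa> n * of_real (\<gamma> * (amp n y)\<^sup>2)" for y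
  proof -
    have "(LINT x|lborel. indicator (strip \<gamma>) (Complex x y) *\<^sub>R f (Complex x y)) =
       \<bar>\<gamma>\<bar> *\<^sub>R (LINT x|lborel. indicator (strip \<gamma>) (Complex (0 + \<gamma> * x) y) *\<^sub>R f (Complex (0 + \<gamma> * x) y))"
      by (rule lborel_integral_real_affine) simp
    also have "(LINT x|lborel. indicator (strip \<gamma>) (Complex (0 + \<gamma> * x) y) *\<^sub>R f (Complex (0 + \<gamma> * x) y)) =
       (LINT x|lborel. of_real (amp n y) * (indicator {-1/2..1/2} x *\<^sub>R (line u y x * fchar n x)))"
    proof (rule integral_cong_AE)
      have fl: "f (Complex (\<gamma> * x) y) = of_real (amp n y) * (line u y x * fchar n x)" for x
        by (simp add: f_def psi_Complex line_def cnj_fchar cis_cnj mult_ac)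
      have st: "Complex (\<gamma> * x) y \<in> strip \<gamma> \<longleftrightarrow> -1/2 < x \<and> x \<le> 1/2" for x
      proof -
        have "- \<gamma> / 2 < \<gamma> * x \<longleftrightarrow> \<gamma> * (- 1/2) < \<gamma> * x" by simp
        also have "\<dots> \<longleftrightarrow> -1/2 < x" using gamma_pos by (rule mult_less_cancel_left_pos)
        finally have 1: "- \<gamma> / 2 < \<gamma> * x \<longleftrightarrow> -1/2 < x" .
        have "\<gamma> * x \<le> \<gamma> / 2 \<longleftrightarrow> \<gamma> * x \<le> \<gamma> * (1/2)" by simp
        also have "\<dots> \<longleftrightarrow> x \<le> 1/2" using gamma_pos by (rule mult_le_cancel_left_pos)
        finally show ?thesis using 1 by (simp add: strip_def)
      qed
      \<comment> \<open>The strip is open on the left, so the endpoint -1/2 is discarded as a null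
        set.\<close>
      show "AE x in lborel. indicator (strip \<gamma>) (Complex (0 + \<gamma> * x) y) *\<^sub>R f (Complex (0 + \<gamma> * x) y) =
          of_real (amp n y) * (indicator {-1/2..1/2} x *\<^sub>R (line u y x * fchar n x))"
        using AE_lborel_singleton[of "-1/2"]
        by eventually_elim (auto simp: fl st indicator_def)
      have "(\<lambda>x. Complex (0 + \<gamma> * x) y) \<in> borel_measurable borel"
        unfolding Complex_eq by (intro borel_measurable_continuous_onI continuous_intros)
      from measurable_compose[OF this gb]
      show "(\<lambda>x. indicator (strip \<gamma>) (Complex (0 + \<gamma> * x) y) *\<^sub>R f (Complex (0 + \<gamma> * x) y)) \<in> borel_measurable lborel"
        by simp
      have [measurable]: "(\<lambda>x. line u y x * fchar n x) \<in> borel_measurable borel"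
        by (rule continuous_borel[OF cont])
      show "(\<lambda>x. of_real (amp n y) * (indicator {-1/2..1/2} x *\<^sub>R (line u y x * fchar n x))) \<in> borel_measurable lborel"
        by measurable
    qed
    also have "\<dots> = of_real (amp n y) * (LINT x|lborel. indicator {-1/2..1/2} x *\<^sub>R (line u y x * fchar n x))"
      by (rule integral_mult_right_zero)
    also have "(LINT x|lborel. indicator {-1/2..1/2} x *\<^sub>R (line u y x * fchar n x)) = integral {-1/2..1/2} (\<lambda>x. line u y x * fchar n x)"
    proof -
      have "continuous_on {-1/2..1/2} (\<lambda>x. line u y x * fchar n x)"
        by (rule continuous_on_subset[OF cont]) simp
      from set_borel_integral_eq_integral(2)[OF borel_integrable_atLeastAtMost'[OF this]] show ?thesis
        by (simp add: set_lebesgue_integral_def)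
    qed
    also have "\<dots> = \<kappa> n * of_real (amp n y)"
      using \<kappa>[of y n "-1/2"] by (simp add: integral_unique)
    finally show ?thesis
      using gamma_pos by (simp add: scaleR_conv_of_real power2_eq_square mult_ac)
  qed
  have "ip (lebesgue_on (strip \<gamma>)) u (psi \<gamma> n) = (LINT z|lborel. indicator (strip \<gamma>) z *\<^sub>R f z)"
    unfolding ip_def f_def[symmetric] by (rule strip_restrict(2)[OF fb])
  also have "\<dots> = (LINT y|lborel. \<kappa> n * of_real (\<gamma> * (amp n y)\<^sup>2))"
    unfolding integral_lborel_complex_iterated[OF gb gi] inner ..
  also have "\<dots> = \<kappa> n * of_real (LINT y|lborel. \<gamma> * (amp n y)\<^sup>2)"
    unfolding integral_complex_of_real[symmetric] by (rule integral_mult_right_zero)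
  finally show ?thesis using 1 amp_sq_integral(2)[of n] by simp
qed

end

section \<open>Expansions in the basis \<open>\<psi>\<^sub>n\<close>\<close>

text \<open>Riesz-Fischer for a series already known to converge pointwise. Fatou's lemma bounds the
  squared norm of \<open>u - s F\<close> by the part of the sum of squares outside \<open>F\<close>;
  the case of empty \<open>F\<close> shows that \<open>u\<close> is square integrable.\<close>

lemma (in orthonormal_family) expansionI_pointwise:
  assumes sm: "(\<lambda>n. (norm (c n))\<^sup>2) summable_on UNIV" and um: "u \<in> borel_measurable M"
    and pw: "\<And>x. ((\<lambda>n. c n * e n x) has_sum u x) UNIV"
  shows "L2_expansion M e c u"
proof -
  \<comment> \<open>Fatou's lemma works along a sequence, whereas the sums run along the net of
    finite sets; these symmetric intervals are cofinal in it.\<close>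
  define A where "A k = {- int k..int k}" for k
  define S where "S = (\<Sum>\<^sub>\<infinity>n\<in>UNIV. (norm (c n))\<^sup>2)"
  define s where "s F x = (\<Sum>n\<in>F. c n * e n x)" for F x
  have sq_s: "square_integrable M (s F)" for F unfolding s_def by (rule square_integrable_comb)
  have em: "e n \<in> borel_measurable M" for n using sq[of n] by (simp add: square_integrable_def)
  have lim: "filterlim A (finite_subsets_at_top UNIV) sequentially"
    unfolding filterlim_finite_subsets_at_top
  proof (intro allI impI, elim conjE)
    fix X :: "int set" assume X: "finite X"
    then obtain K where K: "\<And>n. n \<in> X \<Longrightarrow> nat \<bar>n\<bar> \<le> K"
      using finite_nat_set_iff_bounded_le[of "(\<lambda>n. nat \<bar>n\<bar>) ` X"] by auto
    show "\<forall>\<^sub>F k in sequentially. finite (A k) \<and> X \<subseteq> A k \<and> A k \<subseteq> UNIV"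
      using eventually_ge_at_top[of K]
    proof eventually_elim
      case (elim k)
      have "n \<in> A k" if "n \<in> X" for n using K[OF that] elim by (auto simp: A_def)
      then show ?case by (auto simp: A_def)
    qed
  qed
  have pt: "(\<lambda>k. s (A k) x) \<longlonglongrightarrow> u x" for x
    using pw[of x] filterlim_compose[OF _ lim] unfolding has_sum_def s_def by blast
  have key: "integrable M (\<lambda>x. (norm (u x - s F x))\<^sup>2) \<and> (L2norm M (\<lambda>x. u x - s F x))\<^sup>2 \<le> S - (\<Sum>n\<in>F. (norm (c n))\<^sup>2)"
    if F: "finite F" for F
  proof -
    let ?g = "\<lambda>k x. ennreal ((norm (s (A k) x - s F x))\<^sup>2)"
    let ?T = "S - (\<Sum>n\<in>F. (norm (c n))\<^sup>2)"
    have T0: "?T \<ge> 0"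
      using finite_sum_le_infsum[OF sm F] by (simp add: S_def)
    have bd: "(\<integral>\<^sup>+x. ?g k x \<partial>M) \<le> ennreal ?T" if k: "F \<subseteq> A k" for k
    proof -
      have fin: "finite (A k)" by (simp add: A_def)
      have "s (A k) x - s F x = (\<Sum>n\<in>A k - F. c n * e n x)" for x
        unfolding s_def using k fin by (simp add: sum_diff)
      then have d: "(\<lambda>x. s (A k) x - s F x) = s (A k - F)" by (auto simp: s_def)
      have i: "integrable M (\<lambda>x. (norm (s (A k - F) x))\<^sup>2)"
        using sq_s[of "A k - F"] by (simp add: square_integrable_def)
      have "(\<integral>\<^sup>+x. ?g k x \<partial>M) = (\<integral>\<^sup>+x. ennreal ((norm (s (A k - F) x))\<^sup>2) \<partial>M)"
        using fun_cong[OF d] by simp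
      also have "\<dots> = ennreal (LINT x|M. (norm (s (A k - F) x))\<^sup>2)"
        by (rule nn_integral_eq_integral[OF i]) simp
      also have "(LINT x|M. (norm (s (A k - F) x))\<^sup>2) = (\<Sum>n\<in>A k - F. (norm (c n))\<^sup>2)"
        using L2norm_comb[of "A k - F" c] fin by (simp add: L2norm_sq s_def)
      also have "\<dots> = (\<Sum>n\<in>A k. (norm (c n))\<^sup>2) - (\<Sum>n\<in>F. (norm (c n))\<^sup>2)"
        using k fin by (simp add: sum_diff)
      also have "\<dots> \<le> ?T"
        using finite_sum_le_infsum[OF sm fin] by (simp add: S_def)
      finally show ?thesis by (simp add: ennreal_leI)
    qed
    have sm': "s G \<in> borel_measurable M" for G using sq_s by (simp add: square_integrable_def)
    have "(\<lambda>k. ?g k x) \<longlonglongrightarrow> ennreal ((norm (u x - s F x))\<^sup>2)" for x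
      by (rule tendsto_ennrealI[OF tendsto_power[OF tendsto_norm[OF tendsto_diff[OF pt tendsto_const]]]])
    then have li: "liminf (\<lambda>k. ?g k x) = ennreal ((norm (u x - s F x))\<^sup>2)" for x
      by (rule lim_imp_Liminf[OF trivial_limit_sequentially])
    have gm: "?g k \<in> borel_measurable M" for k
    proof -
      have [measurable]: "s (A k) \<in> borel_measurable M" "s F \<in> borel_measurable M" by (rule sm')+
      show ?thesis by measurable
    qed
    have "(\<integral>\<^sup>+x. ennreal ((norm (u x - s F x))\<^sup>2) \<partial>M) = (\<integral>\<^sup>+x. liminf (\<lambda>k. ?g k x) \<partial>M)"
      unfolding li ..
    also have "\<dots> \<le> liminf (\<lambda>k. \<integral>\<^sup>+x. ?g k x \<partial>M)"
      by (rule nn_integral_liminf[OF gm])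
    also have "\<dots> \<le> ennreal ?T"
    proof (rule Liminf_le)
      have "\<forall>\<^sub>F k in sequentially. finite (A k) \<and> F \<subseteq> A k \<and> A k \<subseteq> UNIV"
        using lim[unfolded filterlim_finite_subsets_at_top, rule_format, of F] F by blast
      then show "\<forall>\<^sub>F k in sequentially. (\<integral>\<^sup>+x. ?g k x \<partial>M) \<le> ennreal ?T"
        by eventually_elim (use bd in blast)
    qed simp
    finally have le: "(\<integral>\<^sup>+x. ennreal ((norm (u x - s F x))\<^sup>2) \<partial>M) \<le> ennreal ?T" .
    have mm: "(\<lambda>x. (norm (u x - s F x))\<^sup>2) \<in> borel_measurable M"
    proof -
      have [measurable]: "u \<in> borel_measurable M" "s F \<in> borel_measurable M" by (rule um sm')+
      show ?thesis by measurable
    qed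
    have int: "integrable M (\<lambda>x. (norm (u x - s F x))\<^sup>2)"
    proof (rule integrableI_bounded[OF mm])
      have "(\<integral>\<^sup>+x. ennreal (norm ((norm (u x - s F x))\<^sup>2)) \<partial>M) \<le> ennreal ?T" using le by simp
      then show "(\<integral>\<^sup>+x. ennreal (norm ((norm (u x - s F x))\<^sup>2)) \<partial>M) < \<infinity>"
        by (rule le_less_trans) simp
    qed
    have "ennreal ((L2norm M (\<lambda>x. u x - s F x))\<^sup>2) \<le> ennreal ?T"
      using le nn_integral_eq_integral[OF int] by (simp add: L2norm_sq)
    then have "(L2norm M (\<lambda>x. u x - s F x))\<^sup>2 \<le> ?T" using T0 by (simp add: ennreal_le_iff)
    with int show ?thesis by blast
  qed
  have usq: "square_integrable M u"
    using key[of "{}"] um by (simp add: square_integrable_def s_def)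
  have "((\<lambda>F. S - (\<Sum>n\<in>F. (norm (c n))\<^sup>2)) \<longlongrightarrow> S - S) (finite_subsets_at_top UNIV)"
    using has_sum_infsum[OF sm] unfolding S_def has_sum_def by (rule tendsto_diff[OF tendsto_const])
  then have l0: "((\<lambda>F. S - (\<Sum>n\<in>F. (norm (c n))\<^sup>2)) \<longlongrightarrow> 0) (finite_subsets_at_top UNIV)" by simp
  have "((\<lambda>F. (L2norm M (\<lambda>x. u x - s F x))\<^sup>2) \<longlongrightarrow> 0) (finite_subsets_at_top UNIV)"
  proof (rule tendsto_sandwich[OF _ _ tendsto_const l0])
    show "\<forall>\<^sub>F F in finite_subsets_at_top UNIV. 0 \<le> (L2norm M (\<lambda>x. u x - s F x))\<^sup>2" by simp
    show "\<forall>\<^sub>F F in finite_subsets_at_top UNIV. (L2norm M (\<lambda>x. u x - s F x))\<^sup>2 \<le> S - (\<Sum>n\<in>F. (norm (c n))\<^sup>2)"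
      by (rule eventually_finite_subsets_at_top_weakI) (use key in blast)
  qed
  from tendsto_real_sqrt[OF this] have "((\<lambda>F. L2norm M (\<lambda>x. u x - s F x)) \<longlongrightarrow> 0) (finite_subsets_at_top UNIV)"
    by (simp add: L2norm_nonneg)
  with usq show ?thesis by (simp add: L2_expansion_def s_def)
qed

context rectangular_lattice
begin

text \<open>From (2 y + \<beta> n)^2 \<ge> 0 follows (y + \<beta> n)^2 \<ge> (\<beta> n)^2 / 2 -
  y^2. Halving the exponent of the weight amounts to replacing \<gamma> by \<gamma> * sqrt
  2.\<close>

lemma amp_le: "amp n y \<le> N * exp (y\<^sup>2) * gw (\<gamma> * sqrt 2) n"
proof -
  have "0 \<le> (2 * y + \<beta> * of_int n)\<^sup>2" by simp
  then have "- (y + \<beta> * of_int n)\<^sup>2 \<le> y\<^sup>2 + - (\<beta> * of_int n)\<^sup>2 / 2"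
    by (simp add: power2_eq_square algebra_simps)
  then have "exp (- (y + \<beta> * of_int n)\<^sup>2) \<le> exp (y\<^sup>2) * exp (- (\<beta> * of_int n)\<^sup>2 / 2)"
    by (simp flip: exp_add)
  also have "exp (- (\<beta> * of_int n)\<^sup>2 / 2) = gw (\<gamma> * sqrt 2) n"
    by (simp add: gw_def \<beta>_def power_mult_distrib power_divide)
  finally show ?thesis using N_pos by (simp add: amp_def mult.assoc)
qed

lemma summable_majorant: "gw (\<gamma> * sqrt 2) summable_on UNIV"
  by (rule summable_gw) simp

definition psi_bound :: real where
  "psi_bound = N * exp (\<beta>\<^sup>2) * (\<Sum>\<^sub>\<infinity>n\<in>UNIV. gw (\<gamma> * sqrt 2) n)"

lemma psi_bound_nonneg: "psi_bound \<ge> 0"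
  using N_pos by (simp add: psi_bound_def infsum_nonneg less_imp_le)

lemma amp_summable: "(\<lambda>n. amp n y) summable_on UNIV"
proof (rule summable_on_comparison_test)
  show "(\<lambda>n. N * exp (y\<^sup>2) * gw (\<gamma> * sqrt 2) n) summable_on UNIV"
    by (rule summable_on_cmult_right[OF summable_majorant])
qed (use amp_le amp_pos less_imp_le in blast)+

text \<open>Raising y by \<beta> shifts the index by one, so the sum is \<beta>-periodic in y, and
  the majorant is applied with 0 \<le> y \<le> \<beta>.\<close>

lemma amp_infsum_le: "(\<Sum>\<^sub>\<infinity>n\<in>UNIV. amp n y) \<le> psi_bound"
proof -
  define k where "k = \<lfloor>y / \<beta>\<rfloor>"
  define y' where "y' = y - \<beta> * of_int k"
  have "of_int k \<le> y / \<beta>" "y / \<beta> \<le> of_int k + 1" unfolding k_def by linarith+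
  then have y': "0 \<le> y'" "y' \<le> \<beta>" using beta_pos by (simp_all add: y'_def field_simps)
  have sh: "amp n y = amp (n + k) y'" for n
    by (simp add: amp_def y'_def algebra_simps)
  have "(\<Sum>\<^sub>\<infinity>n\<in>UNIV. amp n y) = (\<Sum>\<^sub>\<infinity>n\<in>UNIV. amp n y')"
    unfolding sh
    by (rule infsum_reindex_bij_betw[of "\<lambda>n. n + k" UNIV UNIV "\<lambda>n. amp n y'"])
       (rule bij_betwI[where g = "\<lambda>n. n - k"], auto)
  also have "\<dots> \<le> (\<Sum>\<^sub>\<infinity>n\<in>UNIV. N * exp (\<beta>\<^sup>2) * gw (\<gamma> * sqrt 2) n)"
  proof (rule infsum_mono[OF amp_summable summable_on_cmult_right[OF summable_majorant]])
    fix n :: int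
    have "amp n y' \<le> N * exp (y'\<^sup>2) * gw (\<gamma> * sqrt 2) n" by (rule amp_le)
    also have "\<dots> \<le> N * exp (\<beta>\<^sup>2) * gw (\<gamma> * sqrt 2) n"
      using y' N_pos by (intro mult_right_mono mult_left_mono) (simp_all add: less_imp_le)
    finally show "amp n y' \<le> N * exp (\<beta>\<^sup>2) * gw (\<gamma> * sqrt 2) n" .
  qed
  also have "\<dots> = psi_bound"
    unfolding psi_bound_def by (rule infsum_cmult_right')
  finally show ?thesis .
qed

text \<open>Meant for bounded coefficients: those of \<open>Phi0\<close> are constant, and the
  Gaussian decay of \<open>amp\<close> makes the series absolutely convergent and uniformly bounded
  all the same.\<close>

definition bseries :: "(int \<Rightarrow> complex) \<Rightarrow> complex \<Rightarrow> complex" where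
  "bseries c z = (\<Sum>\<^sub>\<infinity>n\<in>UNIV. c n * psi \<gamma> n z)"

lemma bseries_abs_summable:
  assumes "\<And>n. norm (c n) \<le> C"
  shows "(\<lambda>n. norm (c n * psi \<gamma> n z)) summable_on UNIV"
proof (rule summable_on_comparison_test[OF summable_on_cmult_right[OF amp_summable]])
  show "norm (c n * psi \<gamma> n z) \<le> C * amp n (Im z)" for n
    unfolding norm_mult norm_psi by (rule mult_right_mono[OF assms less_imp_le[OF amp_pos]])
qed simp

lemma bseries_has_sum:
  assumes "\<And>n. norm (c n) \<le> C"
  shows "((\<lambda>n. c n * psi \<gamma> n z) has_sum bseries c z) UNIV"
  unfolding bseries_def by (rule has_sum_infsum[OF abs_summable_summable[OF bseries_abs_summable[OF assms]]])

lemma bseries_abs_bound: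
  assumes "\<And>n. norm (c n) \<le> C"
  shows "(\<Sum>\<^sub>\<infinity>n\<in>UNIV. norm (c n * psi \<gamma> n z)) \<le> C * psi_bound"
proof -
  have C: "C \<ge> 0" by (rule order_trans[OF norm_ge_zero assms])
  have "(\<Sum>\<^sub>\<infinity>n\<in>UNIV. norm (c n * psi \<gamma> n z)) \<le> (\<Sum>\<^sub>\<infinity>n\<in>UNIV. C * amp n (Im z))"
  proof (rule infsum_mono[OF bseries_abs_summable[OF assms] summable_on_cmult_right[OF amp_summable]])
    show "norm (c n * psi \<gamma> n z) \<le> C * amp n (Im z)" for n
      unfolding norm_mult norm_psi by (rule mult_right_mono[OF assms less_imp_le[OF amp_pos]])
  qed
  also have "\<dots> = C * (\<Sum>\<^sub>\<infinity>n\<in>UNIV. amp n (Im z))" by (rule infsum_cmult_right')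
  also have "\<dots> \<le> C * psi_bound" by (rule mult_left_mono[OF amp_infsum_le C])
  finally show ?thesis .
qed

lemma bseries_bound:
  assumes "\<And>n. norm (c n) \<le> C"
  shows "norm (bseries c z) \<le> C * psi_bound"
  using norm_infsum_bound[OF bseries_abs_summable[of c C z, OF assms]] bseries_abs_bound[of c C z, OF assms]
  by (simp add: bseries_def)

definition psi_entire :: "int \<Rightarrow> complex \<Rightarrow> complex" where
  "psi_entire n z = of_real (N * gw \<gamma> n) * exp (2 * \<i> * of_int n * of_real \<beta> * z + z\<^sup>2 / 2)"

lemma psi_psi_entire: "psi \<gamma> n z = of_real (exp (- (cmod z)\<^sup>2 / 2)) * psi_entire n z"
proof -
  have "- of_real (pi\<^sup>2 * (of_int n)\<^sup>2 / \<gamma>\<^sup>2) + 2 * \<i> * of_int n * of_real (pi / \<gamma>) * z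
          + z\<^sup>2 / 2 - of_real ((cmod z)\<^sup>2 / 2) =
     complex_of_real (- (pi\<^sup>2 * (of_int n)\<^sup>2 / \<gamma>\<^sup>2)) + ((2 * \<i> * of_int n * of_real \<beta> * z + z\<^sup>2 / 2) + of_real (- (cmod z)\<^sup>2 / 2))"
    by (simp add: \<beta>_def)
  then have "psi \<gamma> n z = of_real N * exp (complex_of_real (- (pi\<^sup>2 * (of_int n)\<^sup>2 / \<gamma>\<^sup>2)) + ((2 * \<i> * of_int n * of_real \<beta> * z + z\<^sup>2 / 2) + of_real (- (cmod z)\<^sup>2 / 2)))"
    by (simp only: psi_def Npsi_def)
  then show ?thesis
    unfolding exp_add[of "complex_of_real _"] exp_add[of _ "of_real (- (cmod z)\<^sup>2 / 2)"] exp_of_real psi_entire_def gw_def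
    by (simp only: of_real_mult mult_ac)
qed

lemma norm_psi_entire: "norm (psi_entire n z) = exp ((cmod z)\<^sup>2 / 2) * amp n (Im z)"
proof -
  have "amp n (Im z) = exp (- ((cmod z)\<^sup>2 / 2)) * norm (psi_entire n z)"
    unfolding norm_psi[symmetric] psi_psi_entire norm_mult by simp
  then show ?thesis by (simp flip: exp_add mult.assoc)
qed

lemma psi_R: "R (of_real \<gamma>) (psi \<gamma> n) z = psi \<gamma> n z"
proof -
  have "exp ((of_real \<gamma> * cnj z - cnj (of_real \<gamma>) * z) / 2) = cis (- (\<gamma> * Im z))"
    unfolding cis_conv_exp by (rule arg_cong[of _ _ exp]) (simp add: complex_eq_iff algebra_simps)
  then have "R (of_real \<gamma>) (psi \<gamma> n) z = of_real (amp n (Im z)) * (cis (- (\<gamma> * Im z)) * cis (2 * \<beta> * of_int n * (Re z + \<gamma>) + (Re z + \<gamma>) * Im z))"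
    unfolding R_def psi_polar by (simp add: mult_ac)
  also have "cis (- (\<gamma> * Im z)) * cis (2 * \<beta> * of_int n * (Re z + \<gamma>) + (Re z + \<gamma>) * Im z) =
     cis (2 * \<beta> * of_int n * Re z + Re z * Im z) * cis (2 * pi * of_int n)"
    unfolding cis_mult by (rule arg_cong[of _ _ cis]) (simp add: \<beta>_def field_simps)
  finally show ?thesis unfolding cis_2pi_int psi_polar[of n z] by simp
qed

text \<open>Locally uniform convergence makes the holomorphic part entire; boundedness gives
  polynomial growth with exponent 0, and each term is fixed by \<open>R\<close>.\<close>

lemma bseries_Fspace:
  assumes C: "\<And>n. norm (c n) \<le> C"
  shows "bseries c \<in> Fspace \<gamma>"
proof -
  define F where "F z = (\<Sum>\<^sub>\<infinity>n\<in>UNIV. c n * psi_entire n z)" for z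
  have C0: "C \<ge> 0" by (rule order_trans[OF norm_ge_zero C])
  have hol_ball: "F holomorphic_on ball 0 r" for r
  proof -
    let ?M = "\<lambda>n. C * exp (r\<^sup>2 / 2) * N * exp (r\<^sup>2) * gw (\<gamma> * sqrt 2) n"
    have ul: "uniform_limit (cball 0 r) (\<lambda>X z. \<Sum>n\<in>X. c n * psi_entire n z) F (finite_subsets_at_top UNIV)"
      unfolding F_def
    proof (rule Weierstrass_m_test_general)
      show "?M summable_on UNIV" by (rule summable_on_cmult_right[OF summable_majorant])
      fix n :: int and z :: complex assume "z \<in> cball 0 r"
      then have z: "norm z \<le> r" by simp
      have 1: "(norm z)\<^sup>2 \<le> r\<^sup>2" by (rule power_mono[OF z]) simp
      have 2: "(Im z)\<^sup>2 \<le> (norm z)\<^sup>2" by (simp add: cmod_power2)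
      have "norm (c n * psi_entire n z) = norm (c n) * (exp ((cmod z)\<^sup>2 / 2) * amp n (Im z))"
        by (simp add: norm_mult norm_psi_entire)
      also have "\<dots> \<le> C * (exp (r\<^sup>2 / 2) * (N * exp (r\<^sup>2) * gw (\<gamma> * sqrt 2) n))"
      proof (intro mult_mono C)
        have "amp n (Im z) \<le> N * exp ((Im z)\<^sup>2) * gw (\<gamma> * sqrt 2) n" by (rule amp_le)
        also have "\<dots> \<le> N * exp (r\<^sup>2) * gw (\<gamma> * sqrt 2) n"
          using 1 2 N_pos by (intro mult_right_mono mult_left_mono) (simp_all add: less_imp_le)
        finally show "amp n (Im z) \<le> N * exp (r\<^sup>2) * gw (\<gamma> * sqrt 2) n" .
      qed (use 1 C0 amp_pos[of n "Im z"] in auto)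
      finally show "norm (c n * psi_entire n z) \<le> ?M n" by (simp only: mult.assoc)
    qed
    have ev: "\<forall>\<^sub>F X in finite_subsets_at_top UNIV. continuous_on (cball 0 r) (\<lambda>z. \<Sum>n\<in>X. c n * psi_entire n z) \<and>
        (\<lambda>z. \<Sum>n\<in>X. c n * psi_entire n z) holomorphic_on ball 0 r"
      unfolding psi_entire_def
      by (intro always_eventually allI conjI continuous_intros holomorphic_intros) auto
    show ?thesis
      by (rule holomorphic_uniform_limit[OF ev ul]) simp_all
  qed
  have hol: "F holomorphic_on UNIV"
    unfolding holomorphic_on_def
  proof
    fix z :: complex
    have "F field_differentiable at z"
      by (rule holomorphic_on_imp_differentiable_at[OF hol_ball[of "norm z + 1"]]) auto
    then show "F field_differentiable at z within UNIV" by simp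
  qed
  have eq: "bseries c z = of_real (exp (- (cmod z)\<^sup>2 / 2)) * F z" for z
  proof -
    have "bseries c z = (\<Sum>\<^sub>\<infinity>n\<in>UNIV. of_real (exp (- (cmod z)\<^sup>2 / 2)) * (c n * psi_entire n z))"
      unfolding bseries_def psi_psi_entire by (rule infsum_cong) (simp only: mult_ac)
    also have "\<dots> = of_real (exp (- (cmod z)\<^sup>2 / 2)) * F z" unfolding F_def by (rule infsum_cmult_right')
    finally show ?thesis .
  qed
  have "bseries c \<in> Etilde"
    unfolding Etilde_def mem_Collect_eq
  proof (intro conjI exI allI)
    show "F holomorphic_on UNIV" by (rule hol)
    show "bseries c z = of_real (exp (- (cmod z)\<^sup>2 / 2)) * F z" for z by (rule eq)
    \<comment> \<open>\<open>powr\<close> sends base 0 to 0 for every exponent, so this is what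
      makes \<open>japanese z powr 0\<close> equal to 1.\<close>
    have "japanese z \<noteq> 0" for z
      using sum_power2_ge_zero[of 1 "cmod z"] by (simp add: japanese_def add_nonneg_eq_0_iff)
    then show "norm (bseries c z) \<le> C * psi_bound * japanese z powr 0" for z
      using bseries_bound[of c C z, OF C] by simp
  qed
  moreover have "R (of_real \<gamma>) (bseries c) = bseries c"
  proof
    fix z
    have "R (of_real \<gamma>) (bseries c) z = (\<Sum>\<^sub>\<infinity>n\<in>UNIV. c n * R (of_real \<gamma>) (psi \<gamma> n) z)"
      unfolding R_def bseries_def infsum_cmult_right'[symmetric]
      by (rule infsum_cong) (simp only: mult_ac)
    then show "R (of_real \<gamma>) (bseries c) z = bseries c z"
      by (simp only: psi_R bseries_def)
  qed
  ultimately show ?thesis by (simp add: Fspace_def)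
qed

lemma bseries_single: "bseries (\<lambda>m. if m = n then 1 else 0) = psi \<gamma> n"
proof
  fix z
  have "((\<lambda>m. (if m = n then 1 else 0) * psi \<gamma> m z) has_sum psi \<gamma> n z) UNIV"
    by (rule has_sum_finiteI[THEN has_sum_cong_neutral[THEN iffD1, rotated -1], of "{n}"]) auto
  then show "bseries (\<lambda>m. if m = n then 1 else 0) z = psi \<gamma> n z"
    by (simp add: bseries_def infsumI)
qed

lemma square_integrable_psi: "square_integrable (lebesgue_on (strip \<gamma>)) (psi \<gamma> n)"
proof -
  define g where "g z = (norm (psi \<gamma> n z))\<^sup>2" for z
  have "continuous_on UNIV g" unfolding g_def by (intro continuous_intros continuous_psi)
  then have gb: "g \<in> borel_measurable borel" by (rule continuous_borel)
  have gb': "(\<lambda>z. indicator (strip \<gamma>) z *\<^sub>R g z) \<in> borel_measurable borel"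
    using gb strip_borel[of \<gamma>] by measurable
  have "integrable (lborel \<Otimes>\<^sub>M lborel) (\<lambda>(x, y). indicator {- \<gamma> / 2<..\<gamma> / 2} x * (amp n y)\<^sup>2)"
    by (rule integrable_pair_mult) (use gamma_pos amp_sq_integral in auto)
  also have "(\<lambda>(x, y). indicator {- \<gamma> / 2<..\<gamma> / 2} x * (amp n y)\<^sup>2) =
      (\<lambda>(x, y). indicator (strip \<gamma>) (Complex x y) *\<^sub>R g (Complex x y))"
    by (auto simp: fun_eq_iff indicator_def strip_def g_def norm_psi)
  finally have "integrable lborel (\<lambda>z. indicator (strip \<gamma>) z *\<^sub>R g z)"
    using integrable_lborel_complex[OF gb'] by simp
  then have "integrable (lebesgue_on (strip \<gamma>)) g"
    using strip_restrict(1)[OF gb] by simp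
  then show ?thesis
    using measurable_strip_continuous[OF continuous_psi] by (simp add: square_integrable_def g_def[abs_def])
qed

lemma psi_L2F: "psi \<gamma> n \<in> L2F \<gamma>"
proof -
  have "bseries (\<lambda>m. if m = n then 1 else 0) \<in> Fspace \<gamma>"
    by (rule bseries_Fspace[of _ 1]) simp
  then show ?thesis by (simp add: bseries_single L2F_def square_integrable_psi)
qed

text \<open>On a horizontal line the series is an absolutely convergent Fourier series, whose
  coefficients can be read off.\<close>

lemma line_coefficient_bseries:
  assumes C: "\<And>n. norm (c n) \<le> C"
  shows "ip period (line (bseries c) y) (fchar (- n)) = c n * of_real (amp n y)"
proof -
  define \<delta> where "\<delta> i = c i * of_real (amp i y)" for i
  have sm: "(\<lambda>i. norm (\<delta> i)) summable_on UNIV"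
    using bseries_abs_summable[of c C "\<i> * of_real y", OF C] less_imp_le[OF amp_pos]
    by (simp add: \<delta>_def norm_mult norm_psi abs_of_pos[OF amp_pos])
  have "line (bseries c) y x = (\<Sum>\<^sub>\<infinity>i\<in>UNIV. \<delta> i * fchar (- i) x)" for x
  proof -
    have "line (bseries c) y x = (\<Sum>\<^sub>\<infinity>i\<in>UNIV. c i * line (psi \<gamma> i) y x)"
      unfolding line_def bseries_def infsum_cmult_left'[symmetric] by (simp only: mult.assoc)
    then show ?thesis by (simp add: line_psi \<delta>_def mult.assoc)
  qed
  \<comment> \<open>The factor \<open>fchar 0\<close> is 1; it brings the series into the product
    shape of \<open>coeff_infsum_mult\<close>.\<close>
  then have eq: "line (bseries c) y = (\<lambda>x. (\<Sum>\<^sub>\<infinity>i\<in>UNIV. \<delta> i * fchar (- i) x) * fchar 0 x)" by auto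
  have "((\<lambda>i. \<delta> i * ip period (fchar 0) (fchar (- n - - i))) has_sum ip period (line (bseries c) y) (fchar (- n))) UNIV"
    unfolding eq by (rule coeff_infsum_mult[OF _ _ sm square_integrable_fchar]) (auto simp: infinite_UNIV_int)
  moreover have "((\<lambda>i. \<delta> i * ip period (fchar 0) (fchar (- n - - i))) has_sum \<delta> n) UNIV"
    by (rule has_sum_finiteI[THEN has_sum_cong_neutral[THEN iffD1, rotated -1], of "{n}"])
       (auto simp: fourier.ortho)
  ultimately show ?thesis unfolding \<delta>_def by (rule has_sum_unique)
qed

sublocale psi: orthonormal_family "lebesgue_on (strip \<gamma>)" "psi \<gamma>"
proof
  show "square_integrable (lebesgue_on (strip \<gamma>)) (psi \<gamma> n)" for n by (rule square_integrable_psi)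
  show "ip (lebesgue_on (strip \<gamma>)) (psi \<gamma> m) (psi \<gamma> n) = (if m = n then 1 else 0)" for m n
  proof -
    \<comment> \<open>Two evaluations of the same line coefficient of \<open>psi \<gamma> m\<close>:
      one through the inner product on the strip, one through its one-term series. The positive
      factor \<open>amp n 0\<close> cancels.\<close>
    have "ip (lebesgue_on (strip \<gamma>)) (psi \<gamma> m) (psi \<gamma> n) * of_real (amp n 0) = (if n = m then 1 else 0) * of_real (amp n 0)"
      unfolding L2F_line_coefficient[OF psi_L2F square_integrable_psi, symmetric]
      unfolding bseries_single[of m, symmetric]
      by (rule line_coefficient_bseries[of _ 1]) simp
    then show ?thesis using amp_pos[of n 0] by auto
  qed
qed

abbreviation coef :: "(complex \<Rightarrow> complex) \<Rightarrow> int \<Rightarrow> complex" where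
  "coef u n \<equiv> ip (lebesgue_on (strip \<gamma>)) u (psi \<gamma> n)"

lemma coef_bounded: "u \<in> L2F \<gamma> \<Longrightarrow> norm (coef u n) \<le> L2norm (lebesgue_on (strip \<gamma>)) u"
  by (rule psi.coeff_bound[OF L2FD(1)])

text \<open>On the horizontal line through z both sides have the same Fourier coefficients, and a
  continuous periodic function with zero coefficients vanishes. The identity therefore holds at
  every point, not merely almost everywhere.\<close>

lemma L2F_eq_bseries:
  assumes u: "u \<in> L2F \<gamma>"
  shows "u = bseries (coef u)"
proof
  fix z
  define C where "C = L2norm (lebesgue_on (strip \<gamma>)) u"
  have C: "norm (coef u n) \<le> C" for n unfolding C_def by (rule coef_bounded[OF u])
  note uF = L2FD(2)[OF u] and bF = bseries_Fspace[of "coef u", OF C]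
  define y where "y = Im z"
  define x where "x = Re z / \<gamma>"
  have z: "z = Complex (\<gamma> * x) y" by (simp add: complex_eq_iff x_def y_def)
  define W where "W t = line u y t - line (bseries (coef u)) y t" for t
  have sl: "square_integrable period (line u y)" "square_integrable period (line (bseries (coef u)) y)"
    by (rule square_integrable_continuous, rule line_continuous, rule uF bF)+
  have "W x = 0"
  proof (rule fourier_unique_0)
    show "W (\<xi> + 1) = W \<xi>" for \<xi> by (simp add: W_def line_periodic[OF uF] line_periodic[OF bF])
    show "continuous_on UNIV W"
      unfolding W_def by (intro continuous_intros line_continuous uF bF)
    show "ip period W (fchar n) = 0" for n
    proof -
      have "ip period W (fchar (- (- n))) = 0"
        unfolding W_def ip_diff_left[OF sl square_integrable_fchar] line_coefficient_bseries[of "coef u", OF C]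
          L2F_line_coefficient[OF u square_integrable_psi] by simp
      then show ?thesis by simp
    qed
  qed
  then show "u z = bseries (coef u) z" by (simp add: W_def line_def z)
qed

lemma coef_bseries:
  assumes "bseries c \<in> L2F \<gamma>" and C: "\<And>n. norm (c n) \<le> C"
  shows "coef (bseries c) n = c n"
  using L2F_line_coefficient[OF assms(1) square_integrable_psi[of n], of 0] line_coefficient_bseries[of c, OF C, of 0 n] amp_pos[of n 0]
  by simp

text \<open>Converse to \<open>L2F_eq_bseries\<close>. Square-summable coefficients are in
  particular bounded, which gives membership in \<open>Fspace\<close>, and pointwise convergence
  upgrades to convergence in L2.\<close>

lemma bseries_expansion:
  assumes sm: "(\<lambda>n. (norm (c n))\<^sup>2) summable_on UNIV"
  shows "bseries c \<in> L2F \<gamma>" "L2_expansion (lebesgue_on (strip \<gamma>)) (psi \<gamma>) c (bseries c)"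
proof -
  define C where "C = sqrt (\<Sum>\<^sub>\<infinity>n\<in>UNIV. (norm (c n))\<^sup>2)"
  have C: "norm (c n) \<le> C" for n
    using finite_sum_le_infsum[OF sm, of "{n}"] by (simp add: C_def real_le_rsqrt)
  note F = bseries_Fspace[of c, OF C]
  show e: "L2_expansion (lebesgue_on (strip \<gamma>)) (psi \<gamma>) c (bseries c)"
    by (rule psi.expansionI_pointwise[OF sm measurable_strip_continuous[OF Fspace_continuous[OF F]] bseries_has_sum[of c, OF C]])
  show "bseries c \<in> L2F \<gamma>" using F e by (simp add: L2F_def L2_expansion_def)
qed

end

section \<open>The cubic projection\<close>

lemma std_normal_fourier:
  "(CLINT u|lborel. of_real (exp (- u\<^sup>2 / 2)) * exp (\<i> * of_real (t * u))) = of_real (sqrt (2 * pi) * exp (- t\<^sup>2 / 2))"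
proof -
  have "complex_of_real (exp (- t\<^sup>2 / 2)) = (CLINT u|std_normal_distribution. iexp (t * u))"
    using fun_cong[OF char_std_normal_distribution, of t] by (simp add: char_def)
  also have "\<dots> = (CLINT u|lborel. std_normal_density u *\<^sub>R iexp (t * u))"
    by (rule integral_density) (auto simp: normal_density_nonneg)
  also have "\<dots> = (CLINT u|lborel. of_real (1 / sqrt (2 * pi)) * (of_real (exp (- u\<^sup>2 / 2)) * exp (\<i> * of_real (t * u))))"
    by (simp add: std_normal_density_def scaleR_conv_of_real mult.assoc)
  also have "\<dots> = of_real (1 / sqrt (2 * pi)) * (CLINT u|lborel. of_real (exp (- u\<^sup>2 / 2)) * exp (\<i> * of_real (t * u)))"
    by (rule integral_mult_right_zero)
  finally show ?thesis by (simp add: field_simps)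
qed

text \<open>The square is completed only for the real part of \<open>c\<close>, by a real
  translation; the imaginary part is a frequency, handled by the characteristic function of the
  normal law. No contour is moved.\<close>

lemma complex_gaussian:
  fixes a :: real and c :: complex
  assumes a: "a > 0"
  shows "integrable lborel (\<lambda>x. exp (of_real (- (a * x\<^sup>2)) + c * of_real x))"
    and "(CLINT x|lborel. exp (of_real (- (a * x\<^sup>2)) + c * of_real x)) = of_real (sqrt (pi / a)) * exp (c\<^sup>2 / (4 * of_real a))"
proof -
  define p q where "p = Re c" and "q = Im c"
  have c: "c = of_real p + \<i> * of_real q" by (simp add: p_def q_def complex_eq_iff)
  define f where "f x = exp (of_real (- (a * x\<^sup>2)) + c * of_real x)" for x :: real
  have fm: "f \<in> borel_measurable borel"
    unfolding f_def by (intro borel_measurable_continuous_onI continuous_intros)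
  have nf: "norm (f x) = exp (p\<^sup>2 / (4 * a)) * exp (- (a * (x + - p / (2 * a))\<^sup>2))" for x
    unfolding f_def norm_exp_eq_Re using a
    by (simp add: p_def power2_eq_square field_simps flip: exp_add)
  show "integrable lborel f"
  proof (rule integrable_bound_real)
    show "integrable lborel (\<lambda>x. exp (p\<^sup>2 / (4 * a)) * exp (- (a * (x + - p / (2 * a))\<^sup>2)))"
      by (rule integrable_mult_right[OF gaussian_integral(1)[OF a]])
  qed (use fm nf in auto)
  define r where "r = 1 / sqrt (2 * a)"
  have r: "r > 0" "r\<^sup>2 = 1 / (2 * a)" using a by (simp_all add: r_def power_divide)
  have "(CLINT x|lborel. f x) = \<bar>r\<bar> *\<^sub>R (CLINT u|lborel. f (p / (2 * a) + r * u))"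
    using r by (intro lborel_integral_real_affine) simp
  also have "(\<lambda>u. f (p / (2 * a) + r * u)) = (\<lambda>u. exp (of_real (p\<^sup>2 / (4 * a)) + \<i> * of_real (p * q / (2 * a))) * (of_real (exp (- u\<^sup>2 / 2)) * exp (\<i> * of_real ((q * r) * u))))"
  proof
    fix u
    have "a * (p / (2 * a) + r * u)\<^sup>2 = p\<^sup>2 / (4 * a) + p * r * u + a * r\<^sup>2 * u\<^sup>2"
      using a by (simp add: power2_eq_square field_simps)
    also have "a * r\<^sup>2 * u\<^sup>2 = u\<^sup>2 / 2" using a by (simp add: r(2))
    finally have e: "a * (p / (2 * a) + r * u)\<^sup>2 = p\<^sup>2 / (4 * a) + p * r * u + u\<^sup>2 / 2" .
    have "of_real (- (a * (p / (2 * a) + r * u)\<^sup>2)) + c * of_real (p / (2 * a) + r * u) =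
        (of_real (p\<^sup>2 / (4 * a)) + \<i> * of_real (p * q / (2 * a))) + (of_real (- u\<^sup>2 / 2) + \<i> * of_real ((q * r) * u))"
      unfolding e c using a by (simp add: complex_eq_iff power2_eq_square field_simps)
    then show "f (p / (2 * a) + r * u) = exp (of_real (p\<^sup>2 / (4 * a)) + \<i> * of_real (p * q / (2 * a))) * (of_real (exp (- u\<^sup>2 / 2)) * exp (\<i> * of_real ((q * r) * u)))"
      unfolding f_def by (simp only: exp_add exp_of_real)
  qed
  also have "(CLINT u|lborel. exp (of_real (p\<^sup>2 / (4 * a)) + \<i> * of_real (p * q / (2 * a))) * (of_real (exp (- u\<^sup>2 / 2)) * exp (\<i> * of_real ((q * r) * u)))) =
      exp (of_real (p\<^sup>2 / (4 * a)) + \<i> * of_real (p * q / (2 * a))) * of_real (sqrt (2 * pi) * exp (- (q * r)\<^sup>2 / 2))"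
    by (subst integral_mult_right_zero) (simp only: std_normal_fourier)
  also have "\<bar>r\<bar> *\<^sub>R \<dots> = of_real (r * sqrt (2 * pi)) * exp (of_real (p\<^sup>2 / (4 * a)) + \<i> * of_real (p * q / (2 * a)) + of_real (- (q * r)\<^sup>2 / 2))"
    using r unfolding exp_add exp_of_real by (simp add: scaleR_conv_of_real mult_ac)
  also have "r * sqrt (2 * pi) = sqrt (pi / a)"
    using a by (simp add: r_def real_sqrt_divide real_sqrt_mult)
  also have "(q * r)\<^sup>2 = q\<^sup>2 / (2 * a)" by (simp add: power_mult_distrib r(2))
  also have "of_real (p\<^sup>2 / (4 * a)) + \<i> * of_real (p * q / (2 * a)) + of_real (- (q\<^sup>2 / (2 * a)) / 2) = c\<^sup>2 / (4 * of_real a)"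
    using a by (simp add: c complex_eq_iff power2_eq_square field_simps)
  finally show "(CLINT x|lborel. f x) = of_real (sqrt (pi / a)) * exp (c\<^sup>2 / (4 * of_real a))" .
qed

lemma gaussian_plane_bound:
  fixes a b p q :: real
  assumes "a > 0" "b > 0"
  shows "integrable lborel (\<lambda>w. exp (- (a * (Re w)\<^sup>2) - b * (Im w)\<^sup>2 + p * Re w + q * Im w))"
proof -
  let ?f = "\<lambda>w. exp (- (a * (Re w)\<^sup>2) - b * (Im w)\<^sup>2 + p * Re w + q * Im w)"
  have g: "integrable lborel (\<lambda>x. exp (- (a * x\<^sup>2) + p * x))" if "a > 0" for a p :: real
    using integrable_norm[OF complex_gaussian(1)[OF that, of "of_real p"]]
    by (simp add: norm_exp_eq_Re)
  have "?f \<in> borel_measurable borel"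
    by (intro borel_measurable_continuous_onI continuous_intros)
  moreover have "integrable (lborel \<Otimes>\<^sub>M lborel) (\<lambda>(x,y). exp (- (a * x\<^sup>2) + p * x) * exp (- (b * y\<^sup>2) + q * y))"
    by (intro integrable_pair_mult g assms)
  moreover have "(\<lambda>(x,y). exp (- (a * x\<^sup>2) + p * x) * exp (- (b * y\<^sup>2) + q * y)) = (\<lambda>(x,y). ?f (Complex x y))"
    by (auto simp: fun_eq_iff algebra_simps simp flip: exp_add)
  ultimately show ?thesis by (simp add: integrable_lborel_complex)
qed

text \<open>The quadratic form is that of the projection integral of three basis functions:
  \<open>Pkernel\<close> contributes minus half of |w|^2, each basis function minus the square of Im
  w, and the phases i Re w Im w enter with signs +, +, -. Integrating over Re w first raises 7/2 to
  4, whence the 16.\<close>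

lemma complex_gaussian_plane:
  fixes A B :: complex
  defines "g \<equiv> \<lambda>w. exp (of_real (- (Re w)\<^sup>2 / 2 - 7 / 2 * (Im w)\<^sup>2) + \<i> * of_real (Re w * Im w) + A * of_real (Re w) + B * of_real (Im w))"
  shows "(CLINT w|lborel. g w) = of_real (pi / sqrt 2) * exp (A\<^sup>2 / 2 + (B + \<i> * A)\<^sup>2 / 16)"
proof -
  have gb: "g \<in> borel_measurable borel"
    unfolding g_def by (intro borel_measurable_continuous_onI continuous_intros) auto
  have gi: "integrable lborel g"
  proof (rule integrable_bound_real)
    show "integrable lborel (\<lambda>w. exp (- (1/2 * (Re w)\<^sup>2) - 7/2 * (Im w)\<^sup>2 + Re A * Re w + Re B * Im w))"
      by (rule gaussian_plane_bound) auto
    show "norm (g w) \<le> exp (- (1/2 * (Re w)\<^sup>2) - 7/2 * (Im w)\<^sup>2 + Re A * Re w + Re B * Im w)" for w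
      by (simp add: g_def norm_exp_eq_Re)
  qed (use gb in simp)
  have gx: "g (Complex x y) = exp (of_real (- (7 / 2 * y\<^sup>2)) + B * of_real y) * exp (of_real (- (1/2 * x\<^sup>2)) + (A + \<i> * of_real y) * of_real x)" for x y
    unfolding g_def by (simp add: algebra_simps flip: exp_add)
  have inner: "(CLINT x|lborel. g (Complex x y)) = of_real (sqrt (2 * pi)) * exp (A\<^sup>2 / 2) * exp (of_real (- (4 * y\<^sup>2)) + (B + \<i> * A) * of_real y)" for y
  proof -
    have "(CLINT x|lborel. g (Complex x y)) = exp (of_real (- (7 / 2 * y\<^sup>2)) + B * of_real y) * (of_real (sqrt (pi / (1/2))) * exp ((A + \<i> * of_real y)\<^sup>2 / (4 * of_real (1/2))))"
      unfolding gx by (subst integral_mult_right_zero, subst complex_gaussian(2)) simp_all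
    also have "\<dots> = of_real (sqrt (2 * pi)) * exp (of_real (- (7 / 2 * y\<^sup>2)) + B * of_real y + (A + \<i> * of_real y)\<^sup>2 / 2)"
      unfolding exp_add by (simp add: mult_ac)
    also have "of_real (- (7 / 2 * y\<^sup>2)) + B * of_real y + (A + \<i> * of_real y)\<^sup>2 / 2 =
      A\<^sup>2 / 2 + (of_real (- (4 * y\<^sup>2)) + (B + \<i> * A) * of_real y)"
      by (simp add: power2_eq_square field_simps)
    finally show ?thesis unfolding exp_add by (simp only: mult.assoc)
  qed
  have "(CLINT w|lborel. g w) = of_real (sqrt (2 * pi)) * exp (A\<^sup>2 / 2) * (of_real (sqrt (pi / 4)) * exp ((B + \<i> * A)\<^sup>2 / (4 * of_real 4)))"
    unfolding integral_lborel_complex_iterated[OF gb gi] inner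
    by (subst integral_mult_right_zero, subst complex_gaussian(2)) simp_all
  also have "\<dots> = of_real (sqrt (2 * pi) * sqrt (pi / 4)) * exp (A\<^sup>2 / 2 + (B + \<i> * A)\<^sup>2 / 16)"
    unfolding exp_add by (simp add: mult_ac)
  also have "sqrt (2 * pi) * sqrt (pi / 4) = pi / sqrt 2"
    by (simp add: real_sqrt_mult real_sqrt_divide field_simps)
  finally show ?thesis .
qed

definition Pkernel :: "complex \<Rightarrow> complex \<Rightarrow> complex" where
  "Pkernel z w = exp (cnj w * z - of_real ((cmod w)\<^sup>2 / 2))"

lemma continuous_Pkernel: "continuous_on UNIV (Pkernel z)"
  unfolding Pkernel_def by (intro continuous_intros) auto

lemma integrable_norm_Pkernel: "integrable lborel (\<lambda>w. norm (Pkernel z w))"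
proof -
  have "norm (Pkernel z w) = exp (- (1/2 * (Re w)\<^sup>2) - 1/2 * (Im w)\<^sup>2 + Re z * Re w + Im z * Im w)" for w
    unfolding Pkernel_def norm_exp_eq_Re cmod_power2 by (simp add: algebra_simps)
  then show ?thesis using gaussian_plane_bound[of "1/2" "1/2"] by simp
qed

lemma Proj_lborel:
  assumes "continuous_on UNIV u"
  shows "Proj u z = of_real (1 / pi * exp (- (cmod z)\<^sup>2 / 2)) * (CLINT w|lborel. Pkernel z w * u w)"
proof -
  have "continuous_on UNIV (\<lambda>w. Pkernel z w * u w)"
    by (intro continuous_intros continuous_Pkernel assms)
  then have "(\<lambda>w. Pkernel z w * u w) \<in> borel_measurable lborel"
    using continuous_borel by simp
  from integral_completion[OF this] show ?thesis
    unfolding Proj_def Pkernel_def[symmetric] by simp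
qed

context rectangular_lattice
begin

definition \<kappa> :: real where "\<kappa> = 1 / (\<gamma> * sqrt pi)"

lemma N_sq_kappa: "N\<^sup>2 / sqrt 2 = \<kappa>"
  by (simp add: N_sq \<kappa>_def real_sqrt_divide)

text \<open>A single exponential of a polynomial in Re w and Im w, so that products of basis
  functions become sums of exponents.\<close>

lemma psi_exponential:
  "psi \<gamma> n w = of_real N * exp (- (of_real \<beta> * of_int n)\<^sup>2 + 2 * \<i> * of_real \<beta> * of_int n * (of_real (Re w) + \<i> * of_real (Im w))
     + \<i> * of_real (Re w) * of_real (Im w) - (of_real (Im w))\<^sup>2)"
  unfolding psi_polar amp_def of_real_mult exp_of_real[symmetric] cis_conv_exp mult.assoc exp_add[symmetric]
  by (intro arg_cong2[of _ _ _ _ "(*)"] refl arg_cong[of _ _ exp])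
     (simp add: complex_eq_iff power2_eq_square algebra_simps)

text \<open>Frequencies balance as j + k = m + n. After the Gaussian integral everything is one
  exponential, and the identity is a completion of squares in j, k and m.\<close>

lemma Proj_triple:
  fixes j k n :: int
  defines "m \<equiv> j + k - n"
  shows "Proj (\<lambda>w. psi \<gamma> j w * psi \<gamma> k w * cnj (psi \<gamma> n w)) z = of_real (\<kappa> * gw \<gamma> (j - m) * gw \<gamma> (k - m)) * psi \<gamma> m z"
proof -
  define A where "A = z + 2 * \<i> * of_real \<beta> * of_int m"
  define B where "B = - \<i> * z - 2 * of_real \<beta> * of_int (j + k + n)"
  define Q :: complex where "Q = - (of_real \<beta> * of_int j)\<^sup>2 - (of_real \<beta> * of_int k)\<^sup>2 - (of_real \<beta> * of_int n)\<^sup>2"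
  have pt: "Pkernel z w * (psi \<gamma> j w * psi \<gamma> k w * cnj (psi \<gamma> n w)) = of_real (N ^ 3) * exp Q *
     exp (of_real (- (Re w)\<^sup>2 / 2 - 7 / 2 * (Im w)\<^sup>2) + \<i> * of_real (Re w * Im w) + A * of_real (Re w) + B * of_real (Im w))" for w
  proof -
    define X Y where "X = complex_of_real (Re w)" and "Y = complex_of_real (Im w)"
    have cw: "cnj w = X - \<i> * Y" by (simp add: X_def Y_def complex_eq_iff)
    have nw: "complex_of_real ((cmod w)\<^sup>2 / 2) = (X\<^sup>2 + Y\<^sup>2) / 2" by (simp add: X_def Y_def cmod_power2)
    have cX: "cnj X = X" "cnj Y = Y" by (simp_all add: X_def Y_def)
    have cE: "cnj (exp (- (of_real \<beta> * of_int n)\<^sup>2 + 2 * \<i> * of_real \<beta> * of_int n * (X + \<i> * Y) + \<i> * X * Y - Y\<^sup>2)) =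
        exp (- (of_real \<beta> * of_int n)\<^sup>2 - 2 * \<i> * of_real \<beta> * of_int n * (X - \<i> * Y) - \<i> * X * Y - Y\<^sup>2)"
      unfolding exp_cnj by (rule arg_cong[of _ _ exp]) (simp add: cX)
    have "Pkernel z w * (psi \<gamma> j w * psi \<gamma> k w * cnj (psi \<gamma> n w)) = of_real (N ^ 3) *
       (exp ((X - \<i> * Y) * z - (X\<^sup>2 + Y\<^sup>2) / 2) *
        exp (- (of_real \<beta> * of_int j)\<^sup>2 + 2 * \<i> * of_real \<beta> * of_int j * (X + \<i> * Y) + \<i> * X * Y - Y\<^sup>2) *
        exp (- (of_real \<beta> * of_int k)\<^sup>2 + 2 * \<i> * of_real \<beta> * of_int k * (X + \<i> * Y) + \<i> * X * Y - Y\<^sup>2) *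
        exp (- (of_real \<beta> * of_int n)\<^sup>2 - 2 * \<i> * of_real \<beta> * of_int n * (X - \<i> * Y) - \<i> * X * Y - Y\<^sup>2))"
      unfolding Pkernel_def psi_exponential X_def[symmetric] Y_def[symmetric] cw nw complex_cnj_mult cE
      by (simp add: power3_eq_cube mult_ac)
    also have "\<dots> = of_real (N ^ 3) * (exp Q * exp ((- X\<^sup>2 / 2 - 7 / 2 * Y\<^sup>2) + \<i> * (X * Y) + A * X + B * Y))"
      unfolding exp_add[symmetric]
      by (intro arg_cong2[of _ _ _ _ "(*)"] refl arg_cong[of _ _ exp])
         (simp add: A_def B_def Q_def m_def power2_eq_square field_simps)
    finally show ?thesis by (simp add: X_def Y_def mult.assoc)
  qed
  \<comment> \<open>Here z cancels. It survives only in A^2/2, which contains z^2/2 + 2 i \<beta> m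
    z, the exponent of \<open>psi_entire m\<close>.\<close>
  have AB: "B + \<i> * A = - 4 * of_real \<beta> * of_int (j + k)"
    by (simp add: A_def B_def m_def algebra_simps)
  define G where "G = (of_real \<beta> * of_int (j - m))\<^sup>2 + (of_real \<beta> * complex_of_int (k - m))\<^sup>2"
  have cont: "continuous_on UNIV (\<lambda>w. psi \<gamma> j w * psi \<gamma> k w * cnj (psi \<gamma> n w))"
    by (intro continuous_intros continuous_psi)
  have "Proj (\<lambda>w. psi \<gamma> j w * psi \<gamma> k w * cnj (psi \<gamma> n w)) z =
     of_real (1 / pi * exp (- (cmod z)\<^sup>2 / 2)) * (of_real (N ^ 3) * exp Q * (of_real (pi / sqrt 2) * exp (A\<^sup>2 / 2 + (B + \<i> * A)\<^sup>2 / 16)))"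
    unfolding Proj_lborel[OF cont] pt integral_mult_right_zero complex_gaussian_plane ..
  also have "\<dots> = of_real (N ^ 3 / sqrt 2) * (exp (of_real (- (cmod z)\<^sup>2 / 2)) * exp Q * exp (A\<^sup>2 / 2 + (B + \<i> * A)\<^sup>2 / 16))"
    by (simp add: exp_of_real[symmetric] field_simps)
  also have "exp (of_real (- (cmod z)\<^sup>2 / 2)) * exp Q * exp (A\<^sup>2 / 2 + (B + \<i> * A)\<^sup>2 / 16) =
      exp (- G) * (exp (of_real (- (cmod z)\<^sup>2 / 2)) * (exp (- (of_real \<beta> * of_int m)\<^sup>2) * exp (2 * \<i> * of_int m * of_real \<beta> * z + z\<^sup>2 / 2)))"
    unfolding exp_add[symmetric] AB
    by (rule arg_cong[of _ _ exp]) (simp add: A_def Q_def G_def m_def power2_eq_square field_simps)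
  also have "of_real (N ^ 3 / sqrt 2) = of_real \<kappa> * complex_of_real N"
    by (simp add: N_sq_kappa[symmetric] power3_eq_cube power2_eq_square)
  also have "exp (- G) = of_real (gw \<gamma> (j - m) * gw \<gamma> (k - m))"
    unfolding gw_beta of_real_mult exp_of_real[symmetric] exp_add[symmetric]
    by (rule arg_cong[of _ _ exp]) (simp add: G_def)
  also have "exp (- (of_real \<beta> * of_int m)\<^sup>2) = complex_of_real (gw \<gamma> m)"
    unfolding gw_beta exp_of_real[symmetric] by simp
  finally show ?thesis
    unfolding psi_psi_entire[of m z] psi_entire_def exp_of_real by (simp only: of_real_mult mult_ac)
qed

end

section \<open>Cubic expressions in basis series\<close>

lemma abs_summable_prod3:
  fixes f :: "'i \<Rightarrow> 'b::{banach,real_normed_field}" and g :: "'j \<Rightarrow> 'b" and h :: "'k \<Rightarrow> 'b"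
  assumes f: "(\<lambda>i. norm (f i)) summable_on UNIV" and g: "(\<lambda>j. norm (g j)) summable_on UNIV"
    and h: "(\<lambda>k. norm (h k)) summable_on UNIV"
  shows "(\<lambda>(k,i,j). norm (h k * (f i * g j))) summable_on UNIV"
    and "((\<lambda>(k,i,j). h k * (f i * g j)) has_sum
      ((\<Sum>\<^sub>\<infinity>k\<in>UNIV. h k) * ((\<Sum>\<^sub>\<infinity>i\<in>UNIV. f i) * (\<Sum>\<^sub>\<infinity>j\<in>UNIV. g j)))) UNIV"
proof -
  define fg where "fg p = f (fst p) * g (snd p)" for p
  have 1: "(\<lambda>p. norm (fg p)) summable_on UNIV"
    using abs_summable_prod(1)[OF f g] by (simp add: fg_def[abs_def] case_prod_beta')
  have 2: "(\<Sum>\<^sub>\<infinity>p\<in>UNIV. fg p) = (\<Sum>\<^sub>\<infinity>i\<in>UNIV. f i) * (\<Sum>\<^sub>\<infinity>j\<in>UNIV. g j)"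
    using abs_summable_prod(2)[OF f g] by (intro infsumI) (simp add: fg_def[abs_def] case_prod_beta')
  show "(\<lambda>(k,i,j). norm (h k * (f i * g j))) summable_on UNIV"
    using abs_summable_prod(1)[OF h 1] by (simp add: fg_def case_prod_beta')
  show "((\<lambda>(k,i,j). h k * (f i * g j)) has_sum
      ((\<Sum>\<^sub>\<infinity>k\<in>UNIV. h k) * ((\<Sum>\<^sub>\<infinity>i\<in>UNIV. f i) * (\<Sum>\<^sub>\<infinity>j\<in>UNIV. g j)))) UNIV"
    using abs_summable_prod(2)[OF h 1] unfolding 2 by (simp add: fg_def case_prod_beta')
qed

context rectangular_lattice
begin

lemma continuous_bseries:
  assumes "\<And>n. norm (c n) \<le> C"
  shows "continuous_on UNIV (bseries c)"
  by (rule Fspace_continuous[OF bseries_Fspace[of c, OF assms]])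

text \<open>The triples with j + k = m + n, parametrized by p = j - m and q = k - m, so that n = m +
  p + q and the Gaussian weight factors into a p-part and a q-part.\<close>

definition cubic_coeff :: "(int \<Rightarrow> complex) \<Rightarrow> (int \<Rightarrow> complex) \<Rightarrow> (int \<Rightarrow> complex) \<Rightarrow> int \<Rightarrow> int \<times> int \<Rightarrow> complex" where
  "cubic_coeff x y w m = (\<lambda>(p, q). of_real (\<kappa> * gw \<gamma> p * gw \<gamma> q) * (x (m + p) * y (m + q) * cnj (w (m + p + q))))"

text \<open>Termwise projection of the triple product. Every finite sum of absolute values is at
  most \<open>B ^ 3\<close> uniformly in \<omega>, and \<open>Pkernel\<close> is integrable, so the
  integrals of the terms are absolutely summable.\<close>

lemma Proj_cubic_has_sum:
  assumes x: "\<And>n. norm (x n) \<le> C" and y: "\<And>n. norm (y n) \<le> C" and w: "\<And>n. norm (w n) \<le> C"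
  defines "T \<equiv> \<lambda>\<omega>. bseries x \<omega> * bseries y \<omega> * cnj (bseries w \<omega>)"
  shows "integrable lborel (\<lambda>\<omega>. Pkernel z \<omega> * T \<omega>)"
    and "((\<lambda>(m, pq). cubic_coeff x y w m pq * psi \<gamma> m z) has_sum Proj T z) UNIV"
proof -
  define B where "B = C * psi_bound"
  have C0: "C \<ge> 0" by (rule order_trans[OF norm_ge_zero x])
  have B0: "B \<ge> 0" unfolding B_def by (rule mult_nonneg_nonneg[OF C0 psi_bound_nonneg])
  define t where "t = (\<lambda>(n, j, k) \<omega>. cnj (w n * psi \<gamma> n \<omega>) * ((x j * psi \<gamma> j \<omega>) * (y k * psi \<gamma> k \<omega>)))"
  have wc: "norm (cnj (w n)) \<le> C" for n using w by simp
  have sx: "(\<lambda>n. norm (x n * psi \<gamma> n \<omega>)) summable_on UNIV" for \<omega> by (rule bseries_abs_summable[of x, OF x])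
  have sy: "(\<lambda>n. norm (y n * psi \<gamma> n \<omega>)) summable_on UNIV" for \<omega> by (rule bseries_abs_summable[of y, OF y])
  have sw: "(\<lambda>n. norm (w n * psi \<gamma> n \<omega>)) summable_on UNIV" for \<omega> by (rule bseries_abs_summable[of w, OF w])
  have sw': "(\<lambda>n. norm (cnj (w n * psi \<gamma> n \<omega>))) summable_on UNIV" for \<omega> using sw by (simp only: complex_mod_cnj)
  have "cnj (bseries w \<omega>) = (\<Sum>\<^sub>\<infinity>n\<in>UNIV. cnj (w n * psi \<gamma> n \<omega>))" for \<omega>
    unfolding bseries_def by (rule infsum_cnj[symmetric])
  then have tT: "((\<lambda>i. t i \<omega>) has_sum T \<omega>) UNIV" for \<omega>
    using abs_summable_prod3(2)[OF sx[of \<omega>] sy[of \<omega>] sw'[of \<omega>]]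
    by (simp add: t_def T_def bseries_def case_prod_beta' mult_ac)
  have tN: "(\<lambda>i. norm (t i \<omega>)) summable_on UNIV" for \<omega>
    using abs_summable_prod3(1)[OF sx[of \<omega>] sy[of \<omega>] sw'[of \<omega>]] by (simp add: t_def case_prod_beta')
  have tB: "(\<Sum>i\<in>F. norm (t i \<omega>)) \<le> B ^ 3" if "finite F" for F \<omega>
  proof -
    have n: "(\<lambda>n. norm (norm (f n))) summable_on UNIV \<longleftrightarrow> (\<lambda>n. norm (f n)) summable_on UNIV" for f :: "int \<Rightarrow> complex"
      by simp
    have "((\<lambda>(n, j, k). norm (w n * psi \<gamma> n \<omega>) * (norm (x j * psi \<gamma> j \<omega>) * norm (y k * psi \<gamma> k \<omega>))) has_sum
       ((\<Sum>\<^sub>\<infinity>n\<in>UNIV. norm (w n * psi \<gamma> n \<omega>)) * ((\<Sum>\<^sub>\<infinity>n\<in>UNIV. norm (x n * psi \<gamma> n \<omega>)) * (\<Sum>\<^sub>\<infinity>n\<in>UNIV. norm (y n * psi \<gamma> n \<omega>))))) UNIV"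
      by (rule abs_summable_prod3(2)) (simp_all only: n sx sy sw)
    then have "(\<Sum>\<^sub>\<infinity>i\<in>UNIV. norm (t i \<omega>)) = (\<Sum>\<^sub>\<infinity>n\<in>UNIV. norm (w n * psi \<gamma> n \<omega>)) * ((\<Sum>\<^sub>\<infinity>n\<in>UNIV. norm (x n * psi \<gamma> n \<omega>)) * (\<Sum>\<^sub>\<infinity>n\<in>UNIV. norm (y n * psi \<gamma> n \<omega>)))"
      by (intro infsumI) (simp add: t_def case_prod_beta' norm_mult)
    also have "\<dots> \<le> B * (B * B)"
      unfolding B_def
      by (intro mult_mono bseries_abs_bound x y w mult_nonneg_nonneg infsum_nonneg norm_ge_zero C0 psi_bound_nonneg)
    finally have "(\<Sum>\<^sub>\<infinity>i\<in>UNIV. norm (t i \<omega>)) \<le> B ^ 3" by (simp add: power3_eq_cube mult.assoc)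
    moreover have "(\<Sum>i\<in>F. norm (t i \<omega>)) \<le> (\<Sum>\<^sub>\<infinity>i\<in>UNIV. norm (t i \<omega>))"
      by (rule finite_sum_le_infsum[OF tN that]) auto
    ultimately show ?thesis by linarith
  qed
  \<comment> \<open>Passes from mode and differences (m, p, q) to (n, j, k); the inverse is m = j +
    k - n, p = n - k, q = n - j.\<close>
  define r :: "int \<times> int \<times> int \<Rightarrow> int \<times> int \<times> int" where "r = (\<lambda>(m, p, q). (m + p + q, m + p, m + q))"
  have r: "bij_betw r UNIV UNIV"
    by (rule bij_betwI[where g = "\<lambda>(n, j, k). (j + k - n, n - k, n - j)"]) (auto simp: r_def)
  define g where "g i \<omega> = Pkernel z \<omega> * t (r i) \<omega>" for i \<omega>
  have tcont: "continuous_on UNIV (t i)" for i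
    unfolding t_def by (cases i) (simp, intro continuous_intros continuous_psi)
  have gi: "integrable lborel (g i)" for i
  proof (rule integrable_bound_real[OF integrable_mult_left[of "B ^ 3", OF integrable_norm_Pkernel[of z]]])
    have "continuous_on UNIV (g i)" unfolding g_def by (intro continuous_intros continuous_Pkernel tcont)
    then show "g i \<in> borel_measurable lborel" using continuous_borel by simp
    show "norm (g i \<omega>) \<le> norm (Pkernel z \<omega>) * B ^ 3" for \<omega>
      unfolding g_def norm_mult using tB[of "{r i}" \<omega>] by (intro mult_left_mono) simp_all
  qed
  have gN: "(\<lambda>i. norm (g i \<omega>)) summable_on UNIV" for \<omega>
    unfolding g_def norm_mult
    by (rule summable_on_cmult_right) (simp only: summable_on_reindex_bij_betw[OF r, of "\<lambda>i. norm (t i \<omega>)"] tN)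
  have gS: "((\<lambda>i. g i \<omega>) has_sum Pkernel z \<omega> * T \<omega>) UNIV" for \<omega>
    unfolding g_def
    by (rule has_sum_cmult_right) (simp only: has_sum_reindex_bij_betw[OF r, of "\<lambda>i. t i \<omega>"] tT)
  then have gS': "(\<Sum>\<^sub>\<infinity>i\<in>UNIV. g i \<omega>) = Pkernel z \<omega> * T \<omega>" for \<omega> by (rule infsumI)
  have gI: "(\<lambda>i. LINT \<omega>|lborel. norm (g i \<omega>)) summable_on UNIV"
  proof (rule nonneg_bdd_above_summable_on)
    show "bdd_above (sum (\<lambda>i. LINT \<omega>|lborel. norm (g i \<omega>)) ` {F. F \<subseteq> UNIV \<and> finite F})"
    proof (rule bdd_aboveI2)
      fix F :: "(int \<times> int \<times> int) set" assume "F \<in> {F. F \<subseteq> UNIV \<and> finite F}"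
      then have F: "finite F" by simp
      have "(\<Sum>i\<in>F. LINT \<omega>|lborel. norm (g i \<omega>)) = (LINT \<omega>|lborel. (\<Sum>i\<in>F. norm (g i \<omega>)))"
        by (rule Bochner_Integration.integral_sum[symmetric]) (rule integrable_norm[OF gi])
      also have "\<dots> \<le> (LINT \<omega>|lborel. norm (Pkernel z \<omega>) * B ^ 3)"
      proof (rule integral_mono)
        show "integrable lborel (\<lambda>\<omega>. \<Sum>i\<in>F. norm (g i \<omega>))"
          by (rule Bochner_Integration.integrable_sum) (rule integrable_norm[OF gi])
        show "integrable lborel (\<lambda>\<omega>. norm (Pkernel z \<omega>) * B ^ 3)"
          by (rule integrable_mult_left[OF integrable_norm_Pkernel])
        fix \<omega>
        have inj: "inj_on r F" using r by (meson bij_betw_imp_inj_on inj_on_subset subset_UNIV)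
        have "(\<Sum>i\<in>F. norm (t (r i) \<omega>)) = (\<Sum>i\<in>r ` F. norm (t i \<omega>))"
          by (simp add: sum.reindex[OF inj])
        also have "\<dots> \<le> B ^ 3" by (rule tB) (simp add: F)
        finally show "(\<Sum>i\<in>F. norm (g i \<omega>)) \<le> norm (Pkernel z \<omega>) * B ^ 3"
          unfolding g_def norm_mult sum_distrib_left[symmetric] by (rule mult_left_mono) simp
      qed
      finally show "(\<Sum>i\<in>F. LINT \<omega>|lborel. norm (g i \<omega>)) \<le> (LINT \<omega>|lborel. norm (Pkernel z \<omega>) * B ^ 3)" .
    qed
  qed (simp add: integral_nonneg_AE)
  note HS = has_sum_integral[OF _ _ gi gN gI, unfolded gS']
  show "integrable lborel (\<lambda>\<omega>. Pkernel z \<omega> * T \<omega>)"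
    by (rule HS(1)) (auto simp: finite_prod infinite_UNIV_int)
  define \<alpha> where "\<alpha> = complex_of_real (1 / pi * exp (- (cmod z)\<^sup>2 / 2))"
  have Tcont: "continuous_on UNIV T"
    unfolding T_def by (intro continuous_intros continuous_bseries[of x, OF x] continuous_bseries[of y, OF y] continuous_bseries[of w, OF w])
  have "((\<lambda>i. CLINT \<omega>|lborel. g i \<omega>) has_sum (CLINT \<omega>|lborel. Pkernel z \<omega> * T \<omega>)) UNIV"
    by (rule HS(2)) (auto simp: finite_prod infinite_UNIV_int)
  from has_sum_cmult_right[OF this, of \<alpha>]
  have main: "((\<lambda>i. \<alpha> * (CLINT \<omega>|lborel. g i \<omega>)) has_sum Proj T z) UNIV"
    unfolding Proj_lborel[OF Tcont] \<alpha>_def .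
  have "\<alpha> * (CLINT \<omega>|lborel. g i \<omega>) = (\<lambda>(m, pq). cubic_coeff x y w m pq * psi \<gamma> m z) i" for i
  proof -
    obtain m p q where i: "i = (m, p, q)" by (cases i) auto
    have cont: "continuous_on UNIV (\<lambda>\<omega>. psi \<gamma> (m + p) \<omega> * psi \<gamma> (m + q) \<omega> * cnj (psi \<gamma> (m + p + q) \<omega>))"
      by (intro continuous_intros continuous_psi)
    have gx: "g i \<omega> = (x (m + p) * y (m + q) * cnj (w (m + p + q))) * (Pkernel z \<omega> * (psi \<gamma> (m + p) \<omega> * psi \<gamma> (m + q) \<omega> * cnj (psi \<gamma> (m + p + q) \<omega>)))" for \<omega>
      by (simp add: g_def t_def r_def i mult_ac)
    have "\<alpha> * (CLINT \<omega>|lborel. g i \<omega>) = (x (m + p) * y (m + q) * cnj (w (m + p + q))) *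
        (\<alpha> * (CLINT \<omega>|lborel. Pkernel z \<omega> * (psi \<gamma> (m + p) \<omega> * psi \<gamma> (m + q) \<omega> * cnj (psi \<gamma> (m + p + q) \<omega>))))"
      unfolding gx integral_mult_right_zero by (rule mult.left_commute)
    also have "\<alpha> * (CLINT \<omega>|lborel. Pkernel z \<omega> * (psi \<gamma> (m + p) \<omega> * psi \<gamma> (m + q) \<omega> * cnj (psi \<gamma> (m + p + q) \<omega>))) =
        Proj (\<lambda>\<omega>. psi \<gamma> (m + p) \<omega> * psi \<gamma> (m + q) \<omega> * cnj (psi \<gamma> (m + p + q) \<omega>)) z"
      unfolding \<alpha>_def by (rule Proj_lborel[OF cont, symmetric])
    also have "\<dots> = of_real (\<kappa> * gw \<gamma> p * gw \<gamma> q) * psi \<gamma> m z"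
      using Proj_triple[of "m + p" "m + q" "m + p + q" z] by simp
    finally show ?thesis by (simp add: i cubic_coeff_def mult_ac)
  qed
  then show "((\<lambda>(m, pq). cubic_coeff x y w m pq * psi \<gamma> m z) has_sum Proj T z) UNIV"
    using main by simp
qed

lemma kappa_pos: "\<kappa> > 0"
  using gamma_pos by (simp add: \<kappa>_def)

lemma gw_pair_summable: "(\<lambda>(p, q). norm (complex_of_real (gw \<gamma> p) * of_real (gw \<gamma> q))) summable_on UNIV"
  by (rule abs_summable_prod(1)) (rule norm_summable_gw, simp)+

definition gw_mass :: real where
  "gw_mass = (\<Sum>\<^sub>\<infinity>(p, q)\<in>UNIV. gw \<gamma> p * gw \<gamma> q)"

lemma gw_mass: "(\<lambda>(p, q). gw \<gamma> p * gw \<gamma> q) summable_on UNIV" "gw_mass \<ge> 0"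
proof -
  show "(\<lambda>(p, q). gw \<gamma> p * gw \<gamma> q) summable_on UNIV"
    using gw_pair_summable by (simp add: norm_mult abs_of_pos)
  show "gw_mass \<ge> 0" unfolding gw_mass_def by (rule infsum_nonneg) (auto simp: less_imp_le)
qed

lemma cubic_coeff_sum:
  assumes x: "\<And>n. norm (x n) \<le> C" and y: "\<And>n. norm (y n) \<le> C" and w: "\<And>n. norm (w n) \<le> C"
  shows "(\<lambda>pq. norm (cubic_coeff x y w m pq)) summable_on UNIV"
    and "norm (\<Sum>\<^sub>\<infinity>pq\<in>UNIV. cubic_coeff x y w m pq) \<le> \<kappa> * C ^ 3 * gw_mass"
proof -
  let ?g = "\<lambda>pq :: int \<times> int. \<kappa> * C ^ 3 * (case pq of (p, q) \<Rightarrow> gw \<gamma> p * gw \<gamma> q)"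
  have C0: "C \<ge> 0" by (rule order_trans[OF norm_ge_zero x])
  have le: "norm (cubic_coeff x y w m pq) \<le> ?g pq" for pq
  proof -
    obtain p q where pq: "pq = (p, q)" by fastforce
    have "norm (cubic_coeff x y w m pq) = \<kappa> * gw \<gamma> p * gw \<gamma> q * (norm (x (m + p)) * norm (y (m + q)) * norm (w (m + p + q)))"
      by (simp add: pq cubic_coeff_def norm_mult abs_of_pos[OF kappa_pos] abs_of_pos[OF gw_pos])
    also have "\<dots> \<le> \<kappa> * gw \<gamma> p * gw \<gamma> q * (C * C * C)"
    proof (rule mult_left_mono)
      show "norm (x (m + p)) * norm (y (m + q)) * norm (w (m + p + q)) \<le> C * C * C"
        by (intro mult_mono x y w mult_nonneg_nonneg norm_ge_zero C0)
      show "0 \<le> \<kappa> * gw \<gamma> p * gw \<gamma> q"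
        by (rule less_imp_le) (intro mult_pos_pos kappa_pos gw_pos)
    qed
    finally show ?thesis by (simp add: pq power3_eq_cube mult_ac)
  qed
  have s: "?g summable_on UNIV" by (rule summable_on_cmult_right[OF gw_mass(1)])
  show s': "(\<lambda>pq. norm (cubic_coeff x y w m pq)) summable_on UNIV"
    by (rule summable_on_comparison_test[OF s]) (use le in auto)
  have "norm (\<Sum>\<^sub>\<infinity>pq\<in>UNIV. cubic_coeff x y w m pq) \<le> (\<Sum>\<^sub>\<infinity>pq\<in>UNIV. norm (cubic_coeff x y w m pq))"
    by (rule norm_infsum_bound[OF s'])
  also have "\<dots> \<le> (\<Sum>\<^sub>\<infinity>pq\<in>UNIV. ?g pq)" by (rule infsum_mono[OF s' s le])
  also have "\<dots> = \<kappa> * C ^ 3 * gw_mass" unfolding gw_mass_def by (rule infsum_cmult_right')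
  finally show "norm (\<Sum>\<^sub>\<infinity>pq\<in>UNIV. cubic_coeff x y w m pq) \<le> \<kappa> * C ^ 3 * gw_mass" .
qed

lemma Proj_cubic:
  assumes x: "\<And>n. norm (x n) \<le> C" and y: "\<And>n. norm (y n) \<le> C" and w: "\<And>n. norm (w n) \<le> C"
  shows "Proj (\<lambda>\<omega>. bseries x \<omega> * bseries y \<omega> * cnj (bseries w \<omega>)) z = bseries (\<lambda>m. \<Sum>\<^sub>\<infinity>pq\<in>UNIV. cubic_coeff x y w m pq) z"
proof -
  define D where "D m = (\<Sum>\<^sub>\<infinity>pq\<in>UNIV. cubic_coeff x y w m pq)" for m
  have D: "norm (D m) \<le> \<kappa> * C ^ 3 * gw_mass" for m
    unfolding D_def by (rule cubic_coeff_sum(2)[of x C y w, OF x y w])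
  have h: "((\<lambda>(m, pq). cubic_coeff x y w m pq * psi \<gamma> m z) has_sum Proj (\<lambda>\<omega>. bseries x \<omega> * bseries y \<omega> * cnj (bseries w \<omega>)) z) (Sigma UNIV (\<lambda>_. UNIV))"
    using Proj_cubic_has_sum(2)[of x C y w z, OF x y w] by simp
  have "((\<lambda>m. D m * psi \<gamma> m z) has_sum Proj (\<lambda>\<omega>. bseries x \<omega> * bseries y \<omega> * cnj (bseries w \<omega>)) z) UNIV"
  proof (rule has_sum_SigmaD[OF h])
    fix m
    have "((\<lambda>pq. cubic_coeff x y w m pq * psi \<gamma> m z) has_sum D m * psi \<gamma> m z) UNIV"
      unfolding D_def
      by (rule has_sum_cmult_left[OF has_sum_infsum[OF abs_summable_summable[OF cubic_coeff_sum(1)[of x C y w, OF x y w]]]])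
    then show "((\<lambda>pq. case (m, pq) of (m, pq) \<Rightarrow> cubic_coeff x y w m pq * psi \<gamma> m z) has_sum D m * psi \<gamma> m z) UNIV"
      by simp
  qed
  from has_sum_unique[OF this bseries_has_sum[of D, OF D]] show ?thesis by (simp add: D_def[abs_def])
qed

section \<open>The linearized operator on coefficients\<close>

definition K0 :: real where
  "K0 = (pi * \<gamma>\<^sup>2 / 2) powr (1/4) * exp (pi\<^sup>2 / (4 * \<gamma>\<^sup>2))"

text \<open>Origin of the constant \<open>C_M\<close>: two factors \<open>Phi0\<close> contribute
  \<open>K0\<close> each, and the projection of a triple contributes \<kappa>.\<close>

lemma K0_sq_kappa: "K0\<^sup>2 * \<kappa> = C_M \<gamma>"
proof -
  have "((pi * \<gamma>\<^sup>2 / 2) powr (1/4))\<^sup>2 = (pi * \<gamma>\<^sup>2 / 2) powr (1/2)"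
    unfolding power2_eq_square[of "_ powr _"] powr_add[symmetric] by simp
  also have "\<dots> = sqrt (pi * \<gamma>\<^sup>2 / 2)" using gamma_pos by (simp add: powr_half_sqrt)
  also have "\<dots> = sqrt pi * \<gamma> / sqrt 2" using gamma_pos by (simp add: real_sqrt_divide real_sqrt_mult)
  finally have 1: "((pi * \<gamma>\<^sup>2 / 2) powr (1/4))\<^sup>2 = sqrt pi * \<gamma> / sqrt 2" .
  have 2: "(exp (pi\<^sup>2 / (4 * \<gamma>\<^sup>2)))\<^sup>2 = exp (pi\<^sup>2 / (2 * \<gamma>\<^sup>2))"
    unfolding exp_double[symmetric] by (simp add: field_simps)
  show ?thesis
    unfolding K0_def power_mult_distrib 1 2 using gamma_pos by (simp add: \<kappa>_def C_M_def)
qed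

lemma Phi0_bseries: "Phi0 \<gamma> z = bseries (\<lambda>_. of_real K0) z"
  unfolding Phi0_def bseries_def K0_def[symmetric] by (rule infsum_cmult_right'[symmetric])

text \<open>The right-hand side of the equation in coefficients. In the term with the squared
  modulus of \<open>Phi0\<close> the unknown sits at index k = m + q; in the term with its conjugate
  it sits at n = m + p + q.\<close>

definition lin :: "(int \<Rightarrow> complex) \<Rightarrow> int \<Rightarrow> complex" where
  "lin c m = (\<Sum>\<^sub>\<infinity>(p, q)\<in>UNIV. of_real (C_M \<gamma> * gw \<gamma> p * gw \<gamma> q) * (2 * c (m + q) + cnj (c (m + p + q))))"

lemma lin_cubic:
  assumes c: "\<And>n. norm (c n) \<le> C"
  shows "lin c m = (\<Sum>\<^sub>\<infinity>pq\<in>UNIV. cubic_coeff (\<lambda>_. 2 * of_real K0) c (\<lambda>_. of_real K0) m pq) +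
     (\<Sum>\<^sub>\<infinity>pq\<in>UNIV. cubic_coeff (\<lambda>_. of_real K0) (\<lambda>_. of_real K0) c m pq)"
proof -
  define C' where "C' = max C (2 * \<bar>K0\<bar>)"
  have b: "norm (c n) \<le> C'" "norm (2 * complex_of_real K0) \<le> C'" "norm (complex_of_real K0) \<le> C'" for n
    using c[of n] by (auto simp: C'_def norm_mult)
  have s1: "cubic_coeff (\<lambda>_. 2 * of_real K0) c (\<lambda>_. of_real K0) m summable_on UNIV"
    by (rule abs_summable_summable, rule cubic_coeff_sum(1)[of _ C']) (rule b)+
  have s2: "cubic_coeff (\<lambda>_. of_real K0) (\<lambda>_. of_real K0) c m summable_on UNIV"
    by (rule abs_summable_summable, rule cubic_coeff_sum(1)[of _ C']) (rule b)+
  have "(\<lambda>(p, q). of_real (C_M \<gamma> * gw \<gamma> p * gw \<gamma> q) * (2 * c (m + q) + cnj (c (m + p + q)))) =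
     (\<lambda>pq. cubic_coeff (\<lambda>_. 2 * of_real K0) c (\<lambda>_. of_real K0) m pq + cubic_coeff (\<lambda>_. of_real K0) (\<lambda>_. of_real K0) c m pq)"
    by (auto simp: fun_eq_iff cubic_coeff_def power2_eq_square algebra_simps simp flip: K0_sq_kappa)
  then show ?thesis unfolding lin_def by (simp only: infsum_add[OF s1 s2])
qed

lemma lin_term_bound:
  assumes c: "\<And>n. norm (c n) \<le> C"
  shows "norm (case pq of (p, q) \<Rightarrow> of_real (C_M \<gamma> * gw \<gamma> p * gw \<gamma> q) * (2 * c (m + q) + cnj (c (m + p + q)))) \<le>
      3 * C_M \<gamma> * C * (case pq of (p, q) \<Rightarrow> gw \<gamma> p * gw \<gamma> q)"
proof -
  obtain p q where pq: "pq = (p, q)" by fastforce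
  have "norm (2 * c (m + q) + cnj (c (m + p + q))) \<le> 2 * norm (c (m + q)) + norm (c (m + p + q))"
    using norm_triangle_ineq[of "2 * c (m + q)" "cnj (c (m + p + q))"] by (simp add: norm_mult)
  also have "\<dots> \<le> 3 * C" using c[of "m + q"] c[of "m + p + q"] by simp
  finally have "C_M \<gamma> * gw \<gamma> p * gw \<gamma> q * norm (2 * c (m + q) + cnj (c (m + p + q))) \<le> C_M \<gamma> * gw \<gamma> p * gw \<gamma> q * (3 * C)"
    by (rule mult_left_mono) (rule less_imp_le, intro mult_pos_pos C_M_pos gw_pos)
  then show ?thesis
    by (simp add: pq norm_mult abs_of_pos[OF C_M_pos] abs_of_pos[OF gw_pos] mult_ac)
qed

lemma lin_abs_summable:
  assumes c: "\<And>n. norm (c n) \<le> C"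
  shows "(\<lambda>pq. norm (case pq of (p, q) \<Rightarrow> of_real (C_M \<gamma> * gw \<gamma> p * gw \<gamma> q) * (2 * c (m + q) + cnj (c (m + p + q))))) summable_on UNIV"
  by (rule summable_on_comparison_test[OF summable_on_cmult_right[OF gw_mass(1)]])
     (rule lin_term_bound[of c C, OF c], simp)

lemma lin_has_sum:
  assumes c: "\<And>n. norm (c n) \<le> C"
  shows "((\<lambda>(p, q). of_real (C_M \<gamma> * gw \<gamma> p * gw \<gamma> q) * (2 * c (m + q) + cnj (c (m + p + q)))) has_sum lin c m) UNIV"
  unfolding lin_def by (rule has_sum_infsum[OF abs_summable_summable[OF lin_abs_summable[of c C, OF c]]])

text \<open>In the supremum norm the convolution is bounded by the total mass of its weights; the
  uniqueness argument runs in this norm.\<close>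

lemma lin_bound:
  assumes c: "\<And>n. norm (c n) \<le> C"
  shows "norm (lin c m) \<le> 3 * C_M \<gamma> * gw_mass * C"
proof -
  note s' = lin_abs_summable[of c C m, OF c]
  have "norm (lin c m) \<le> (\<Sum>\<^sub>\<infinity>pq\<in>UNIV. norm (case pq of (p, q) \<Rightarrow> of_real (C_M \<gamma> * gw \<gamma> p * gw \<gamma> q) * (2 * c (m + q) + cnj (c (m + p + q)))))"
    unfolding lin_def by (rule norm_infsum_bound[OF s'])
  also have "\<dots> \<le> (\<Sum>\<^sub>\<infinity>pq\<in>UNIV. 3 * C_M \<gamma> * C * (case pq of (p, q) \<Rightarrow> gw \<gamma> p * gw \<gamma> q))"
    by (rule infsum_mono[OF s' summable_on_cmult_right[OF gw_mass(1)] lin_term_bound[of c C, OF c]])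
  also have "\<dots> = 3 * C_M \<gamma> * C * gw_mass" unfolding gw_mass_def by (rule infsum_cmult_right')
  finally show ?thesis by (simp add: mult_ac)
qed

lemma bseries_add:
  assumes c: "\<And>n. norm (c n) \<le> C" and d: "\<And>n. norm (d n) \<le> D"
  shows "bseries c z + bseries d z = bseries (\<lambda>n. c n + d n) z"
  using has_sum_add[OF bseries_has_sum[of c C z, OF c] bseries_has_sum[of d D z, OF d]]
  unfolding bseries_def[of "\<lambda>n. c n + d n"] by (simp add: infsumI distrib_right)

lemma bseries_cmult: "bseries (\<lambda>n. a * c n) z = a * bseries c z"
  unfolding bseries_def mult.assoc by (rule infsum_cmult_right')

lemma Proj_linearized:
  assumes c: "\<And>n. norm (c n) \<le> C"
  shows "Proj (\<lambda>w. 2 * of_real ((cmod (Phi0 \<gamma> w))\<^sup>2) * bseries c w + (Phi0 \<gamma> w)\<^sup>2 * cnj (bseries c w)) z = bseries (lin c) z"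
proof -
  define C' where "C' = max C (2 * \<bar>K0\<bar>)"
  have b: "norm (c n) \<le> C'" "norm (2 * complex_of_real K0) \<le> C'" "norm (complex_of_real K0) \<le> C'" for n
    using c[of n] by (auto simp: C'_def norm_mult)
  define T1 where "T1 w = bseries (\<lambda>_. 2 * of_real K0) w * bseries c w * cnj (bseries (\<lambda>_. of_real K0) w)" for w
  define T2 where "T2 w = bseries (\<lambda>_. of_real K0) w * bseries (\<lambda>_. of_real K0) w * cnj (bseries c w)" for w
  have cb: "continuous_on UNIV (bseries c)" "continuous_on UNIV (bseries (\<lambda>_. 2 * of_real K0))" "continuous_on UNIV (bseries (\<lambda>_. of_real K0))"
    by (rule continuous_bseries[of _ C'], rule b)+
  have cont: "continuous_on UNIV T1" "continuous_on UNIV T2"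
    unfolding T1_def T2_def by (intro continuous_intros cb)+
  have i1: "integrable lborel (\<lambda>w. Pkernel z w * T1 w)"
    unfolding T1_def by (rule Proj_cubic_has_sum(1)[of _ C']) (rule b)+
  have i2: "integrable lborel (\<lambda>w. Pkernel z w * T2 w)"
    unfolding T2_def by (rule Proj_cubic_has_sum(1)[of _ C']) (rule b)+
  have eq: "2 * of_real ((cmod (Phi0 \<gamma> w))\<^sup>2) * bseries c w + (Phi0 \<gamma> w)\<^sup>2 * cnj (bseries c w) = T1 w + T2 w" for w
  proof -
    have "complex_of_real ((cmod \<Phi>)\<^sup>2) = \<Phi> * cnj \<Phi>" for \<Phi> by (rule complex_norm_square)
    then show ?thesis
      unfolding Phi0_bseries T1_def T2_def bseries_cmult power2_eq_square[of "bseries _ _"] by (simp only: mult_ac)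
  qed
  have "Proj (\<lambda>w. T1 w + T2 w) z = Proj T1 z + Proj T2 z"
    unfolding Proj_lborel[OF cont(1)] Proj_lborel[OF cont(2)] Proj_lborel[OF continuous_on_add[OF cont]]
    using i1 i2 by (simp add: distrib_left)
  also have "Proj T1 z = bseries (\<lambda>m. \<Sum>\<^sub>\<infinity>pq\<in>UNIV. cubic_coeff (\<lambda>_. 2 * of_real K0) c (\<lambda>_. of_real K0) m pq) z"
    unfolding T1_def by (rule Proj_cubic[of _ C']) (rule b)+
  also have "Proj T2 z = bseries (\<lambda>m. \<Sum>\<^sub>\<infinity>pq\<in>UNIV. cubic_coeff (\<lambda>_. of_real K0) (\<lambda>_. of_real K0) c m pq) z"
    unfolding T2_def by (rule Proj_cubic[of _ C']) (rule b)+
  also have "bseries (\<lambda>m. \<Sum>\<^sub>\<infinity>pq\<in>UNIV. cubic_coeff (\<lambda>_. 2 * of_real K0) c (\<lambda>_. of_real K0) m pq) z +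
     bseries (\<lambda>m. \<Sum>\<^sub>\<infinity>pq\<in>UNIV. cubic_coeff (\<lambda>_. of_real K0) (\<lambda>_. of_real K0) c m pq) z = bseries (lin c) z"
    unfolding lin_cubic[of c, OF c]
    by (rule bseries_add) (rule cubic_coeff_sum(2)[of _ C'], (rule b)+)+
  finally show ?thesis unfolding eq .
qed

end

section \<open>The equation on the Fourier side\<close>

lemma (in orthonormal_family) expansion_quotient:
  assumes "L2_expansion M e cs us" "L2_expansion M e ct ut" "L2_expansion M e d w"
  shows "L2_expansion M e (\<lambda>n. of_real r * cs n - of_real r * ct n - d n) (\<lambda>x. r *\<^sub>R (us x - ut x) - w x)"
proof -
  have "L2_expansion M e (\<lambda>n. of_real r * cs n + - of_real r * ct n) (\<lambda>x. of_real r * us x + - of_real r * ut x)"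
    by (rule expansion_lincomb[OF assms(1,2)])
  from expansion_lincomb[OF this assms(3), of 1 "-1"] show ?thesis
    by (simp add: scaleR_conv_of_real right_diff_distrib)
qed

lemma borel_measurable_vector_2:
  assumes "g \<in> borel_measurable M" "h \<in> borel_measurable M"
  shows "(\<lambda>x. vector [g x, h x] :: complex^2) \<in> borel_measurable M"
proof -
  have eq: "(vector [a, b] :: complex^2) = (\<chi> i. if i = 1 then a else b)" for a b
    by (simp add: vec_eq_iff forall_2)
  have "continuous_on UNIV (\<lambda>p :: complex \<times> complex. (\<chi> i. if i = 1 then fst p else snd p) :: complex^2)"
    unfolding continuous_on_def
  proof (intro ballI tendsto_vec_lambda)
    fix x :: "complex \<times> complex" and i :: 2
    show "((\<lambda>p. if i = 1 then fst p else snd p) \<longlongrightarrow> (if i = 1 then fst x else snd x)) (at x within UNIV)"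
      by (cases "i = 1") (simp_all add: tendsto_fst[OF tendsto_ident_at] tendsto_snd[OF tendsto_ident_at])
  qed
  then have cm: "(\<lambda>p :: complex \<times> complex. (\<chi> i. if i = 1 then fst p else snd p) :: complex^2) \<in> borel_measurable borel"
    by (rule borel_measurable_continuous_onI)
  have "(\<lambda>x. (g x, h x)) \<in> borel_measurable M"
    using assms by (rule borel_measurable_Pair)
  from measurable_compose[OF this cm] show ?thesis unfolding eq fst_conv snd_conv .
qed

lemma norm_conj_pair: "(norm (conj_pair g \<xi>))\<^sup>2 = (norm (g \<xi>))\<^sup>2 + (norm (cnj (g (- \<xi>))))\<^sup>2"
  by (simp add: norm_vec_def L2_set_def sum_2 conj_pair_def)

text \<open>Reflection and conjugation preserve the norm, so the second entry contributes as much as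
  the first. Convergence of pairs in L2 is thus equivalent to convergence of the functions.\<close>

lemma conj_pair_L2:
  assumes per: "\<And>\<xi>. g (\<xi> + 1) = g \<xi>" and g: "square_integrable period g"
  shows "square_integrable period (conj_pair g)" "L2norm period (conj_pair g) = sqrt 2 * L2norm period g"
proof -
  note r = reflect_period[of g, OF per g]
  note c = square_integrable_cnj[OF r(1)]
  have i: "integrable period (\<lambda>\<xi>. (norm (g \<xi>))\<^sup>2)" "integrable period (\<lambda>\<xi>. (norm (cnj (g (- \<xi>))))\<^sup>2)"
    using g c by (simp_all add: square_integrable_def)
  have "conj_pair g \<in> borel_measurable period"
    unfolding conj_pair_def[abs_def]
    by (rule borel_measurable_vector_2) (use g c in \<open>simp_all only: square_integrable_def\<close>)
  then show "square_integrable period (conj_pair g)"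
    unfolding square_integrable_def norm_conj_pair using i by (simp del: complex_mod_cnj)
  have "(L2norm period (conj_pair g))\<^sup>2 = (L2norm period g)\<^sup>2 + (L2norm period (\<lambda>\<xi>. cnj (g (- \<xi>))))\<^sup>2"
    unfolding L2norm_sq norm_conj_pair by (rule Bochner_Integration.integral_add[OF i])
  also have "\<dots> = 2 * (L2norm period g)\<^sup>2" unfolding L2norm_cnj r(2) by simp
  finally have "(L2norm period (conj_pair g))\<^sup>2 = (sqrt 2 * L2norm period g)\<^sup>2" by (simp add: power_mult_distrib)
  then show "L2norm period (conj_pair g) = sqrt 2 * L2norm period g"
    by (simp add: L2norm_nonneg)
qed

lemma conj_pair_quotient:
  "(conj_pair g \<xi> - conj_pair h \<xi>) /\<^sub>R r - conj_pair k \<xi> = conj_pair (\<lambda>\<xi>. (g \<xi> - h \<xi>) /\<^sub>R r - k \<xi>) \<xi>"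
  by (simp add: conj_pair_def vec_eq_iff forall_2)

lemma L2_expansion_square_integrable: "L2_expansion M e c u \<Longrightarrow> square_integrable M u"
  by (simp add: L2_expansion_def)

lemma fchar_fun: "(\<lambda>n \<xi>. exp (- 2 * of_real pi * \<i> * of_int n * of_real \<xi>)) = fchar"
  by (simp add: fun_eq_iff fchar_def)

context rectangular_lattice
begin

text \<open>Where the entries of \<open>A_rect\<close> come from: shifting by q alone gives ell(0)
  ell(\<xi>), shifting by p + q gives the square of ell(\<xi>).\<close>

lemma ell_product_series:
  shows "(\<Sum>\<^sub>\<infinity>(p, q)\<in>UNIV. of_real (gw \<gamma> p * gw \<gamma> q) * fchar (- q) \<xi>) = of_real (ell \<gamma> 0 * ell \<gamma> \<xi>)"
    and "(\<Sum>\<^sub>\<infinity>(p, q)\<in>UNIV. of_real (gw \<gamma> p * gw \<gamma> q) * fchar (- (p + q)) \<xi>) = of_real (ell \<gamma> \<xi> * ell \<gamma> \<xi>)"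
proof -
  have s: "(\<lambda>p. norm (of_real (gw \<gamma> p) * fchar p \<eta>)) summable_on UNIV" for \<eta>
    using norm_summable_gw[of \<gamma>] by (simp add: norm_mult)
  have 1: "(\<Sum>\<^sub>\<infinity>(p, q)\<in>UNIV. (of_real (gw \<gamma> p) * fchar p 0) * (of_real (gw \<gamma> q) * fchar q (- \<xi>))) = of_real (ell \<gamma> 0 * ell \<gamma> (- \<xi>))"
    using abs_summable_prod(2)[OF s[of 0] s[of "- \<xi>"]] by (intro infsumI) (simp add: ell_infsum)
  then show "(\<Sum>\<^sub>\<infinity>(p, q)\<in>UNIV. of_real (gw \<gamma> p * gw \<gamma> q) * fchar (- q) \<xi>) = of_real (ell \<gamma> 0 * ell \<gamma> \<xi>)"
    by (simp add: ell_minus fchar_minus mult.assoc)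
  have 2: "(\<Sum>\<^sub>\<infinity>(p, q)\<in>UNIV. (of_real (gw \<gamma> p) * fchar p (- \<xi>)) * (of_real (gw \<gamma> q) * fchar q (- \<xi>))) = of_real (ell \<gamma> (- \<xi>) * ell \<gamma> (- \<xi>))"
    using abs_summable_prod(2)[OF s[of "- \<xi>"] s[of "- \<xi>"]] by (intro infsumI) (simp add: ell_infsum)
  have "of_real (gw \<gamma> p * gw \<gamma> q) * fchar (- (p + q)) \<xi> = (of_real (gw \<gamma> p) * fchar p (- \<xi>)) * (of_real (gw \<gamma> q) * fchar q (- \<xi>))" for p q
    using fchar_add[of "- p" "- q" \<xi>] by (simp add: fchar_minus mult_ac)
  then show "(\<Sum>\<^sub>\<infinity>(p, q)\<in>UNIV. of_real (gw \<gamma> p * gw \<gamma> q) * fchar (- (p + q)) \<xi>) = of_real (ell \<gamma> \<xi> * ell \<gamma> \<xi>)"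
    using 2 by (simp only: ell_minus)
qed

text \<open>On the coefficients \<open>c\<close> of \<open>v\<close> the evolution equation reads \<open>c' = gen c\<close>, on the function \<open>f\<close> with
  Fourier coefficients \<open>c\<close> it reads \<open>f' = fgen f\<close>.\<close>

definition gen :: "(int \<Rightarrow> complex) \<Rightarrow> int \<Rightarrow> complex" where
  "gen c n = - \<i> * (lin c n - of_real (lam \<gamma>) * c n)"

definition fgen :: "(real \<Rightarrow> complex) \<Rightarrow> real \<Rightarrow> complex" where
  "fgen f \<xi> = - \<i> * (of_real (a_rect \<gamma> \<xi>) * f \<xi> + of_real (b_rect \<gamma> \<xi>) * cnj (f (- \<xi>)))"

text \<open>Taking the coefficient at m + q is multiplication by the character of frequency -q, and
  the conjugated coefficients belong to the reflected conjugate of \<open>f\<close>; so the two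
  convolutions become multiplications by double series.\<close>

lemma lin_expansion:
  assumes per: "\<And>\<xi>. f (\<xi> + 1) = f \<xi>" and f: "L2_expansion period fchar c f"
  shows "L2_expansion period fchar (lin c)
    (\<lambda>\<xi>. of_real (2 * C_M \<gamma> * ell \<gamma> 0 * ell \<gamma> \<xi>) * f \<xi> + of_real (b_rect \<gamma> \<xi>) * cnj (f (- \<xi>)))"
proof -
  define g1 where "g1 = (\<lambda>(p :: int, q :: int). complex_of_real (2 * C_M \<gamma> * (gw \<gamma> p * gw \<gamma> q)))"
  define g2 where "g2 = (\<lambda>(p :: int, q :: int). complex_of_real (C_M \<gamma> * (gw \<gamma> p * gw \<gamma> q)))"
  define s1 where "s1 = (\<lambda>(p :: int, q :: int). - q)"
  define s2 where "s2 = (\<lambda>(p :: int, q :: int). - (p + q))"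
  have n1: "norm (g1 pq) = 2 * C_M \<gamma> * (case pq of (p, q) \<Rightarrow> gw \<gamma> p * gw \<gamma> q)" for pq
    by (cases pq) (simp add: g1_def norm_mult abs_of_pos[OF C_M_pos] abs_of_pos[OF gw_pos])
  have n2: "norm (g2 pq) = C_M \<gamma> * (case pq of (p, q) \<Rightarrow> gw \<gamma> p * gw \<gamma> q)" for pq
    by (cases pq) (simp add: g2_def norm_mult abs_of_pos[OF C_M_pos] abs_of_pos[OF gw_pos])
  have sm1: "(\<lambda>pq. norm (g1 pq)) summable_on UNIV" unfolding n1 by (rule summable_on_cmult_right[OF gw_mass(1)])
  have sm2: "(\<lambda>pq. norm (g2 pq)) summable_on UNIV" unfolding n2 by (rule summable_on_cmult_right[OF gw_mass(1)])
  have cnt: "countable (UNIV :: (int \<times> int) set)" "infinite (UNIV :: (int \<times> int) set)"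
    by (auto simp: finite_prod infinite_UNIV_int)
  note fc = expansion_cnj_reflect[of f c, OF per f]
  note sq = L2_expansion_square_integrable[OF f] L2_expansion_square_integrable[OF fc]
  have h1: "((\<lambda>pq. g1 pq * c (n - s1 pq)) has_sum (\<Sum>\<^sub>\<infinity>pq\<in>UNIV. g1 pq * c (n - s1 pq))) UNIV" for n
    using has_sum_imp_summable[OF coeff_infsum_mult[OF cnt sm1 sq(1), of n s1]]
    unfolding fourier.expansion_coeff[OF f] by (rule has_sum_infsum)
  have h2: "((\<lambda>pq. g2 pq * cnj (c (n - s2 pq))) has_sum (\<Sum>\<^sub>\<infinity>pq\<in>UNIV. g2 pq * cnj (c (n - s2 pq)))) UNIV" for n
    using has_sum_imp_summable[OF coeff_infsum_mult[OF cnt sm2 sq(2), of n s2]]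
    unfolding fourier.expansion_coeff[OF fc] by (rule has_sum_infsum)
  have F1: "(\<Sum>\<^sub>\<infinity>pq\<in>UNIV. g1 pq * fchar (s1 pq) \<xi>) = of_real (2 * C_M \<gamma> * ell \<gamma> 0 * ell \<gamma> \<xi>)" for \<xi>
  proof -
    have "(\<Sum>\<^sub>\<infinity>pq\<in>UNIV. g1 pq * fchar (s1 pq) \<xi>) = (\<Sum>\<^sub>\<infinity>pq\<in>UNIV. of_real (2 * C_M \<gamma>) * (case pq of (p, q) \<Rightarrow> of_real (gw \<gamma> p * gw \<gamma> q) * fchar (- q) \<xi>))"
      by (rule infsum_cong) (auto simp: g1_def s1_def)
    also have "\<dots> = of_real (2 * C_M \<gamma>) * of_real (ell \<gamma> 0 * ell \<gamma> \<xi>)"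
      unfolding infsum_cmult_right' ell_product_series(1) ..
    finally show ?thesis by simp
  qed
  have F2: "(\<Sum>\<^sub>\<infinity>pq\<in>UNIV. g2 pq * fchar (s2 pq) \<xi>) = of_real (b_rect \<gamma> \<xi>)" for \<xi>
  proof -
    have "(\<Sum>\<^sub>\<infinity>pq\<in>UNIV. g2 pq * fchar (s2 pq) \<xi>) = (\<Sum>\<^sub>\<infinity>pq\<in>UNIV. of_real (C_M \<gamma>) * (case pq of (p, q) \<Rightarrow> of_real (gw \<gamma> p * gw \<gamma> q) * fchar (- (p + q)) \<xi>))"
      by (rule infsum_cong) (auto simp: g2_def s2_def)
    also have "\<dots> = of_real (C_M \<gamma>) * of_real (ell \<gamma> \<xi> * ell \<gamma> \<xi>)"
      unfolding infsum_cmult_right' ell_product_series(2) ..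
    finally show ?thesis by (simp add: b_rect_def power2_eq_square)
  qed
  have L: "(\<Sum>\<^sub>\<infinity>pq\<in>UNIV. g1 pq * c (n - s1 pq)) + (\<Sum>\<^sub>\<infinity>pq\<in>UNIV. g2 pq * cnj (c (n - s2 pq))) = lin c n" for n
  proof -
    have "(\<lambda>pq. g1 pq * c (n - s1 pq) + g2 pq * cnj (c (n - s2 pq))) =
       (\<lambda>(p, q). of_real (C_M \<gamma> * gw \<gamma> p * gw \<gamma> q) * (2 * c (n + q) + cnj (c (n + p + q))))"
      by (auto simp: fun_eq_iff g1_def g2_def s1_def s2_def algebra_simps)
    with has_sum_add[OF h1[of n] h2[of n]] show ?thesis unfolding lin_def by (simp only: infsumI)
  qed
  from fourier.expansion_lincomb[OF expansion_infsum_mult[OF cnt sm1 f, of s1] expansion_infsum_mult[OF cnt sm2 fc, of s2], of 1 1]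
  show ?thesis unfolding F1 F2 mult_1_left L .
qed

lemma gen_expansion:
  assumes per: "\<And>\<xi>. f (\<xi> + 1) = f \<xi>" and f: "L2_expansion period fchar c f"
  shows "L2_expansion period fchar (gen c) (fgen f)"
proof -
  \<comment> \<open>Subtracting \<lambda>, which is \<open>C_M\<close> times the square of ell(0),
    from the diagonal multiplier leaves \<open>a_rect\<close>.\<close>
  have a: "a_rect \<gamma> \<xi> = 2 * C_M \<gamma> * ell \<gamma> 0 * ell \<gamma> \<xi> - lam \<gamma>" for \<xi>
    by (simp add: a_rect_def lam_def power2_eq_square algebra_simps)
  have "fgen f = (\<lambda>\<xi>. - \<i> * (of_real (2 * C_M \<gamma> * ell \<gamma> 0 * ell \<gamma> \<xi>) * f \<xi> + of_real (b_rect \<gamma> \<xi>) * cnj (f (- \<xi>))) + \<i> * of_real (lam \<gamma>) * f \<xi>)"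
    by (simp add: fun_eq_iff fgen_def a algebra_simps)
  moreover have "gen c = (\<lambda>n. - \<i> * lin c n + \<i> * of_real (lam \<gamma>) * c n)"
    by (simp add: fun_eq_iff gen_def algebra_simps)
  ultimately show ?thesis
    using fourier.expansion_lincomb[OF lin_expansion[of f c, OF per f] f, of "- \<i>" "\<i> * of_real (lam \<gamma>)"] by simp
qed

lemma a_rect_periodic: "a_rect \<gamma> (\<xi> + 1) = a_rect \<gamma> \<xi>" and b_rect_periodic: "b_rect \<gamma> (\<xi> + 1) = b_rect \<gamma> \<xi>"
  by (simp_all add: a_rect_def b_rect_def ell_plus_1)

lemma a_rect_minus: "a_rect \<gamma> (- \<xi>) = a_rect \<gamma> \<xi>" and b_rect_minus: "b_rect \<gamma> (- \<xi>) = b_rect \<gamma> \<xi>"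
  by (simp_all add: a_rect_def b_rect_def ell_minus)

lemma fgen_periodic:
  assumes per: "\<And>\<xi>. f (\<xi> + 1) = f \<xi>"
  shows "fgen f (\<xi> + 1) = fgen f \<xi>"
  using per[of \<xi>] per[of "- \<xi> - 1"] by (simp add: fgen_def a_rect_periodic b_rect_periodic)

lemma gen_bound:
  assumes "\<And>n. norm (c n) \<le> C"
  shows "norm (gen c n) \<le> (3 * C_M \<gamma> * gw_mass + \<bar>lam \<gamma>\<bar>) * C"
proof -
  have "norm (gen c n) \<le> norm (lin c n) + norm (of_real (lam \<gamma>) * c n)"
    using norm_triangle_ineq4[of "lin c n" "of_real (lam \<gamma>) * c n"] by (simp add: gen_def norm_mult)
  also have "\<dots> \<le> 3 * C_M \<gamma> * gw_mass * C + \<bar>lam \<gamma>\<bar> * C"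
    using assms[of n] by (intro add_mono lin_bound assms) (simp add: norm_mult mult_left_mono)
  finally show ?thesis by (simp add: algebra_simps)
qed

text \<open>The equation determines the time derivative at every point, so the quantified
  \<open>v'\<close> of \<open>solves_linearized\<close> can be eliminated.\<close>

lemma linearized_iff:
  assumes c: "\<And>n. norm (c n) \<le> C"
  shows "(\<forall>z. \<i> * v' z + of_real (lam \<gamma>) * bseries c z =
      Proj (\<lambda>w. 2 * of_real ((cmod (Phi0 \<gamma> w))\<^sup>2) * bseries c w + (Phi0 \<gamma> w)\<^sup>2 * cnj (bseries c w)) z) \<longleftrightarrow>
    v' = bseries (gen c)"
proof -
  have "bseries (gen c) z = - \<i> * (bseries (lin c) z - of_real (lam \<gamma>) * bseries c z)" for z
  proof -
    have l: "norm (- \<i> * lin c n) \<le> 3 * C_M \<gamma> * gw_mass * C" for n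
      using lin_bound[of c C n, OF c] by (simp add: norm_mult)
    have d: "norm (\<i> * of_real (lam \<gamma>) * c n) \<le> \<bar>lam \<gamma>\<bar> * C" for n
      using c[of n] by (simp add: norm_mult mult_left_mono)
    have g: "gen c = (\<lambda>n. - \<i> * lin c n + \<i> * of_real (lam \<gamma>) * c n)"
      by (simp add: fun_eq_iff gen_def algebra_simps)
    show ?thesis
      unfolding g bseries_add[of "\<lambda>n. - \<i> * lin c n" _ "\<lambda>n. \<i> * of_real (lam \<gamma>) * c n", OF l d, symmetric] bseries_cmult
      by (simp add: algebra_simps)
  qed
  then have "\<i> * v' z + of_real (lam \<gamma>) * bseries c z = bseries (lin c) z \<longleftrightarrow> v' z = bseries (gen c) z" for z
    by (auto simp: complex_eq_iff)
  then show ?thesis unfolding Proj_linearized[of c, OF c] by (auto simp: fun_eq_iff)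
qed

text \<open>a and b are real and even, so after division by i the second row produces at \<xi> the
  conjugate of what the first produces at -\<xi>; hence the derivative is again a conjugate
  pair.\<close>

lemma fgen_matrix:
  "\<i> *s w = A_rect \<gamma> \<xi> *v conj_pair f \<xi> \<longleftrightarrow> w = conj_pair (fgen f) \<xi>"
proof -
  have i: "\<i> * x = y \<longleftrightarrow> x = - \<i> * y" for x y by (auto simp: complex_eq_iff)
  show ?thesis
    by (simp add: vec_eq_iff forall_2 matrix_vector_mult_def sum_2 A_rect_def conj_pair_def fgen_def
        a_rect_minus b_rect_minus i)
       (auto simp: algebra_simps)
qed

lemma solves_linearized_coeffs:
  assumes v: "\<And>t. t \<in> T \<Longrightarrow> v t \<in> L2F \<gamma>"
  shows "solves_linearized \<gamma> T v \<longleftrightarrow> (\<forall>t\<in>T. bseries (gen (coef (v t))) \<in> L2F \<gamma> \<and>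
     has_L2_derivative (lebesgue_on (strip \<gamma>)) v (bseries (gen (coef (v t)))) t T)"
proof -
  have "(\<exists>v'\<in>L2F \<gamma>. has_L2_derivative (lebesgue_on (strip \<gamma>)) v v' t T \<and>
        (\<forall>z. \<i> * v' z + of_real (lam \<gamma>) * v t z =
             Proj (\<lambda>w. 2 * of_real ((cmod (Phi0 \<gamma> w))\<^sup>2) * v t w + (Phi0 \<gamma> w)\<^sup>2 * cnj (v t w)) z)) \<longleftrightarrow>
     bseries (gen (coef (v t))) \<in> L2F \<gamma> \<and> has_L2_derivative (lebesgue_on (strip \<gamma>)) v (bseries (gen (coef (v t)))) t T"
    if t: "t \<in> T" for t
  proof -
    have "(\<forall>z. \<i> * v' z + of_real (lam \<gamma>) * v t z =
             Proj (\<lambda>w. 2 * of_real ((cmod (Phi0 \<gamma> w))\<^sup>2) * v t w + (Phi0 \<gamma> w)\<^sup>2 * cnj (v t w)) z) \<longleftrightarrow> v' = bseries (gen (coef (v t)))" for v'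
      using linearized_iff[of "coef (v t)", OF coef_bounded[OF v[OF t]]]
      by (simp flip: L2F_eq_bseries[OF v[OF t]])
    then show ?thesis by auto
  qed
  then show ?thesis unfolding solves_linearized_def using v by auto
qed

text \<open>The derivative \<open>w'\<close> is fixed only almost everywhere, but L2 norms do not
  see the difference, so it may be replaced by the pair of \<open>fgen (f t)\<close>. The factor
  sqrt 2 between pair and function does not affect convergence to 0.\<close>

lemma solves_fourier_fgen:
  assumes per: "\<And>t \<xi>. t \<in> T \<Longrightarrow> f t (\<xi> + 1) = f t \<xi>" and sq: "\<And>t. t \<in> T \<Longrightarrow> square_integrable period (f t)"
    and sqg: "\<And>t. t \<in> T \<Longrightarrow> square_integrable period (fgen (f t))"
  shows "solves_fourier \<gamma> T f \<longleftrightarrow> (\<forall>t\<in>T. has_L2_derivative period f (fgen (f t)) t T)"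
proof -
  have "(\<exists>w'. has_L2_derivative period (\<lambda>s. conj_pair (f s)) w' t T \<and>
        (AE \<xi> in period. \<i> *s w' \<xi> = A_rect \<gamma> \<xi> *v conj_pair (f t) \<xi>)) \<longleftrightarrow> has_L2_derivative period f (fgen (f t)) t T"
    if t: "t \<in> T" for t
  proof -
    let ?w = "conj_pair (fgen (f t))"
    have pg: "fgen (f t) (\<xi> + 1) = fgen (f t) \<xi>" for \<xi> by (rule fgen_periodic[of "f t", OF per[OF t]])
    note sqw = conj_pair_L2(1)[of "fgen (f t)", OF pg sqg[OF t]]
    have sqc: "square_integrable period (conj_pair (f s))" if "s \<in> T" for s
      by (rule conj_pair_L2(1)[of "f s", OF per[OF that] sq[OF that]])
    have q: "L2norm period (\<lambda>x. (conj_pair (f s) x - conj_pair (f t) x) /\<^sub>R (s - t) - ?w x) =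
        sqrt 2 * L2norm period (\<lambda>x. (f s x - f t x) /\<^sub>R (s - t) - fgen (f t) x)" if s: "s \<in> T" for s
      unfolding conj_pair_quotient
      by (rule conj_pair_L2(2)) (simp add: per[OF s] per[OF t] pg,
          intro square_integrable_diff square_integrable_scaleR sq s t sqg)
    have ev: "\<forall>\<^sub>F s in at t within T. sqrt 2 * L2norm period (\<lambda>x. (f s x - f t x) /\<^sub>R (s - t) - fgen (f t) x) =
        L2norm period (\<lambda>x. (conj_pair (f s) x - conj_pair (f t) x) /\<^sub>R (s - t) - ?w x)"
      using q by (auto simp: eventually_at_filter)
    have scale: "((\<lambda>s. sqrt 2 * g s) \<longlongrightarrow> 0) F \<longleftrightarrow> (g \<longlongrightarrow> 0) F" for g :: "real \<Rightarrow> real" and F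
      using tendsto_mult_left_iff[of "sqrt 2" g 0 F] by simp
    have iff: "has_L2_derivative period (\<lambda>s. conj_pair (f s)) ?w t T \<longleftrightarrow> has_L2_derivative period f (fgen (f t)) t T"
      unfolding has_L2_derivative_def tendsto_cong[OF ev, symmetric] scale using sqw sqc sq sqg[OF t] by blast
    show ?thesis
    proof
      assume "has_L2_derivative period f (fgen (f t)) t T"
      then show "\<exists>w'. has_L2_derivative period (\<lambda>s. conj_pair (f s)) w' t T \<and>
        (AE \<xi> in period. \<i> *s w' \<xi> = A_rect \<gamma> \<xi> *v conj_pair (f t) \<xi>)"
        by (intro exI[of _ ?w]) (simp add: iff fgen_matrix)
    next
      assume "\<exists>w'. has_L2_derivative period (\<lambda>s. conj_pair (f s)) w' t T \<and>
        (AE \<xi> in period. \<i> *s w' \<xi> = A_rect \<gamma> \<xi> *v conj_pair (f t) \<xi>)"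
      then obtain w' where w': "has_L2_derivative period (\<lambda>s. conj_pair (f s)) w' t T"
        and ae: "AE \<xi> in period. w' \<xi> = ?w \<xi>" by (auto simp: fgen_matrix)
      have mw: "w' \<in> borel_measurable period" "?w \<in> borel_measurable period"
        using w' sqw by (simp_all add: has_L2_derivative_def square_integrable_def)
      have "L2norm period (\<lambda>x. (conj_pair (f s) x - conj_pair (f t) x) /\<^sub>R (s - t) - w' x) =
         L2norm period (\<lambda>x. (conj_pair (f s) x - conj_pair (f t) x) /\<^sub>R (s - t) - ?w x)" if s: "s \<in> T" for s
      proof (rule L2norm_cong_AE)
        have [measurable]: "conj_pair (f s) \<in> borel_measurable period" "conj_pair (f t) \<in> borel_measurable period"
          using sqc[OF s] sqc[OF t] by (simp_all add: square_integrable_def)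
        note [measurable] = mw
        show "(\<lambda>x. (conj_pair (f s) x - conj_pair (f t) x) /\<^sub>R (s - t) - w' x) \<in> borel_measurable period" by measurable
        show "(\<lambda>x. (conj_pair (f s) x - conj_pair (f t) x) /\<^sub>R (s - t) - ?w x) \<in> borel_measurable period" by measurable
        show "AE x in period. (conj_pair (f s) x - conj_pair (f t) x) /\<^sub>R (s - t) - w' x = (conj_pair (f s) x - conj_pair (f t) x) /\<^sub>R (s - t) - ?w x"
          using ae by eventually_elim simp
      qed
      then have "\<forall>\<^sub>F s in at t within T. L2norm period (\<lambda>x. (conj_pair (f s) x - conj_pair (f t) x) /\<^sub>R (s - t) - w' x) =
         L2norm period (\<lambda>x. (conj_pair (f s) x - conj_pair (f t) x) /\<^sub>R (s - t) - ?w x)"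
        by (auto simp: eventually_at_filter)
      with w' have "has_L2_derivative period (\<lambda>s. conj_pair (f s)) ?w t T"
        unfolding has_L2_derivative_def using sqw by (auto simp: tendsto_cong)
      then show "has_L2_derivative period f (fgen (f t)) t T" using iff by simp
    qed
  qed
  then show ?thesis unfolding solves_fourier_def by auto
qed

text \<open>Both sides reduce to the derivative being given by \<open>gen\<close>, respectively
  \<open>fgen\<close>. The residuals of the difference quotients have the same coefficients, hence
  the same norms. That \<open>gen (c t)\<close> is square-summable is read off on the Fourier side,
  where it is the coefficient sequence of \<open>fgen (f t)\<close>.\<close>

lemma linearized_fourier_equivalence:
  assumes v: "\<And>t. t \<in> T \<Longrightarrow> v t \<in> L2F \<gamma>"
    and vc: "\<And>t. t \<in> T \<Longrightarrow> L2_expansion (lebesgue_on (strip \<gamma>)) (psi \<gamma>) (c t) (v t)"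
    and per: "\<And>t \<xi>. t \<in> T \<Longrightarrow> f t (\<xi> + 1) = f t \<xi>"
    and fc: "\<And>t. t \<in> T \<Longrightarrow> L2_expansion period fchar (c t) (f t)"
  shows "solves_linearized \<gamma> T v \<longleftrightarrow> solves_fourier \<gamma> T f"
proof -
  have co: "coef (v t) = c t" if "t \<in> T" for t
    using psi.expansion_coeff[OF vc[OF that]] by (rule ext)
  have gf: "L2_expansion period fchar (gen (c t)) (fgen (f t))" if "t \<in> T" for t
    by (rule gen_expansion[of "f t", OF per[OF that] fc[OF that]])
  have gs: "(\<lambda>n. (norm (gen (c t) n))\<^sup>2) summable_on UNIV" if "t \<in> T" for t
    using fourier.expansion_Parseval[OF gf[OF that]] by (auto simp: summable_on_def)
  note gv = bseries_expansion[OF gs]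
  have n: "L2norm (lebesgue_on (strip \<gamma>)) (\<lambda>x. (v s x - v t x) /\<^sub>R (s - t) - bseries (gen (c t)) x) =
      L2norm period (\<lambda>x. (f s x - f t x) /\<^sub>R (s - t) - fgen (f t) x)" if "s \<in> T" "t \<in> T" for s t
    by (rule expansion_L2norm_eq[OF psi.orthonormal_family_axioms fourier.orthonormal_family_axioms
          psi.expansion_quotient[OF vc vc gv(2)] fourier.expansion_quotient[OF fc fc gf]]) (use that in auto)
  have "has_L2_derivative (lebesgue_on (strip \<gamma>)) v (bseries (gen (c t))) t T \<longleftrightarrow> has_L2_derivative period f (fgen (f t)) t T"
    if t: "t \<in> T" for t
  proof -
    have "\<forall>\<^sub>F s in at t within T. L2norm (lebesgue_on (strip \<gamma>)) (\<lambda>x. (v s x - v t x) /\<^sub>R (s - t) - bseries (gen (c t)) x) =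
      L2norm period (\<lambda>x. (f s x - f t x) /\<^sub>R (s - t) - fgen (f t) x)"
      using n t by (auto simp: eventually_at_filter)
    from tendsto_cong[OF this] show ?thesis
      unfolding has_L2_derivative_def
      using L2_expansion_square_integrable[OF vc] L2_expansion_square_integrable[OF fc]
        L2_expansion_square_integrable[OF gv(2)[OF t]] L2_expansion_square_integrable[OF gf[OF t]] by blast
  qed
  moreover have "solves_fourier \<gamma> T f \<longleftrightarrow> (\<forall>t\<in>T. has_L2_derivative period f (fgen (f t)) t T)"
    by (rule solves_fourier_fgen) (use per L2_expansion_square_integrable[OF fc] L2_expansion_square_integrable[OF gf] in auto)
  moreover have "solves_linearized \<gamma> T v \<longleftrightarrow> (\<forall>t\<in>T. bseries (gen (coef (v t))) \<in> L2F \<gamma> \<and>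
     has_L2_derivative (lebesgue_on (strip \<gamma>)) v (bseries (gen (coef (v t)))) t T)"
    by (rule solves_linearized_coeffs[OF v])
  ultimately show ?thesis using gv(1) by (simp add: co)
qed

end

section \<open>Instability\<close>

lemma has_L2_derivative_increment:
  fixes u :: "real \<Rightarrow> 'a \<Rightarrow> complex"
  assumes d: "has_L2_derivative M u u' t T" and s: "s \<in> T" and t: "t \<in> T"
  shows "L2norm M (\<lambda>x. u s x - u t x) \<le>
    \<bar>s - t\<bar> * (L2norm M (\<lambda>x. (u s x - u t x) /\<^sub>R (s - t) - u' x) + L2norm M u')"
proof (cases "s = t")
  case True
  then show ?thesis by (simp add: L2norm_def)
next
  case False
  have sq: "square_integrable M (u s)" "square_integrable M (u t)" "square_integrable M u'"
    using d s t by (simp_all add: has_L2_derivative_def)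
  let ?q = "\<lambda>x. (u s x - u t x) /\<^sub>R (s - t) - u' x"
  have q: "square_integrable M ?q"
    by (intro square_integrable_diff square_integrable_scaleR sq)
  have "(\<lambda>x. u s x - u t x) = (\<lambda>x. (s - t) *\<^sub>R (?q x + u' x))"
    using False by simp
  then have "L2norm M (\<lambda>x. u s x - u t x) = \<bar>s - t\<bar> * L2norm M (\<lambda>x. ?q x + u' x)"
    by (simp only: L2norm_scaleR)
  also have "\<dots> \<le> \<bar>s - t\<bar> * (L2norm M ?q + L2norm M u')"
    by (intro mult_left_mono L2norm_triangle q sq) simp
  finally show ?thesis .
qed

lemma L2norm_diff_le:
  fixes u v :: "'a \<Rightarrow> complex"
  assumes u: "square_integrable M u" and v: "square_integrable M v"
  shows "\<bar>L2norm M u - L2norm M v\<bar> \<le> L2norm M (\<lambda>x. u x - v x)"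
  using L2norm_triangle[OF square_integrable_diff[OF u v] v]
    L2norm_triangle[OF square_integrable_diff[OF v u] u] L2norm_minus_commute[of M u v] by simp

text \<open>Supplies a bound of the norm on compact time intervals, the starting point of the
  iteration in \<open>linearized_unique\<close>.\<close>

lemma has_L2_derivative_continuous_norm:
  fixes u :: "real \<Rightarrow> 'a \<Rightarrow> complex"
  assumes d: "\<And>t. t \<in> T \<Longrightarrow> \<exists>u'. has_L2_derivative M u u' t T"
  shows "continuous_on T (\<lambda>t. L2norm M (u t))"
  unfolding continuous_on_def
proof
  fix t assume t: "t \<in> T"
  obtain u' where u': "has_L2_derivative M u u' t T" using d[OF t] by blast
  have sq: "square_integrable M (u s)" if "s \<in> T" for s
    using u' that by (simp add: has_L2_derivative_def)
  let ?q = "\<lambda>s. L2norm M (\<lambda>x. (u s x - u t x) /\<^sub>R (s - t) - u' x)"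
  have "((\<lambda>s. \<bar>s - t\<bar> * (?q s + L2norm M u')) \<longlongrightarrow> \<bar>t - t\<bar> * (0 + L2norm M u')) (at t within T)"
    using u' unfolding has_L2_derivative_def by (intro tendsto_intros) auto
  then have lim: "((\<lambda>s. \<bar>s - t\<bar> * (?q s + L2norm M u')) \<longlongrightarrow> 0) (at t within T)" by simp
  have "\<bar>L2norm M (u s) - L2norm M (u t)\<bar> \<le> \<bar>s - t\<bar> * (?q s + L2norm M u')" if "s \<in> T" for s
    using L2norm_diff_le[OF sq[OF that] sq[OF t]] has_L2_derivative_increment[OF u' that t] by linarith
  then have "\<forall>\<^sub>F s in at t within T. norm (L2norm M (u s) - L2norm M (u t)) \<le> \<bar>s - t\<bar> * (?q s + L2norm M u')"
    by (auto simp: eventually_at_filter)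
  from Lim_null_comparison[OF this lim] show "((\<lambda>t. L2norm M (u t)) \<longlongrightarrow> L2norm M (u t)) (at t within T)"
    by (simp add: LIM_zero_iff)
qed

text \<open>A coefficient is a functional of norm at most 1, so the L2 residual of the difference
  quotient dominates that of each coefficient.\<close>

lemma (in orthonormal_family) coefficient_derivative:
  assumes d: "has_L2_derivative M u u' t T" and t: "t \<in> T"
  shows "((\<lambda>s. ip M (u s) (e n)) has_vector_derivative ip M u' (e n)) (at t within T)"
proof -
  have sq': "square_integrable M u'" and sqs: "\<And>s. s \<in> T \<Longrightarrow> square_integrable M (u s)"
    and lim: "((\<lambda>s. L2norm M (\<lambda>x. (u s x - u t x) /\<^sub>R (s - t) - u' x)) \<longlongrightarrow> 0) (at t within T)"
    using d by (simp_all add: has_L2_derivative_def)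
  have b: "norm ((1 / norm (s - t)) *\<^sub>R (ip M (u s) (e n) - (ip M (u t) (e n) + (s - t) *\<^sub>R ip M u' (e n))))
      \<le> L2norm M (\<lambda>x. (u s x - u t x) /\<^sub>R (s - t) - u' x)" if s: "s \<in> T" "s \<noteq> t" for s
  proof -
    let ?q = "\<lambda>x. (u s x - u t x) /\<^sub>R (s - t) - u' x"
    have d1: "square_integrable M (\<lambda>x. u s x - u t x)" by (intro square_integrable_diff sqs s t)
    have q: "square_integrable M ?q" by (intro square_integrable_diff square_integrable_scaleR sqs sq' s t)
    have alg: "U - (V + h *\<^sub>R W) = h *\<^sub>R X"
      if X: "X = of_real (inverse h) * (U - V) - W" and h: "h \<noteq> 0" for U V W X :: complex and h :: real
    proof -
      have "of_real h * of_real (inverse h) = (1 :: complex)" using h by (simp flip: of_real_mult)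
      then show ?thesis
        unfolding X scaleR_conv_of_real right_diff_distrib[of "of_real h"] mult.assoc[symmetric] by simp
    qed
    have "ip M ?q (e n) = ip M (\<lambda>x. (u s x - u t x) /\<^sub>R (s - t)) (e n) - ip M u' (e n)"
      by (rule ip_diff_left[OF square_integrable_scaleR[OF d1] sq' sq])
    also have "ip M (\<lambda>x. (u s x - u t x) /\<^sub>R (s - t)) (e n) = of_real (inverse (s - t)) * (ip M (u s) (e n) - ip M (u t) (e n))"
      unfolding scaleR_conv_of_real ip_cmult_left ip_diff_left[OF sqs[OF s(1)] sqs[OF t] sq] ..
    finally have "ip M (u s) (e n) - (ip M (u t) (e n) + (s - t) *\<^sub>R ip M u' (e n)) = (s - t) *\<^sub>R ip M ?q (e n)"
      by (rule alg) (use s in simp)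
    then have "norm ((1 / norm (s - t)) *\<^sub>R (ip M (u s) (e n) - (ip M (u t) (e n) + (s - t) *\<^sub>R ip M u' (e n)))) = norm (ip M ?q (e n))"
      using s by simp
    with coeff_bound[OF q, of n] show ?thesis by simp
  qed
  then have "\<forall>\<^sub>F s in at t within T. norm ((1 / norm (s - t)) *\<^sub>R (ip M (u s) (e n) - (ip M (u t) (e n) + (s - t) *\<^sub>R ip M u' (e n))))
      \<le> L2norm M (\<lambda>x. (u s x - u t x) /\<^sub>R (s - t) - u' x)"
    by (auto simp: eventually_at_filter)
  from Lim_null_comparison[OF this lim] show ?thesis
    unfolding has_vector_derivative_def has_derivative_within by (simp add: bounded_linear_scaleR_left)
qed

lemma periodic_continuous_bounded:
  fixes h :: "real \<Rightarrow> 'b::real_normed_vector"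
  assumes per: "\<And>\<xi>. h (\<xi> + 1) = h \<xi>" and cont: "continuous_on UNIV h"
  obtains B where "\<And>\<xi>. norm (h \<xi>) \<le> B"
proof -
  have "compact (h ` {0..1})"
    by (rule compact_continuous_image[OF continuous_on_subset[OF cont]]) auto
  then obtain B where "\<forall>y\<in>h ` {0..1}. norm y \<le> B"
    using compact_imp_bounded[of "h ` {0..1}"] unfolding bounded_iff by blast
  then have B: "\<And>\<xi>. \<xi> \<in> {0..1} \<Longrightarrow> norm (h \<xi>) \<le> B" by blast
  have "norm (h \<xi>) \<le> B" for \<xi>
  proof -
    have "h \<xi> = h (frac \<xi> + of_int \<lfloor>\<xi>\<rfloor>)" by (simp add: frac_def)
    also have "\<dots> = h (frac \<xi>)" by (rule periodic_int[of h, OF per])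
    finally show ?thesis using B[of "frac \<xi>"] frac_lt_1[of \<xi>] by simp
  qed
  then show thesis by (rule that)
qed

text \<open>Second-order Taylor estimate, uniform in 0 \<le> s \<le> S; it makes a continuous packet
  of exponentials differentiable in L2.\<close>

lemma exp_difference_quotient:
  fixes s h S :: real
  assumes "0 \<le> s" "s \<le> S" "h \<noteq> 0" "\<bar>h\<bar> \<le> 1"
  shows "\<bar>(exp (s * h) - 1) / h - s\<bar> \<le> exp S * S\<^sup>2 * \<bar>h\<bar>"
proof -
  let ?x = "s * h"
  have x: "\<bar>?x\<bar> \<le> S * \<bar>h\<bar>" using assms by (simp add: abs_mult mult_right_mono)
  also have "S * \<bar>h\<bar> \<le> S * 1" using assms by (intro mult_left_mono) auto
  finally have x1: "\<bar>?x\<bar> \<le> S" by simp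
  have "\<bar>exp ?x - 1 - ?x\<bar> \<le> exp \<bar>?x\<bar> * \<bar>?x\<bar>\<^sup>2"
    using Taylor_exp_field[of ?x 1] by (simp add: power2_eq_square algebra_simps)
  also have "\<dots> \<le> exp S * (S * \<bar>h\<bar>)\<^sup>2"
    using x x1 by (intro mult_mono power_mono) auto
  finally have *: "\<bar>exp ?x - 1 - ?x\<bar> \<le> exp S * (S * \<bar>h\<bar>)\<^sup>2" .
  have "\<bar>(exp ?x - 1) / h - s\<bar> = \<bar>exp ?x - 1 - ?x\<bar> / \<bar>h\<bar>"
  proof -
    have "(exp ?x - 1) / h - s = (exp ?x - 1 - ?x) / h" using assms(3) by (simp add: diff_divide_distrib)
    then show ?thesis by (simp only: abs_divide)
  qed
  also have "\<dots> \<le> exp S * (S * \<bar>h\<bar>)\<^sup>2 / \<bar>h\<bar>"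
    by (rule divide_right_mono[OF *]) simp
  also have "\<dots> = exp S * S\<^sup>2 * \<bar>h\<bar>"
    using assms(3) by (simp add: power2_eq_square)
  finally show ?thesis .
qed

context rectangular_lattice
begin

section \<open>Uniqueness and growing modes\<close>

lemma gen_diff:
  assumes c: "\<And>n. norm (c n) \<le> C" and d: "\<And>n. norm (d n) \<le> D"
  shows "gen c n - gen d n = gen (\<lambda>n. c n - d n) n"
proof -
  let ?t = "\<lambda>c. \<lambda>(p, q). of_real (C_M \<gamma> * gw \<gamma> p * gw \<gamma> q) * (2 * c (n + q) + cnj (c (n + p + q)))"
  have "((\<lambda>pq. ?t c pq + - 1 * ?t d pq) has_sum lin c n + - 1 * lin d n) UNIV"
    by (intro has_sum_add has_sum_cmult_right lin_has_sum[of c C, OF c] lin_has_sum[of d D, OF d])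
  moreover have "(\<lambda>pq. ?t c pq + - 1 * ?t d pq) = ?t (\<lambda>n. c n - d n)"
    by (auto simp: fun_eq_iff algebra_simps)
  ultimately have "lin (\<lambda>n. c n - d n) n = lin c n - lin d n"
    unfolding lin_def[of "\<lambda>n. c n - d n"] by (simp only: infsumI) simp
  then show ?thesis by (simp only: gen_def) (simp add: algebra_simps)
qed

lemma solution_coefficients:
  assumes sol: "solves_linearized \<gamma> T u" and t: "t \<in> T"
  shows "u t \<in> L2F \<gamma>"
    and "((\<lambda>s. coef (u s) n) has_vector_derivative gen (coef (u t)) n) (at t within T)"
    and "\<exists>u'. has_L2_derivative (lebesgue_on (strip \<gamma>)) u u' t T"
proof -
  have uT: "\<And>t. t \<in> T \<Longrightarrow> u t \<in> L2F \<gamma>" using sol by (simp add: solves_linearized_def)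
  show "u t \<in> L2F \<gamma>" by (rule uT[OF t])
  have "solves_linearized \<gamma> T u \<longleftrightarrow> (\<forall>t\<in>T. bseries (gen (coef (u t))) \<in> L2F \<gamma> \<and>
     has_L2_derivative (lebesgue_on (strip \<gamma>)) u (bseries (gen (coef (u t)))) t T)"
    by (rule solves_linearized_coeffs[OF uT])
  then have b: "bseries (gen (coef (u t))) \<in> L2F \<gamma>"
    and d: "has_L2_derivative (lebesgue_on (strip \<gamma>)) u (bseries (gen (coef (u t)))) t T"
    using sol t by auto
  show "\<exists>u'. has_L2_derivative (lebesgue_on (strip \<gamma>)) u u' t T" using d by blast
  have "coef (bseries (gen (coef (u t)))) n = gen (coef (u t)) n"
    by (rule coef_bseries[OF b gen_bound[of "coef (u t)", OF coef_bounded[OF uT[OF t]]]])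
  with psi.coefficient_derivative[OF d t, of n]
  show "((\<lambda>s. coef (u s) n) has_vector_derivative gen (coef (u t)) n) (at t within T)" by simp
qed

text \<open>Picard iteration on the coefficients: \<open>gen\<close> is bounded for the supremum norm, so the difference
  of two solutions with the same initial value is at most \<open>M (K t)\<^sup>j / j!\<close> for every \<open>j\<close>.\<close>

lemma linearized_unique:
  assumes u: "solves_linearized \<gamma> {0..} u" and v: "solves_linearized \<gamma> {0..} v"
    and init: "u 0 = v 0" and t: "t \<ge> 0"
  shows "u t = v t"
proof (cases "t = 0")
  case True
  then show ?thesis using init by simp
next
  case False
  then have tpos: "t > 0" using t by simp
  note us = solution_coefficients[OF u] and vs = solution_coefficients[OF v]
  define \<delta> where "\<delta> n s = coef (u s) n - coef (v s) n" for n s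
  define K where "K = 3 * C_M \<gamma> * gw_mass + \<bar>lam \<gamma>\<bar>"
  have K0: "K \<ge> 0"
    unfolding K_def using gw_mass(2) C_M_pos[of \<gamma>] by simp
  have cont: "continuous_on {0..} (\<lambda>s. L2norm (lebesgue_on (strip \<gamma>)) (u s))"
    "continuous_on {0..} (\<lambda>s. L2norm (lebesgue_on (strip \<gamma>)) (v s))"
    by (rule has_L2_derivative_continuous_norm, rule us(3) vs(3), simp)+
  define m where "m s = L2norm (lebesgue_on (strip \<gamma>)) (u s) + L2norm (lebesgue_on (strip \<gamma>)) (v s)" for s
  have mc: "continuous_on {0..t} m"
    unfolding m_def by (intro continuous_intros continuous_on_subset[OF cont(1)] continuous_on_subset[OF cont(2)]) auto
  obtain M where M: "\<And>s. s \<in> {0..t} \<Longrightarrow> m s \<le> M"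
  proof -
    obtain M where M: "\<forall>y\<in>m ` {0..t}. norm y \<le> M"
      using compact_imp_bounded[OF compact_continuous_image[OF mc compact_Icc]] unfolding bounded_iff by blast
    have "m s \<le> M" if "s \<in> {0..t}" for s
    proof -
      have "norm (m s) \<le> M" using M that by blast
      then show ?thesis by simp
    qed
    then show thesis by (rule that)
  qed
  have dm: "norm (\<delta> n s) \<le> M" if "s \<in> {0..t}" for n s
  proof -
    have "norm (\<delta> n s) \<le> norm (coef (u s) n) + norm (coef (v s) n)"
      unfolding \<delta>_def by (rule norm_triangle_ineq4)
    also have "\<dots> \<le> m s" unfolding m_def
      using that by (intro add_mono coef_bounded us(1) vs(1)) auto
    finally show ?thesis using M[OF that] by simp
  qed
  have deriv: "((\<lambda>s. \<delta> n s) has_vector_derivative gen (\<lambda>n. \<delta> n s) n) (at s within {0..})" if "s \<ge> 0" for n s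
  proof -
    have "((\<lambda>s. coef (u s) n - coef (v s) n) has_vector_derivative (gen (coef (u s)) n - gen (coef (v s)) n)) (at s within {0..})"
      using that by (intro has_vector_derivative_diff us(2) vs(2)) auto
    moreover have "gen (coef (u s)) n - gen (coef (v s)) n = gen (\<lambda>n. coef (u s) n - coef (v s) n) n"
      by (rule gen_diff) (rule coef_bounded, rule us(1) vs(1), use that in simp)+
    ultimately show ?thesis by (simp add: \<delta>_def)
  qed
  have dcont: "continuous_on {0..} (\<delta> n)" for n
    using has_vector_derivative_continuous[OF deriv] unfolding continuous_on_eq_continuous_within by auto
  have main: "norm (\<delta> n s) \<le> M * (K * s) ^ j / fact j" if "s \<in> {0..t}" for n s j
    using that
  proof (induction j arbitrary: n s)
    case 0
    then show ?case using dm by simp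
  next
    case (Suc j)
    show ?case
    proof (cases "s = 0")
      case True
      then show ?thesis using init by (simp add: \<delta>_def)
    next
      case False
      then have s: "0 < s" "s \<le> t" using Suc.prems by auto
      \<comment> \<open>\<phi>' is \<open>K\<close> times the bound of the previous stage and \<phi>
        is its primitive vanishing at 0; the mean value estimate then gives the next stage.\<close>
      define \<phi> where "\<phi> x = M * (K * x) ^ Suc j / fact (Suc j)" for x
      define \<phi>' where "\<phi>' x = K * (M * (K * x) ^ j / fact j)" for x
      have "norm (\<delta> n s - \<delta> n 0) \<le> \<phi> s - \<phi> 0"
      proof (rule differentiable_bound_general[OF s(1)])
        show "continuous_on {0..s} (\<delta> n)" by (rule continuous_on_subset[OF dcont]) auto
        show "continuous_on {0..s} \<phi>" unfolding \<phi>_def by (intro continuous_intros) simp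
        fix x assume x: "0 < x" "x < s"
        \<comment> \<open>For x > 0 the derivative relative to {0..} is the two-sided one that the
          estimate asks for.\<close>
        have "x \<in> interior {0..}" using x by simp
        from at_within_interior[OF this] show "(\<delta> n has_vector_derivative gen (\<lambda>n. \<delta> n x) n) (at x)"
          using deriv[OF less_imp_le[OF x(1)], of n] by (simp only:)
        have "(\<phi> has_real_derivative M * (real (Suc j) * (K * x) ^ j * K) / fact (Suc j)) (at x)"
          unfolding \<phi>_def by (auto intro!: derivative_eq_intros simp del: power_Suc)
        also have "M * (real (Suc j) * (K * x) ^ j * K) / fact (Suc j) = \<phi>' x"
          unfolding \<phi>'_def by (simp add: fact_Suc field_simps del: of_nat_Suc)
        finally show "(\<phi> has_vector_derivative \<phi>' x) (at x)"
          by (simp add: has_real_derivative_iff_has_vector_derivative)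
        show "norm (gen (\<lambda>n. \<delta> n x) n) \<le> \<phi>' x"
          unfolding \<phi>'_def K_def
          by (rule gen_bound) (rule Suc.IH[unfolded K_def], use x s in auto)
      qed
      then show ?thesis using init by (simp add: \<phi>_def \<delta>_def)
    qed
  qed
  have "(\<lambda>j. M * ((K * t) ^ j / fact j)) \<longlonglongrightarrow> M * 0"
  proof (intro tendsto_intros)
    show "(\<lambda>j. (K * t) ^ j / fact j) \<longlonglongrightarrow> 0"
      using summable_LIMSEQ_zero[OF summable_exp[of "K * t"]] by (simp add: divide_inverse mult.commute)
  qed
  then have lim: "(\<lambda>j. M * (K * t) ^ j / fact j) \<longlonglongrightarrow> 0" by simp
  have "norm (\<delta> n t) \<le> 0" for n
    by (rule LIMSEQ_le_const[OF lim]) (use main[of t] t in auto)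
  then have "coef (u t) = coef (v t)" by (auto simp: \<delta>_def fun_eq_iff)
  then show ?thesis
    using L2F_eq_bseries[OF us(1)[of t]] L2F_eq_bseries[OF vs(1)[of t]] t by simp
qed

text \<open>With z = b - a - i s, multiplying a z + b conj(z) by -i gives s (b - a) - i (b^2 - a^2),
  which is s z when s^2 = b^2 - a^2. The amplitude \<open>r\<close> is real because the equation
  contains a conjugate; the alternative r = 0 covers the points outside the cut-off.\<close>

lemma fgen_mode:
  fixes r s :: real
  assumes "r = 0 \<or> s\<^sup>2 = (b_rect \<gamma> \<xi>)\<^sup>2 - (a_rect \<gamma> \<xi>)\<^sup>2"
    and f: "f \<xi> = of_real r * (of_real (b_rect \<gamma> \<xi> - a_rect \<gamma> \<xi>) - \<i> * of_real s)"
    and f': "f (- \<xi>) = f \<xi>"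
  shows "fgen f \<xi> = of_real s * f \<xi>"
proof (cases "r = 0")
  case True
  then show ?thesis by (simp add: fgen_def f' f)
next
  case False
  let ?a = "a_rect \<gamma> \<xi>" and ?b = "b_rect \<gamma> \<xi>"
  have s2: "s * s = ?b * ?b - ?a * ?a" using assms(1) False by (simp add: power2_eq_square)
  have "- \<i> * (of_real ?a * (of_real (?b - ?a) - \<i> * of_real s) + of_real ?b * (of_real (?b - ?a) + \<i> * of_real s)) =
      of_real s * (of_real (?b - ?a) - \<i> * of_real s)"
    using s2 by (simp add: complex_eq_iff algebra_simps)
  then have "of_real r * (- \<i> * (of_real ?a * (of_real (?b - ?a) - \<i> * of_real s) + of_real ?b * (of_real (?b - ?a) + \<i> * of_real s))) =
      of_real r * (of_real s * (of_real (?b - ?a) - \<i> * of_real s))" by simp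
  then show ?thesis unfolding fgen_def f' f by (simp add: algebra_simps)
qed

text \<open>Packets of growing modes: where \<open>d = b\<^sup>2 - a\<^sup>2 > 0\<close>, the pair \<open>(z, z\<^sup>*)\<close> with \<open>z = b - a - i s\<close>,
  \<open>s = sqrt d\<close>, is an eigenvector of \<open>A\<^sub>r\<^sub>e\<^sub>c\<^sub>t\<close> for the eigenvalue \<open>i s\<close>, and it is even in \<open>\<xi>\<close>; the
  cut-off \<open>r\<close> keeps only modes with \<open>s \<ge> \<sigma>\<close>.\<close>

lemma exponentially_unstable: "exponentially_unstable \<gamma>"
proof -
  let ?a = "a_rect \<gamma>" and ?b = "b_rect \<gamma>" and ?S = "lebesgue_on (strip \<gamma>)"
  define d where "d \<xi> = (?b \<xi>)\<^sup>2 - (?a \<xi>)\<^sup>2" for \<xi>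
  have "\<forall>\<^sub>F \<xi> in at (0::real). ?a \<xi> + ?b \<xi> > 0 \<and> \<xi> \<notin> \<int>"
    using a_plus_b_near_0[OF gamma_neq_0] not_Ints_near_0 by (rule eventually_conj)
  then obtain \<xi>0 where \<xi>0: "?a \<xi>0 + ?b \<xi>0 > 0" "\<xi>0 \<notin> \<int>"
    using eventually_happens'[of "at (0::real)"] by auto
  have ab: "?a \<xi>0 < ?b \<xi>0" by (rule a_less_b[OF gamma_neq_0 \<xi>0(2)])
  have "d \<xi>0 = (?b \<xi>0 - ?a \<xi>0) * (?a \<xi>0 + ?b \<xi>0)" by (simp add: d_def power2_eq_square algebra_simps)
  then have d0: "d \<xi>0 > 0" using \<xi>0(1) ab by simp
  \<comment> \<open>Half of d(\<xi>0): the cut-off \<open>r\<close> below is then positive at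
    \<xi>0, while s \<ge> \<sigma> wherever \<open>r\<close> is nonzero.\<close>
  define \<sigma> where "\<sigma> = sqrt (d \<xi>0 / 2)"
  have \<sigma>: "\<sigma> > 0" "\<sigma>\<^sup>2 = d \<xi>0 / 2" using d0 by (simp_all add: \<sigma>_def)
  \<comment> \<open>Truncation at 0 keeps s real and continuous where d is negative;
    \<open>r\<close> vanishes there.\<close>
  define s where "s \<xi> = sqrt (max 0 (d \<xi>))" for \<xi>
  define r where "r \<xi> = max 0 (d \<xi> - \<sigma>\<^sup>2)" for \<xi>
  define g where "g \<xi> = of_real (r \<xi>) * (of_real (?b \<xi> - ?a \<xi>) - \<i> * of_real (s \<xi>))" for \<xi>
  define f where "f t \<xi> = of_real (exp (s \<xi> * t)) * g \<xi>" for t \<xi>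
  have ca: "continuous_on UNIV ?a" "continuous_on UNIV ?b"
    unfolding a_rect_def b_rect_def by (intro continuous_intros continuous_on_ell gamma_neq_0)+
  have cd: "continuous_on UNIV d" unfolding d_def by (intro continuous_intros ca)
  have cs: "continuous_on UNIV s" unfolding s_def by (intro continuous_intros cd)
  have cr: "continuous_on UNIV r" unfolding r_def by (intro continuous_intros cd)
  have cg: "continuous_on UNIV g" unfolding g_def by (intro continuous_intros ca cs cr)
  have cf: "continuous_on UNIV (f t)" for t unfolding f_def by (intro continuous_intros cs cg)
  have pd: "d (\<xi> + 1) = d \<xi>" for \<xi> by (simp add: d_def a_rect_periodic b_rect_periodic)
  have ps: "s (\<xi> + 1) = s \<xi>" for \<xi> by (simp add: s_def pd)
  have pg: "g (\<xi> + 1) = g \<xi>" for \<xi> by (simp add: g_def r_def ps pd a_rect_periodic b_rect_periodic)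
  have pf: "f t (\<xi> + 1) = f t \<xi>" for t \<xi> by (simp add: f_def ps pg)
  have ef: "f t (- \<xi>) = f t \<xi>" for t \<xi>
    by (simp add: f_def g_def r_def s_def d_def a_rect_minus b_rect_minus)
  have s0: "s \<xi> \<ge> 0" for \<xi> by (simp add: s_def)
  obtain S where "\<And>\<xi>. norm (s \<xi>) \<le> S" using periodic_continuous_bounded[of s, OF ps cs] by blast
  then have S: "s \<xi> \<le> S" for \<xi> using abs_le_D1 by (metis real_norm_def)
  obtain B where B: "\<And>\<xi>. norm (g \<xi>) \<le> B" using periodic_continuous_bounded[of g, OF pg cg] by blast
  have sqf: "square_integrable period (f t)" for t by (rule square_integrable_continuous[OF cf])
  have gen_f: "fgen (f t) = (\<lambda>\<xi>. of_real (s \<xi>) * f t \<xi>)" for t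
  proof
    fix \<xi>
    show "fgen (f t) \<xi> = of_real (s \<xi>) * f t \<xi>"
    proof (rule fgen_mode[where r = "exp (s \<xi> * t) * r \<xi>"])
      show "exp (s \<xi> * t) * r \<xi> = 0 \<or> (s \<xi>)\<^sup>2 = (?b \<xi>)\<^sup>2 - (?a \<xi>)\<^sup>2"
      proof (cases "d \<xi> \<le> \<sigma>\<^sup>2")
        case False
        then have "d \<xi> > 0" using zero_le_power2[of \<sigma>] by linarith
        then show ?thesis by (simp add: s_def) (simp add: d_def)
      qed (simp add: r_def)
      show "f t \<xi> = of_real (exp (s \<xi> * t) * r \<xi>) * (of_real (?b \<xi> - ?a \<xi>) - \<i> * of_real (s \<xi>))"
        by (simp add: f_def g_def mult.assoc)
    qed (rule ef)
  qed
  have sqg: "square_integrable period (fgen (f t))" for t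
    unfolding gen_f by (rule square_integrable_continuous) (intro continuous_intros cs cf)
  have der: "has_L2_derivative period f (fgen (f t)) t {0..}" if t: "t \<ge> 0" for t
    unfolding has_L2_derivative_def
  proof (intro conjI ballI sqf sqg)
    \<comment> \<open>The factors bound the growth up to time t, the amplitude of the packet and the
      second-order error of the exponential.\<close>
    define Q where "Q = exp (S * t) * B * (exp S * S\<^sup>2)"
    have q: "L2norm period (\<lambda>x. (f \<tau> x - f t x) /\<^sub>R (\<tau> - t) - fgen (f t) x) \<le> Q * \<bar>\<tau> - t\<bar>"
      if \<tau>: "\<tau> \<noteq> t" "\<bar>\<tau> - t\<bar> \<le> 1" for \<tau>
    proof (rule L2norm_period_le)
      show "square_integrable period (\<lambda>x. (f \<tau> x - f t x) /\<^sub>R (\<tau> - t) - fgen (f t) x)"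
        by (intro square_integrable_diff square_integrable_scaleR sqf sqg)
      fix \<xi>
      let ?h = "\<tau> - t"
      have e: "exp (s \<xi> * \<tau>) = exp (s \<xi> * t) * exp (s \<xi> * ?h)"
        by (simp add: algebra_simps flip: exp_add)
      have "(f \<tau> \<xi> - f t \<xi>) /\<^sub>R ?h - fgen (f t) \<xi> = of_real (exp (s \<xi> * t) * ((exp (s \<xi> * ?h) - 1) / ?h - s \<xi>)) * g \<xi>"
        unfolding gen_f f_def e by (simp add: scaleR_conv_of_real divide_inverse algebra_simps)
      then have "norm ((f \<tau> \<xi> - f t \<xi>) /\<^sub>R ?h - fgen (f t) \<xi>) = exp (s \<xi> * t) * \<bar>(exp (s \<xi> * ?h) - 1) / ?h - s \<xi>\<bar> * norm (g \<xi>)"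
        by (simp only: norm_mult norm_of_real abs_mult abs_exp_cancel)
      also have "\<dots> \<le> exp (S * t) * (exp S * S\<^sup>2 * \<bar>?h\<bar>) * B"
        using \<tau> t S[of \<xi>] s0[of \<xi>] B[of \<xi>]
        by (intro mult_mono exp_difference_quotient) (auto intro: mult_right_mono)
      also have "\<dots> = Q * \<bar>?h\<bar>" by (simp add: Q_def)
      finally show "norm ((f \<tau> \<xi> - f t \<xi>) /\<^sub>R ?h - fgen (f t) \<xi>) \<le> Q * \<bar>?h\<bar>" .
    qed
    have "\<forall>\<^sub>F \<tau> in at t within {0..}. norm (L2norm period (\<lambda>x. (f \<tau> x - f t x) /\<^sub>R (\<tau> - t) - fgen (f t) x)) \<le> Q * \<bar>\<tau> - t\<bar>"
      unfolding eventually_at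
      by (intro exI[of _ 1]) (auto simp: dist_real_def L2norm_nonneg intro!: q)
    moreover have "((\<lambda>\<tau>. Q * \<bar>\<tau> - t\<bar>) \<longlongrightarrow> Q * \<bar>t - t\<bar>) (at t within {0..})"
      by (intro tendsto_intros)
    then have "((\<lambda>\<tau>. Q * \<bar>\<tau> - t\<bar>) \<longlongrightarrow> 0) (at t within {0..})" by simp
    ultimately show "((\<lambda>\<tau>. L2norm period (\<lambda>x. (f \<tau> x - f t x) /\<^sub>R (\<tau> - t) - fgen (f t) x)) \<longlongrightarrow> 0) (at t within {0..})"
      by (rule Lim_null_comparison)
  qed
  have sol_f: "solves_fourier \<gamma> {0..} f"
    using solves_fourier_fgen[of "{0..}" f, OF pf sqf sqg] der by simp
  define c where "c t n = ip period (f t) (fchar n)" for t n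
  define v where "v t = bseries (c t)" for t
  have fc: "L2_expansion period fchar (c t) (f t)" for t
    unfolding c_def by (rule fourier_expansion_continuous[OF pf cf])
  have csum: "(\<lambda>n. (norm (c t n))\<^sup>2) summable_on UNIV" for t
    using fourier.expansion_Parseval[OF fc] by (auto simp: summable_on_def)
  note vL = bseries_expansion(1)[OF csum, folded v_def] and vc = bseries_expansion(2)[OF csum, folded v_def]
  have sol_v: "solves_linearized \<gamma> {0..} v"
    using linearized_fourier_equivalence[of "{0..}" v c f, OF vL vc pf fc] sol_f by simp
  have norm_v: "L2norm ?S (v t) = L2norm period (f t)" for t
    by (rule expansion_L2norm_eq[OF psi.orthonormal_family_axioms fourier.orthonormal_family_axioms vc fc])
  have growth: "L2norm period (f t) \<ge> exp (\<sigma> * t) * L2norm period (f 0)" if t: "t \<ge> 0" for t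
  proof -
    \<comment> \<open>Pointwise growth: outside the cut-off both sides are 0, inside it s \<ge>
      \<sigma>.\<close>
    have "norm (of_real (exp (\<sigma> * t)) * f 0 \<xi>) \<le> norm (f t \<xi>)" for \<xi>
    proof (cases "r \<xi> = 0")
      case True
      then show ?thesis by (simp add: f_def g_def)
    next
      case False
      then have "\<sigma>\<^sup>2 < d \<xi>" by (auto simp: r_def max_def split: if_splits)
      then have "\<sigma> \<le> s \<xi>" unfolding s_def by (intro real_le_rsqrt) simp
      then have "exp (\<sigma> * t) \<le> exp (s \<xi> * t)" using t by (simp add: mult_right_mono)
      then show ?thesis by (simp add: f_def norm_mult mult_right_mono)
    qed
    then have "(norm (of_real (exp (\<sigma> * t)) * f 0 \<xi>))\<^sup>2 \<le> (norm (f t \<xi>))\<^sup>2" for \<xi>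
      by (intro power_mono) auto
    then have "(L2norm period (\<lambda>\<xi>. of_real (exp (\<sigma> * t)) * f 0 \<xi>))\<^sup>2 \<le> (L2norm period (f t))\<^sup>2"
      unfolding L2norm_sq
      using square_integrable_cmult[OF sqf[of 0], of "of_real (exp (\<sigma> * t))"] sqf[of t]
      by (intro integral_mono) (simp_all only: square_integrable_def)
    then have "L2norm period (\<lambda>\<xi>. of_real (exp (\<sigma> * t)) * f 0 \<xi>) \<le> L2norm period (f t)"
      by (rule power2_le_imp_le) (rule L2norm_nonneg)
    then show ?thesis by (simp add: L2norm_cmult)
  qed
  have "L2norm period (f 0) \<noteq> 0"
  proof
    assume z: "L2norm period (f 0) = 0"
    \<comment> \<open>Zero norm would make all coefficients zero and hence the continuous
      \<open>f 0\<close> vanish identically, against its value at \<xi>0, whose real part is r (b -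
      a) > 0.\<close>
    have "ip period (f 0) (fchar n) = 0" for n
      using fourier.coeff_bound[OF sqf, of 0 n] z by simp
    then have "f 0 \<xi>0 = 0" by (rule fourier_unique_0[OF pf cf])
    moreover have "r \<xi>0 > 0" using \<sigma>(2) d0 by (simp add: r_def)
    moreover have "of_real (?b \<xi>0 - ?a \<xi>0) - \<i> * of_real (s \<xi>0) \<noteq> 0"
      using ab by (auto simp: complex_eq_iff)
    ultimately show False by (simp add: f_def g_def)
  qed
  then have f0: "L2norm period (f 0) > 0" using L2norm_nonneg[of period "f 0"] by linarith
  show ?thesis
    unfolding exponentially_unstable_def
  proof (intro bexI exI conjI allI impI)
    show "v 0 \<in> L2F \<gamma>" by (rule vL)
    show "L2norm period (f 0) > 0" by (rule f0)
    show "\<sigma> > 0" by (rule \<sigma>(1))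
    show "solves_linearized \<gamma> {0..} v" by (rule sol_v)
    show "v 0 = v 0" ..
    fix u t assume u: "solves_linearized \<gamma> {0..} u \<and> u 0 = v 0" and t: "(0::real) \<le> t"
    have "u t = v t" by (rule linearized_unique[OF _ sol_v _ t]) (use u in auto)
    then show "L2norm ?S (u t) \<ge> L2norm period (f 0) * exp (\<sigma> * t)"
      using growth[OF t] by (simp add: norm_v mult.commute)
  qed
qed

end

theorem theorem4p1:
  fixes \<gamma> :: real and \<tau> :: complex
  assumes "\<gamma> > 0" and "\<tau> = \<i> * of_real (pi / \<gamma>\<^sup>2)"
  shows
    "(\<forall>(T :: real set) (v :: real \<Rightarrow> complex \<Rightarrow> complex) (c :: real \<Rightarrow> int \<Rightarrow> complex)
        (f :: real \<Rightarrow> real \<Rightarrow> complex).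
        is_interval T \<and>
        (\<forall>t\<in>T. v t \<in> L2F \<gamma> \<and> L2_expansion (lebesgue_on (strip \<gamma>)) (psi \<gamma>) (c t) (v t)) \<and>
        (\<forall>t\<in>T. (\<forall>\<xi>. f t (\<xi> + 1) = f t \<xi>) \<and>
           L2_expansion (lebesgue_on {0..1})
             (\<lambda>n \<xi>. exp (- 2 * of_real pi * \<i> * of_int n * of_real \<xi>)) (c t) (f t)) \<longrightarrow>
        (solves_linearized \<gamma> T v \<longleftrightarrow> solves_fourier \<gamma> T f))
     \<and> (\<forall>\<xi>. \<xi> \<notin> \<int> \<and> a_rect \<gamma> \<xi> + b_rect \<gamma> \<xi> \<noteq> 0 \<longrightarrow>
          invertible (P_rect \<gamma> \<xi>) \<and>
          A_rect \<gamma> \<xi> = P_rect \<gamma> \<xi> ** D_rect \<gamma> \<xi> ** matrix_inv (P_rect \<gamma> \<xi>))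
     \<and> (\<forall>\<^sub>F \<xi> in at 0. mu \<gamma> \<xi> \<in> range (\<lambda>y. \<i> * of_real y) - {0})
     \<and> (\<tau> = \<i> \<longrightarrow> (\<forall>\<xi>. \<xi> \<notin> \<int> \<longrightarrow> mu \<gamma> \<xi> \<in> range (\<lambda>y. \<i> * of_real y) - {0}))
     \<and> exponentially_unstable \<gamma>"
proof (intro conjI)
  interpret rectangular_lattice \<gamma> by unfold_locales (rule assms(1))
  show "\<forall>(T :: real set) (v :: real \<Rightarrow> complex \<Rightarrow> complex) (c :: real \<Rightarrow> int \<Rightarrow> complex)
        (f :: real \<Rightarrow> real \<Rightarrow> complex).
        is_interval T \<and>
        (\<forall>t\<in>T. v t \<in> L2F \<gamma> \<and> L2_expansion (lebesgue_on (strip \<gamma>)) (psi \<gamma>) (c t) (v t)) \<and>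
        (\<forall>t\<in>T. (\<forall>\<xi>. f t (\<xi> + 1) = f t \<xi>) \<and>
           L2_expansion (lebesgue_on {0..1})
             (\<lambda>n \<xi>. exp (- 2 * of_real pi * \<i> * of_int n * of_real \<xi>)) (c t) (f t)) \<longrightarrow>
        (solves_linearized \<gamma> T v \<longleftrightarrow> solves_fourier \<gamma> T f)"
    unfolding fchar_fun by (intro allI impI linearized_fourier_equivalence) auto
  show "\<forall>\<xi>. \<xi> \<notin> \<int> \<and> a_rect \<gamma> \<xi> + b_rect \<gamma> \<xi> \<noteq> 0 \<longrightarrow>
          invertible (P_rect \<gamma> \<xi>) \<and>
          A_rect \<gamma> \<xi> = P_rect \<gamma> \<xi> ** D_rect \<gamma> \<xi> ** matrix_inv (P_rect \<gamma> \<xi>)"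
    using A_rect_diagonalization[OF gamma_neq_0] by blast
  show "\<forall>\<^sub>F \<xi> in at 0. mu \<gamma> \<xi> \<in> range (\<lambda>y. \<i> * of_real y) - {0}"
    by (rule mu_near_0[OF gamma_neq_0])
  show "\<tau> = \<i> \<longrightarrow> (\<forall>\<xi>. \<xi> \<notin> \<int> \<longrightarrow> mu \<gamma> \<xi> \<in> range (\<lambda>y. \<i> * of_real y) - {0})"
  proof (intro impI allI)
    fix \<xi> :: real assume "\<tau> = \<i>" and \<xi>: "\<xi> \<notin> \<int>"
    then have "pi / \<gamma>\<^sup>2 = 1" using assms(2) by (simp add: complex_eq_iff)
    then have "\<gamma>\<^sup>2 = pi" by (simp add: field_simps)
    then show "mu \<gamma> \<xi> \<in> range (\<lambda>y. \<i> * of_real y) - {0}"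
      by (rule mu_square_lattice[OF gamma_neq_0 _ \<xi>])
  qed
  show "exponentially_unstable \<gamma>" by (rule exponentially_unstable)
qed

end
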